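(* Let $C$ be a non-hyperelliptic smooth complex projective curve of genus $g\ge4$, let $\omega\in H^0(K_C)$, $\omega\ne0$, have zero divisor $Z=\sum_k n_kp_k$ (distinct $p_k$), let $f_k(z_k)=\sum_{j=0}^{n_k-1}\beta_{j,k}z_k^j$ be polynomials in local coordinates $z_k$ centred at $p_k$, let $\rho=\sum_k\tilde\rho f_k$ and $\zeta=[\bar\partial(\rho/\omega)]\in H^1(C,T_C)$. Let $Q=\sum_{i=1}^s\omega_{2i-1}\odot\omega_{2i}\in I_2$ with $\omega_1,\dots,\omega_{2s}\in H^0(K_C)$, and let $g_j=\omega_j/\omega$. Assume that $\rho g_{2i-1}$ is $C^\infty$ for every $i=1,\dots,s$. Then $$II(Q)(\zeta\odot\zeta)=-\sum_{i=1}^s w(\zeta,\omega_{2i-1},\omega_{2i}),$$ where $$w(\zeta,\omega_{2i-1},\omega_{2i})=2\pi i\sum_{p_k\in \mathrm{Supp}(Z)}\mathrm{Res}_{p_k}\big(f_k\,g_{2i-1}\,d(f_k\,g_{2i})\big)$$ (in the prefactor $2\pi i$ the letter $i$ denotes $\sqrt{-1}$).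
   Context: $K_C$ is the canonical bundle, $T_C$ the tangent bundle, $I_2=\ker(\mathrm{Sym}^2H^0(K_C)\to H^0(K_C^{\otimes2}))$, and $a\odot b=a\otimes b+b\otimes a$. The cut-off function: choose pairwise disjoint coordinate neighbourhoods $(U_k,z_k)$ centred at the points $p_k$, and closed disks $D_k\subset\Delta_k\subset U_k$ around $p_k$ with $D_k$ in the interior of $\Delta_k$; $\tilde\rho$ is a $C^\infty$ function on $C$ equal to $1$ on $\bigcup_kD_k$ and to $0$ on $C\setminus\bigcup_k\Delta_k$. The function $\rho$ is thus equal to $\tilde\rho f_k$ on $U_k$ and $0$ elsewhere. If $\omega=g(z)dz$ locally, $1/\omega$ denotes the meromorphic section $\frac1{g(z)}\frac{\partial}{\partial z}$ of $T_C$; $\bar\partial(\rho/\omega)$ is a smooth $T_C$-valued $(0,1)$-form on $C$ (it vanishes near each $p_k$), and $\zeta$ is its Dolbeault class. $II:I_2\to\mathrm{Sym}^2H^0(K_C^{\otimes2})$ is the second fundamental form at $[C]$ of the Torelli map $\mathcal M_g\to\mathcal A_g$ (non-hyperelliptic locus) with respect to the Siegel metric, identified with (normalised as) the Hodge–Gaussian map: for $Q=\sum a_{ij}\,\omega_i\otimes\omega_j\in I_2$ ($a_{ij}=a_{ji}$) and $\zeta=[\Theta]$, $\Theta$ a smooth $T_C$-valued $(0,1)$-form, write $\Theta\omega_i=\gamma_i+\bar\partial h_i$ with $\gamma_i$ a harmonic $(0,1)$-form and $h_i\in C^\infty(C)$; then $II(Q)(\zeta)=\sum a_{ij}\,\omega_i\,\partial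 h_j\in H^0(K_C^{\otimes2})$. The number $II(Q)(\zeta\odot\zeta)$ is the Serre-duality pairing of $II(Q)(\zeta)$ with $\zeta$, where a quadratic differential locally $f\,dz^2$ and $\Theta$ locally $\theta\,d\bar z\,\frac{\partial}{\partial z}$ are paired as $\int_Cf\theta\,dz\wedge d\bar z$; explicitly $II(Q)(\zeta\odot\zeta)=\sum a_{ij}\int_C\partial h_j\wedge\Theta\omega_i$. *)

theory Defs
  imports "HOL-Complex_Analysis.Complex_Analysis" "HOL-Library.Function_Algebras"
begin

section \<open>Smooth functions on open subsets of the complex plane\<close>

text \<open>\<open>Ck k S f\<close>: \<open>f\<close> is of class \<open>C\<^sup>k\<close> in the real sense on the open set \<open>S\<close>.\<close>

primrec Ck :: "nat \<Rightarrow> complex set \<Rightarrow> (complex \<Rightarrow> complex) \<Rightarrow> bool" where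
  "Ck 0 S f \<longleftrightarrow> continuous_on S f"
| "Ck (Suc k) S f \<longleftrightarrow>
     f differentiable_on S \<and> (\<forall>v. Ck k S (\<lambda>z. frechet_derivative f (at z) v))"

definition smooth_on :: "complex set \<Rightarrow> (complex \<Rightarrow> complex) \<Rightarrow> bool" where
  "smooth_on S f \<longleftrightarrow> (\<forall>k. Ck k S f)"

text \<open>The Wirtinger derivatives, with respect to \<open>z\<close> and to its conjugate.\<close>

definition d_z :: "(complex \<Rightarrow> complex) \<Rightarrow> complex \<Rightarrow> complex" where
  "d_z f z = (frechet_derivative f (at z) 1 - \<i> * frechet_derivative f (at z) \<i>) / 2"

definition d_zbar :: "(complex \<Rightarrow> complex) \<Rightarrow> complex \<Rightarrow> complex" where
  "d_zbar f z = (frechet_derivative f (at z) 1 + \<i> * frechet_derivative f (at z) \<i>) / 2"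


section \<open>Compact Riemann surfaces\<close>

text \<open>A smooth complex projective curve is treated as a compact connected Riemann surface. The
  surface is the whole type \<open>'a\<close>, and its complex structure is a maximal holomorphic atlas \<open>X\<close>,
  so that the members of \<open>X\<close> are exactly the local coordinates. A chart is a pair of a domain
  and a coordinate map, whose values outside the domain are irrelevant.\<close>

type_synonym 'a chart = "'a set \<times> ('a \<Rightarrow> complex)"

definition chart_inv :: "'a chart \<Rightarrow> complex \<Rightarrow> 'a" where
  "chart_inv c = inv_into (fst c) (snd c)"

definition chart_image :: "'a chart \<Rightarrow> complex set" where
  "chart_image c = snd c ` fst c"

definition is_chart :: "'a::topological_space chart \<Rightarrow> bool" where
  "is_chart c \<longleftrightarrow> open (fst c) \<and> open (chart_image c) \<and>
     homeomorphism (fst c) (chart_image c) (snd c) (chart_inv c)"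

definition compatible :: "'a chart \<Rightarrow> 'a chart \<Rightarrow> bool" where
  "compatible c d \<longleftrightarrow>
     (snd d \<circ> chart_inv c) holomorphic_on (snd c ` (fst c \<inter> fst d)) \<and>
     (snd c \<circ> chart_inv d) holomorphic_on (snd d ` (fst c \<inter> fst d))"

definition riemann_surface :: "'a::t2_space chart set \<Rightarrow> bool" where
  "riemann_surface X \<longleftrightarrow>
     (\<forall>c\<in>X. is_chart c) \<and> (\<Union>c\<in>X. fst c) = UNIV \<and>
     (\<forall>c\<in>X. \<forall>d\<in>X. compatible c d) \<and>
     (\<forall>c. is_chart c \<and> (\<forall>d\<in>X. compatible c d) \<longrightarrow> c \<in> X)"

definition compact_riemann_surface :: "'a::t2_space chart set \<Rightarrow> bool" where
  "compact_riemann_surface X \<longleftrightarrow>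
     riemann_surface X \<and> compact (UNIV :: 'a set) \<and> connected (UNIV :: 'a set)"

text \<open>Some coordinate around \<open>p\<close>, for notions that do not depend on the coordinate.\<close>

definition chart_at :: "'a chart set \<Rightarrow> 'a \<Rightarrow> 'a chart" where
  "chart_at X p = (SOME c. c \<in> X \<and> p \<in> fst c)"

text \<open>The derivative \<open>dw/dz\<close> at \<open>p\<close> of the coordinate \<open>w\<close> of \<open>d\<close> with respect to the
  coordinate \<open>z\<close> of \<open>c\<close>.\<close>

definition transition :: "'a chart \<Rightarrow> 'a chart \<Rightarrow> 'a \<Rightarrow> complex" where
  "transition c d p = deriv (snd d \<circ> chart_inv c) (snd c p)"


section \<open>Tensor fields\<close>

text \<open>A section \<open>\<sigma>\<close> of \<open>K\<^sup>m \<otimes> (conjugate K)\<^sup>n\<close> (\<open>m\<close>, \<open>n\<close> integers) is given by its coefficients: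
  \<open>\<sigma> c p\<close> is the coefficient at \<open>p\<close> of \<open>dz\<^sup>m \<otimes> dz'\<^sup>n\<close>, where \<open>z\<close> is the coordinate of the chart \<open>c\<close>
  and \<open>z'\<close> its conjugate.
  Thus \<open>(1,0)\<close> are \<open>(1,0)\<close>-forms, \<open>(0,1)\<close> are \<open>(0,1)\<close>-forms, \<open>(2,0)\<close> quadratic differentials,
  \<open>(-1,0)\<close> vector fields of type \<open>(1,0)\<close>, \<open>(-1,1)\<close> the \<open>T\<close>-valued \<open>(0,1)\<close>-forms, and \<open>(1,1)\<close> the
  \<open>2\<close>-forms with coefficient taken with respect to \<open>dz \<and> dz'\<close>. Where \<open>c\<close> is no coordinate
  around \<open>p\<close> the coefficient is \<open>0\<close>, so that equality of sections is equality of functions.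

  Products of sections are products of coefficients; in particular \<open>\<Theta> \<omega>\<close>, for a \<open>T\<close>-valued
  \<open>(0,1)\<close>-form \<open>\<Theta>\<close> and a \<open>1\<close>-form \<open>\<omega>\<close>, has coefficient \<open>\<Theta> c p * \<omega> c p\<close>.\<close>

type_synonym 'a sect = "'a chart \<Rightarrow> 'a \<Rightarrow> complex"

definition tensor_field :: "'a chart set \<Rightarrow> int \<Rightarrow> int \<Rightarrow> 'a sect \<Rightarrow> bool" where
  "tensor_field X m n \<sigma> \<longleftrightarrow>
     (\<forall>c p. c \<notin> X \<or> p \<notin> fst c \<longrightarrow> \<sigma> c p = 0) \<and>
     (\<forall>c\<in>X. \<forall>d\<in>X. \<forall>p \<in> fst c \<inter> fst d.
        \<sigma> c p = \<sigma> d p * transition c d p powi m * cnj (transition c d p) powi n)"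

text \<open>The coefficient as a function of the coordinate.\<close>

definition coeff :: "'a sect \<Rightarrow> 'a chart \<Rightarrow> complex \<Rightarrow> complex" where
  "coeff \<sigma> c z = \<sigma> c (chart_inv c z)"

definition smooth_field :: "'a chart set \<Rightarrow> int \<Rightarrow> int \<Rightarrow> 'a sect \<Rightarrow> bool" where
  "smooth_field X m n \<sigma> \<longleftrightarrow>
     tensor_field X m n \<sigma> \<and> (\<forall>c\<in>X. smooth_on (chart_image c) (coeff \<sigma> c))"

definition smooth_fun :: "'a chart set \<Rightarrow> ('a \<Rightarrow> complex) \<Rightarrow> bool" where
  "smooth_fun X h \<longleftrightarrow> (\<forall>c\<in>X. smooth_on (chart_image c) (h \<circ> chart_inv c))"

text \<open>\<open>H0K X m\<close> is the space of global holomorphic sections of \<open>K\<^sup>m\<close>.\<close>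

definition H0K :: "'a chart set \<Rightarrow> int \<Rightarrow> 'a sect set" where
  "H0K X m = {\<sigma>. tensor_field X m 0 \<sigma> \<and> (\<forall>c\<in>X. coeff \<sigma> c holomorphic_on chart_image c)}"

definition scale_sect :: "complex \<Rightarrow> 'a sect \<Rightarrow> 'a sect" where
  "scale_sect a \<sigma> = (\<lambda>c p. a * \<sigma> c p)"

lemma vector_space_scale_sect: "vector_space scale_sect"
  by unfold_locales (auto simp: scale_sect_def fun_eq_iff algebra_simps)

definition genus :: "'a chart set \<Rightarrow> nat" where
  "genus X = vector_space.dim scale_sect (H0K X 1)"

text \<open>The order of \<open>\<sigma>\<close> at \<open>p\<close>, computed in the coordinate \<open>c\<close> around \<open>p\<close>.\<close>

definition order_at :: "'a chart \<Rightarrow> 'a sect \<Rightarrow> 'a \<Rightarrow> int" where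
  "order_at c \<sigma> p = zorder (coeff \<sigma> c) (snd c p)"

definition zeros :: "'a chart set \<Rightarrow> 'a sect \<Rightarrow> 'a set" where
  "zeros X \<sigma> = {p. \<forall>c\<in>X. p \<in> fst c \<longrightarrow> \<sigma> c p = 0}"

text \<open>A holomorphic map to the projective line (other than the constant \<open>\<infinity>\<close>) is a meromorphic
  function; its degree is the number of its poles counted with multiplicity. Values of \<open>F\<close> at
  isolated points do not matter here.\<close>

definition pole_order :: "'a chart set \<Rightarrow> ('a \<Rightarrow> complex) \<Rightarrow> 'a \<Rightarrow> nat" where
  "pole_order X F p =
     (let c = chart_at X p in
      if is_pole (F \<circ> chart_inv c) (snd c p)
      then nat (- zorder (F \<circ> chart_inv c) (snd c p)) else 0)"

definition hyperelliptic :: "'a chart set \<Rightarrow> bool" where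
  "hyperelliptic X \<longleftrightarrow>
     (\<exists>F. (\<forall>c\<in>X. (F \<circ> chart_inv c) meromorphic_on chart_image c) \<and>
          (\<Sum>p | pole_order X F p \<noteq> 0. pole_order X F p) = 2)"


section \<open>The operators \<open>\<partial>\<close> and \<open>\<partial>\<close>-bar, Dolbeault classes, integration\<close>

text \<open>\<open>dbar X \<sigma>\<close> is meaningful for sections \<open>\<sigma>\<close> of type \<open>(m,0)\<close>. A function \<open>h\<close> is regarded as the
  \<open>(0,0)\<close>-section \<open>\<lambda>_. h\<close>.\<close>

definition del :: "'a chart set \<Rightarrow> ('a \<Rightarrow> complex) \<Rightarrow> 'a sect" where
  "del X h = (\<lambda>c p. if c \<in> X \<and> p \<in> fst c then d_z (h \<circ> chart_inv c) (snd c p) else 0)"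

definition dbar :: "'a chart set \<Rightarrow> 'a sect \<Rightarrow> 'a sect" where
  "dbar X \<sigma> = (\<lambda>c p. if c \<in> X \<and> p \<in> fst c then d_zbar (coeff \<sigma> c) (snd c p) else 0)"

text \<open>The class in \<open>H\<^sup>1(T)\<close> of a smooth \<open>T\<close>-valued \<open>(0,1)\<close>-form, as a coset of the exact forms.\<close>

definition dolbeault_class :: "'a chart set \<Rightarrow> 'a sect \<Rightarrow> 'a sect set" where
  "dolbeault_class X \<Theta> =
     {\<Theta>'. smooth_field X (-1) 1 \<Theta>' \<and>
          (\<exists>V. smooth_field X (-1) 0 V \<and> (\<forall>c p. \<Theta>' c p = \<Theta> c p + dbar X V c p))}"

text \<open>The Hodge star acts on \<open>(0,1)\<close>-forms as a scalar, so such a form is harmonic if and only if it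
  is closed, i.e. \<open>\<partial>\<gamma> = 0\<close>.\<close>

definition harmonic01 :: "'a chart set \<Rightarrow> 'a sect \<Rightarrow> bool" where
  "harmonic01 X \<gamma> \<longleftrightarrow>
     smooth_field X 0 1 \<gamma> \<and> (\<forall>c\<in>X. \<forall>z\<in>chart_image c. d_z (coeff \<gamma> c) z = 0)"

definition partition_of_unity ::
  "'a::topological_space chart set \<Rightarrow> nat \<Rightarrow> (nat \<Rightarrow> 'a chart) \<Rightarrow> (nat \<Rightarrow> 'a \<Rightarrow> real) \<Rightarrow> bool" where
  "partition_of_unity X N c \<psi> \<longleftrightarrow>
     (\<forall>k<N. c k \<in> X \<and> smooth_fun X (\<lambda>p. of_real (\<psi> k p)) \<and> (\<forall>p. 0 \<le> \<psi> k p) \<and>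
        closure {p. \<psi> k p \<noteq> 0} \<subseteq> fst (c k)) \<and>
     (\<forall>p. (\<Sum>k<N. \<psi> k p) = 1)"

text \<open>The integral over the surface of the \<open>2\<close>-form \<open>\<sigma>\<close>, locally \<open>s dz \<and> dz' = -2\<i> s dx \<and> dy\<close>,
  computed with any finite smooth partition of unity.\<close>

definition surface_integral :: "'a::topological_space chart set \<Rightarrow> 'a sect \<Rightarrow> complex" where
  "surface_integral X \<sigma> =
     (SOME I. \<exists>N c \<psi>. partition_of_unity X N c \<psi> \<and>
        I = (\<Sum>k<N. integral (chart_image (c k))
               (\<lambda>z. -2 * \<i> * of_real (\<psi> k (chart_inv (c k) z)) * coeff \<sigma> (c k) z)))"

text \<open>The Serre pairing of a quadratic differential with a Dolbeault class of \<open>T\<close>, computed with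
  any representative of the class.\<close>

definition serre_pairing :: "'a::topological_space chart set \<Rightarrow> 'a sect \<Rightarrow> 'a sect set \<Rightarrow> complex" where
  "serre_pairing X q \<zeta> =
     (SOME v. \<exists>\<Theta>\<in>\<zeta>. v = surface_integral X (\<lambda>c p. q c p * \<Theta> c p))"


section \<open>The space \<open>I\<^sub>2\<close> and the Hodge-Gaussian map\<close>

text \<open>An element of \<open>H\<^sup>0(K) \<otimes> H\<^sup>0(K)\<close> is identified with the corresponding section of the exterior
  product of \<open>K\<close> with itself over the product of the surface with itself; this identification
  is injective. The multiplication map to \<open>H\<^sup>0(K\<^sup>2)\<close> becomes the restriction to the diagonal.\<close>

type_synonym 'a sect2 = "'a chart \<Rightarrow> 'a \<Rightarrow> 'a chart \<Rightarrow> 'a \<Rightarrow> complex"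

definition tensor :: "'a sect \<Rightarrow> 'a sect \<Rightarrow> 'a sect2" (infixl \<open>\<otimes>\<^sub>s\<close> 70) where
  "\<alpha> \<otimes>\<^sub>s \<beta> = (\<lambda>c p d q. \<alpha> c p * \<beta> d q)"

definition odot :: "'a sect \<Rightarrow> 'a sect \<Rightarrow> 'a sect2" (infixl \<open>\<odot>\<^sub>s\<close> 70) where
  "\<alpha> \<odot>\<^sub>s \<beta> = \<alpha> \<otimes>\<^sub>s \<beta> + \<beta> \<otimes>\<^sub>s \<alpha>"

text \<open>\<open>Q = \<Sum> a\<^sub>i\<^sub>j \<eta>\<^sub>i \<otimes> \<eta>\<^sub>j\<close> with holomorphic \<open>1\<close>-forms \<open>\<eta>\<^sub>i\<close> and a symmetric matrix \<open>a\<close>.\<close>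

definition sym_presentation ::
  "'a chart set \<Rightarrow> 'a sect2 \<Rightarrow> nat \<Rightarrow> (nat \<Rightarrow> nat \<Rightarrow> complex) \<Rightarrow> (nat \<Rightarrow> 'a sect) \<Rightarrow> bool" where
  "sym_presentation X Q N a \<eta> \<longleftrightarrow>
     (\<forall>i<N. \<eta> i \<in> H0K X 1) \<and> (\<forall>i<N. \<forall>j<N. a i j = a j i) \<and>
     (\<forall>c p d q. Q c p d q = (\<Sum>i<N. \<Sum>j<N. a i j * (\<eta> i \<otimes>\<^sub>s \<eta> j) c p d q))"

definition Sym2 :: "'a chart set \<Rightarrow> 'a sect2 set" where
  "Sym2 X = {Q. \<exists>N a \<eta>. sym_presentation X Q N a \<eta>}"

definition multiplication :: "'a sect2 \<Rightarrow> 'a sect" where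
  "multiplication Q = (\<lambda>c p. Q c p c p)"

definition I2 :: "'a chart set \<Rightarrow> 'a sect2 set" where
  "I2 X = {Q \<in> Sym2 X. multiplication Q = 0}"

text \<open>\<open>second_fundamental_form X Q \<zeta> q\<close> says that \<open>II(Q)(\<zeta>) = q\<close>, i.e. that \<open>q\<close> is computed from \<open>Q\<close>
  and the class \<open>\<zeta>\<close> by the recipe defining the Hodge-Gaussian map, for some choice of a
  representative \<open>\<Theta>\<close>, of a presentation of \<open>Q\<close> and of decompositions \<open>\<Theta> \<eta>\<^sub>i = \<gamma>\<^sub>i + \<partial>\<close>-bar \<open>h\<^sub>i\<close>.
  The quadratic differential \<open>q\<close> exists by the Hodge theorem and does not depend on the choices.\<close>

definition second_fundamental_form ::
  "'a chart set \<Rightarrow> 'a sect2 \<Rightarrow> 'a sect set \<Rightarrow> 'a sect \<Rightarrow> bool" where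
  "second_fundamental_form X Q \<zeta> q \<longleftrightarrow>
     Q \<in> I2 X \<and>
     (\<exists>\<Theta>\<in>\<zeta>. \<exists>N a \<eta> \<gamma> h. sym_presentation X Q N a \<eta> \<and>
        (\<forall>i<N. harmonic01 X (\<gamma> i) \<and> smooth_fun X (h i) \<and>
           (\<forall>c p. \<Theta> c p * \<eta> i c p = \<gamma> i c p + dbar X (\<lambda>_. h i) c p)) \<and>
        q = (\<lambda>c p. \<Sum>i<N. \<Sum>j<N. a i j * \<eta> i c p * del X (h j) c p))"


section \<open>Quotients by a holomorphic form\<close>

text \<open>The meromorphic function \<open>\<alpha>/\<omega>\<close>; its value at the zeros of \<open>\<omega>\<close> is meaningless.\<close>

definition ratio :: "'a chart set \<Rightarrow> 'a sect \<Rightarrow> 'a sect \<Rightarrow> 'a \<Rightarrow> complex" where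
  "ratio X \<alpha> \<omega> p = \<alpha> (chart_at X p) p / \<omega> (chart_at X p) p"

text \<open>A function \<open>u\<close>, meaningful outside \<open>Z\<close>, is smooth on the whole surface, i.e. its singularities
  at the points of \<open>Z\<close> are removable.\<close>

definition smooth_off :: "'a chart set \<Rightarrow> 'a set \<Rightarrow> ('a \<Rightarrow> complex) \<Rightarrow> bool" where
  "smooth_off X Z u \<longleftrightarrow> (\<exists>v. smooth_fun X v \<and> (\<forall>p. p \<notin> Z \<longrightarrow> v p = u p))"

text \<open>The \<open>T\<close>-valued \<open>(0,1)\<close>-form \<open>\<partial>\<close>-bar\<open>(\<rho>/\<omega>)\<close>. Near a zero of \<open>\<omega>\<close> the field \<open>\<rho>/\<omega>\<close> is meromorphic, and
  the form is extended there by \<open>0\<close>.\<close>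

definition dbar_quotient :: "'a chart set \<Rightarrow> ('a \<Rightarrow> complex) \<Rightarrow> 'a sect \<Rightarrow> 'a sect" where
  "dbar_quotient X \<rho> \<omega> =
     (\<lambda>c p. if p \<in> zeros X \<omega> then 0 else dbar X (\<lambda>c p. \<rho> p / \<omega> c p) c p)"

text \<open>The number \<open>w(\<zeta>, \<alpha>, \<beta>)\<close>: at each zero \<open>p\<close> of \<open>\<omega>\<close> the residue of \<open>f\<^sub>p (\<alpha>/\<omega>) d(f\<^sub>p \<beta>/\<omega>)\<close> is taken
  in the local coordinate \<open>z p\<close>, centred at \<open>p\<close>, in which \<open>f\<^sub>p\<close> is written.\<close>

definition w_residue ::
  "'a chart set \<Rightarrow> 'a sect \<Rightarrow> ('a \<Rightarrow> 'a chart) \<Rightarrow> ('a \<Rightarrow> complex \<Rightarrow> complex) \<Rightarrow>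
   'a sect \<Rightarrow> 'a sect \<Rightarrow> complex" where
  "w_residue X \<omega> z f \<alpha> \<beta> =
     2 * of_real pi * \<i> *
     (\<Sum>p\<in>zeros X \<omega>. residue
        (\<lambda>t. f p t * ratio X \<alpha> \<omega> (chart_inv (z p) t) *
              deriv (\<lambda>u. f p u * ratio X \<beta> \<omega> (chart_inv (z p) u)) t) 0)"

text \<open>The closed coordinate disk of radius \<open>r\<close> around the centre of the chart \<open>c\<close>.\<close>

definition coord_disk :: "'a chart \<Rightarrow> real \<Rightarrow> 'a set" where
  "coord_disk c r = {p \<in> fst c. norm (snd c p) \<le> r}"

end

theory Submission
  imports Defs
begin

text \<open>The integral of \<open>q \<Theta>\<close>, for \<open>q = II(Q)(\<zeta>)\<close> and any representative \<open>\<Theta>\<close> of \<open>\<zeta>\<close>, is turned into residues at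
the zeros of \<open>\<omega>\<close>, and these are rearranged with the help of the symmetric tensor \<open>Q\<close>.

\<^emph>\<open>From the integral to residues.\<close> Since \<open>Q\<close> lies in \<open>I\<^sub>2\<close>, the quadratic differential \<open>q\<close> is
holomorphic. Stokes' theorem (\<open>stokes\<close>) then shows that a change of representative does not change the
integral, so one may take \<open>\<Theta>0 = \<partial>\<close>-bar\<open>(\<rho>/\<omega>)\<close>. This form vanishes near the zeros and outside the
coordinate disks, and on each punctured disk it satisfies \<open>q \<Theta>0 = \<partial>\<close>-bar\<open>(q \<rho>/\<omega>)\<close>. Green's formula
gives \<open>2 \<pi> i\<close> times the sum of the residues of \<open>f\<^sub>p q/\<omega>\<close> (\<open>serre_pairing_residue\<close>).

\<^emph>\<open>From \<open>q\<close> to \<open>w\<close>.\<close> Write \<open>Q = \<Sum> a\<^sub>i\<^sub>j \<eta>\<^sub>i \<otimes> \<eta>\<^sub>j\<close>, and \<open>q = \<Sum> a\<^sub>i\<^sub>j \<eta>\<^sub>i \<partial>h\<^sub>j\<close> where \<open>h\<^sub>j\<close> comes from a Hodge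
decomposition of \<open>\<Theta>0 \<eta>\<^sub>j\<close>. The form \<open>\<partial>h\<^sub>j\<close> is holomorphic near the zeros, so the residue of
\<open>(f\<^sub>p \<eta>\<^sub>i/\<omega>) \<partial>h\<^sub>j\<close> at \<open>p\<close> pairs the polar part of \<open>f\<^sub>p \<eta>\<^sub>i/\<omega>\<close> with Taylor coefficients of \<open>\<partial>h\<^sub>j\<close>. A coefficient
of the polar part is a linear functional of \<open>\<eta>\<^sub>i\<close>. Apply it to the first slot of
\<open>\<Sum> a\<^sub>i\<^sub>j \<eta>\<^sub>i \<otimes> \<eta>\<^sub>j = \<Sum> u\<^sub>i \<otimes> b\<^sub>i + b\<^sub>i \<otimes> u\<^sub>i\<close>, with \<open>u\<^sub>i = \<omega>\<^bsub>2i-1\<^esub>\<close> and \<open>b\<^sub>i = \<omega>\<^bsub>2i\<^esub>\<close>. It kills every \<open>u\<^sub>i\<close>,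
because \<open>f\<^sub>p u\<^sub>i/\<omega>\<close> has no pole. What remains is a linear relation between the \<open>\<eta>\<^sub>j\<close> and the \<open>u\<^sub>i\<close> alone.

Each of these forms comes with a Hodge decomposition: that of \<open>\<Theta>0 \<eta>\<^sub>j\<close> is part of the definition of \<open>q\<close>,
and \<open>\<Theta>0 u\<^sub>i = \<partial>\<close>-bar\<open>(\<rho> u\<^sub>i/\<omega>)\<close> with the smooth function \<open>\<rho> u\<^sub>i/\<omega>\<close>. As \<open>\<partial>h\<close> is determined by \<open>\<Theta>0 \<eta>\<close> (\<open>hodge_lift_unique\<close>), the relation carries over to the
forms \<open>\<partial>h\<^sub>j\<close> and \<open>\<partial>(\<rho> u\<^sub>i/\<omega>)\<close>. Hence the residue of \<open>f\<^sub>p q/\<omega>\<close> is the sum of the residues of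
\<open>(f\<^sub>p b\<^sub>i/\<omega>) d(f\<^sub>p u\<^sub>i/\<omega>)\<close> (\<open>residue_quadratic\<close>), and integration by parts exchanges the two factors at the
cost of the sign in the formula.

The integrals are defined through arbitrary partitions of unity. Their existence, the independence of
the choice, Stokes' theorem and the underlying plane calculus of \<open>\<partial>/\<partial>z\<close> and its conjugate are
developed first.\<close>

section \<open>The Wirtinger calculus\<close>

lemma Ck_cong:
  assumes "open S" "\<And>z. z \<in> S \<Longrightarrow> f z = g z"
  shows "Ck k S f \<longleftrightarrow> Ck k S g"
  using assms(2)
proof (induction k arbitrary: f g)
  case 0
  then show ?case by (simp cong: continuous_on_cong)
next
  case (Suc k)
  have fd: "(f has_derivative D) (at z) \<longleftrightarrow> (g has_derivative D) (at z)" if "z \<in> S" for z D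
    using assms(1) Suc.prems that has_derivative_transform_within_open[of f D z UNIV S g]
      has_derivative_transform_within_open[of g D z UNIV S f] by auto
  have "f differentiable (at z) \<longleftrightarrow> g differentiable (at z)" if "z \<in> S" for z
    using fd[OF that] by (simp add: differentiable_def)
  then have "f differentiable_on S \<longleftrightarrow> g differentiable_on S"
    by (auto simp: differentiable_on_def at_within_open[OF _ assms(1)])
  moreover have "frechet_derivative f (at z) v = frechet_derivative g (at z) v" if "z \<in> S" for z v
    using fd[OF that] by (simp add: frechet_derivative_def)
  then have "Ck k S (\<lambda>z. frechet_derivative f (at z) v) \<longleftrightarrow>
      Ck k S (\<lambda>z. frechet_derivative g (at z) v)" for v
    by (rule Suc.IH)
  ultimately show ?case by simp
qed

lemma Ck_transform: "open S \<Longrightarrow> Ck k S g \<Longrightarrow> (\<And>z. z \<in> S \<Longrightarrow> f z = g z) \<Longrightarrow> Ck k S f"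
  using Ck_cong[of S f g k] by blast

text \<open>A real-linear map of the plane is \<open>v \<mapsto> a v + b v'\<close>, with \<open>v'\<close> the conjugate of \<open>v\<close>, for unique \<open>a\<close> and \<open>b\<close>;
for the derivative of \<open>f\<close> these are the two Wirtinger derivatives. All rules below are read off from
this form of the derivative.\<close>

lemma wirtinger_derivative:
  assumes "f differentiable (at z)"
  shows "(f has_derivative (\<lambda>v. d_z f z * v + d_zbar f z * cnj v)) (at z)"
proof -
  let ?D = "frechet_derivative f (at z)"
  have D: "(f has_derivative ?D) (at z)"
    using assms frechet_derivative_works by blast
  then interpret bounded_linear ?D by (rule has_derivative_bounded_linear)
  have "?D v = d_z f z * v + d_zbar f z * cnj v" for v
  proof -
    have "v = Re v *\<^sub>R 1 + Im v *\<^sub>R \<i>" by (simp add: complex_eq_iff)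
    then have "?D v = Re v *\<^sub>R ?D 1 + Im v *\<^sub>R ?D \<i>" by (metis add scaleR)
    then show ?thesis
      by (simp add: d_z_def d_zbar_def scaleR_conv_of_real field_simps complex_eq_iff)
  qed
  then have "?D = (\<lambda>v. d_z f z * v + d_zbar f z * cnj v)" by blast
  with D show ?thesis by simp
qed

lemma wirtinger_unique:
  assumes "(f has_derivative (\<lambda>v. a * v + b * cnj v)) (at z)"
  shows "d_z f z = a" "d_zbar f z = b"
proof -
  have "frechet_derivative f (at z) = (\<lambda>v. a * v + b * cnj v)"
    using frechet_derivative_at[OF assms] by simp
  then show "d_z f z = a" "d_zbar f z = b"
    by (simp_all add: d_z_def d_zbar_def algebra_simps)
qed

lemma frechet_wirtinger:
  assumes "f differentiable (at z)"
  shows "frechet_derivative f (at z) v = d_z f z * v + d_zbar f z * cnj v"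
  using frechet_derivative_at[OF wirtinger_derivative[OF assms]] by metis

lemma wirtinger_cong:
  assumes "open S" "z \<in> S" "\<And>w. w \<in> S \<Longrightarrow> f w = g w"
  shows "f differentiable (at z) \<longleftrightarrow> g differentiable (at z)" "d_z f z = d_z g z" "d_zbar f z = d_zbar g z"
proof -
  have fd: "(f has_derivative D) (at z) \<longleftrightarrow> (g has_derivative D) (at z)" for D
    using assms has_derivative_transform_within_open[of f D z UNIV S g]
      has_derivative_transform_within_open[of g D z UNIV S f] by auto
  then show "f differentiable (at z) \<longleftrightarrow> g differentiable (at z)" by (simp add: differentiable_def)
  show "d_z f z = d_z g z" "d_zbar f z = d_zbar g z"
    using fd by (simp_all add: d_z_def d_zbar_def frechet_derivative_def)
qed

lemma wirtinger_add:
  assumes "f differentiable (at z)" "g differentiable (at z)"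
  shows "d_z (\<lambda>w. f w + g w) z = d_z f z + d_z g z" "d_zbar (\<lambda>w. f w + g w) z = d_zbar f z + d_zbar g z"
proof -
  have "((\<lambda>w. f w + g w) has_derivative
      (\<lambda>v. (d_z f z + d_z g z) * v + (d_zbar f z + d_zbar g z) * cnj v)) (at z)"
    by (rule has_derivative_eq_rhs, rule has_derivative_add[OF wirtinger_derivative wirtinger_derivative])
       (use assms in \<open>auto simp: algebra_simps\<close>)
  from wirtinger_unique[OF this] show "d_z (\<lambda>w. f w + g w) z = d_z f z + d_z g z"
    "d_zbar (\<lambda>w. f w + g w) z = d_zbar f z + d_zbar g z" by auto
qed

lemma wirtinger_mult:
  assumes "f differentiable (at z)" "g differentiable (at z)"
  shows "d_z (\<lambda>w. f w * g w) z = d_z f z * g z + f z * d_z g z"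
    "d_zbar (\<lambda>w. f w * g w) z = d_zbar f z * g z + f z * d_zbar g z"
proof -
  have "((\<lambda>w. f w * g w) has_derivative
      (\<lambda>v. (d_z f z * g z + f z * d_z g z) * v + (d_zbar f z * g z + f z * d_zbar g z) * cnj v)) (at z)"
    by (rule has_derivative_eq_rhs, rule has_derivative_mult[OF wirtinger_derivative wirtinger_derivative])
       (use assms in \<open>auto simp: algebra_simps\<close>)
  from wirtinger_unique[OF this] show "d_z (\<lambda>w. f w * g w) z = d_z f z * g z + f z * d_z g z"
    "d_zbar (\<lambda>w. f w * g w) z = d_zbar f z * g z + f z * d_zbar g z" by auto
qed

lemma wirtinger_holomorphic:
  assumes "f field_differentiable (at z)"
  shows "f differentiable (at z)" "d_z f z = deriv f z" "d_zbar f z = 0"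
proof -
  have "(f has_field_derivative deriv f z) (at z)"
    using assms field_differentiable_derivI by blast
  then have *: "(f has_derivative (\<lambda>v. deriv f z * v + 0 * cnj v)) (at z)"
    by (simp add: has_field_derivative_def)
  then show "f differentiable (at z)" by (auto simp: differentiable_def)
  from wirtinger_unique[OF *] show "d_z f z = deriv f z" "d_zbar f z = 0" by auto
qed

lemma wirtinger_const [simp]: "d_z (\<lambda>_. c) z = 0" "d_zbar (\<lambda>_. c) z = 0"
  using wirtinger_holomorphic[of "\<lambda>_. c" z] by auto

lemma wirtinger_cmult:
  assumes "f differentiable (at z)"
  shows "d_z (\<lambda>w. c * f w) z = c * d_z f z" "d_zbar (\<lambda>w. c * f w) z = c * d_zbar f z"
  using wirtinger_mult[of "\<lambda>_. c" z f] assms by auto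

lemma wirtinger_minus:
  assumes "f differentiable (at z)" "g differentiable (at z)"
  shows "d_z (\<lambda>w. f w - g w) z = d_z f z - d_z g z" "d_zbar (\<lambda>w. f w - g w) z = d_zbar f z - d_zbar g z"
  using wirtinger_add[of f z "\<lambda>w. (-1) * g w"] wirtinger_cmult[of g z "-1"] assms by auto

lemma wirtinger_sum:
  assumes "\<And>i. i \<in> A \<Longrightarrow> f i differentiable (at z)"
  shows "(\<lambda>w. \<Sum>i\<in>A. f i w) differentiable (at z)"
    "d_z (\<lambda>w. \<Sum>i\<in>A. f i w) z = (\<Sum>i\<in>A. d_z (f i) z)"
    "d_zbar (\<lambda>w. \<Sum>i\<in>A. f i w) z = (\<Sum>i\<in>A. d_zbar (f i) z)"
proof -
  have "(\<lambda>w. \<Sum>i\<in>A. f i w) differentiable (at z) \<and>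
    d_z (\<lambda>w. \<Sum>i\<in>A. f i w) z = (\<Sum>i\<in>A. d_z (f i) z) \<and>
    d_zbar (\<lambda>w. \<Sum>i\<in>A. f i w) z = (\<Sum>i\<in>A. d_zbar (f i) z)"
    using assms by (induction A rule: infinite_finite_induct) (auto simp: wirtinger_add)
  then show "(\<lambda>w. \<Sum>i\<in>A. f i w) differentiable (at z)"
    "d_z (\<lambda>w. \<Sum>i\<in>A. f i w) z = (\<Sum>i\<in>A. d_z (f i) z)"
    "d_zbar (\<lambda>w. \<Sum>i\<in>A. f i w) z = (\<Sum>i\<in>A. d_zbar (f i) z)" by auto
qed

lemma wirtinger_cnj:
  assumes "f differentiable (at z)"
  shows "(\<lambda>w. cnj (f w)) differentiable (at z)"
    "d_z (\<lambda>w. cnj (f w)) z = cnj (d_zbar f z)" "d_zbar (\<lambda>w. cnj (f w)) z = cnj (d_z f z)"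
proof -
  have *: "((\<lambda>w. cnj (f w)) has_derivative
      (\<lambda>v. cnj (d_zbar f z) * v + cnj (d_z f z) * cnj v)) (at z)"
    by (rule has_derivative_eq_rhs, rule has_derivative_cnj[OF wirtinger_derivative])
       (use assms in \<open>auto simp: algebra_simps\<close>)
  then show "(\<lambda>w. cnj (f w)) differentiable (at z)" by (auto simp: differentiable_def)
  from wirtinger_unique[OF *] show "d_z (\<lambda>w. cnj (f w)) z = cnj (d_zbar f z)"
    "d_zbar (\<lambda>w. cnj (f w)) z = cnj (d_z f z)" by auto
qed

lemma wirtinger_chain:
  assumes "g differentiable (at z)" "f differentiable (at (g z))"
  shows "(\<lambda>w. f (g w)) differentiable (at z)"
    "d_z (\<lambda>w. f (g w)) z = d_z f (g z) * d_z g z + d_zbar f (g z) * cnj (d_zbar g z)"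
    "d_zbar (\<lambda>w. f (g w)) z = d_z f (g z) * d_zbar g z + d_zbar f (g z) * cnj (d_z g z)"
proof -
  have *: "((\<lambda>w. f (g w)) has_derivative
      (\<lambda>v. (d_z f (g z) * d_z g z + d_zbar f (g z) * cnj (d_zbar g z)) * v
         + (d_z f (g z) * d_zbar g z + d_zbar f (g z) * cnj (d_z g z)) * cnj v)) (at z)"
    by (rule has_derivative_eq_rhs,
        rule has_derivative_compose[OF wirtinger_derivative[OF assms(1)] wirtinger_derivative[OF assms(2)]])
       (auto simp: algebra_simps)
  then show "(\<lambda>w. f (g w)) differentiable (at z)" by (auto simp: differentiable_def)
  from wirtinger_unique[OF *] show
    "d_z (\<lambda>w. f (g w)) z = d_z f (g z) * d_z g z + d_zbar f (g z) * cnj (d_zbar g z)"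
    "d_zbar (\<lambda>w. f (g w)) z = d_z f (g z) * d_zbar g z + d_zbar f (g z) * cnj (d_z g z)" by auto
qed

lemma field_differentiable_of_d_zbar:
  assumes "f differentiable (at z)" "d_zbar f z = 0"
  shows "(f has_field_derivative d_z f z) (at z)"
  using wirtinger_derivative[OF assms(1)] assms(2) by (simp add: has_field_derivative_def)

section \<open>Closure properties of smooth functions\<close>

lemma differentiable_on_openD:
  "f differentiable_on S \<Longrightarrow> open S \<Longrightarrow> z \<in> S \<Longrightarrow> f differentiable (at z)"
  unfolding differentiable_on_def by (metis at_within_open)

lemma Ck_add_cmult:
  assumes "open S" "Ck k S f" "Ck k S g"
  shows "Ck k S (\<lambda>z. a * f z + b * g z)"
  using assms(2,3)
proof (induction k arbitrary: f g)
  case 0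
  then show ?case by (auto intro!: continuous_intros)
next
  case (Suc k)
  have d: "f differentiable (at z)" "g differentiable (at z)" if "z \<in> S" for z
    using Suc.prems assms(1) that differentiable_on_openD by auto
  have "Ck k S (\<lambda>z. frechet_derivative (\<lambda>z. a * f z + b * g z) (at z) v)" for v
  proof -
    have "Ck k S (\<lambda>z. a * frechet_derivative f (at z) v + b * frechet_derivative g (at z) v)"
      using Suc.prems by (intro Suc.IH) auto
    then show ?thesis
      by (subst Ck_cong[OF assms(1)])
         (use d in \<open>auto simp: frechet_wirtinger wirtinger_add wirtinger_cmult algebra_simps\<close>)
  qed
  moreover have "(\<lambda>z. a * f z + b * g z) differentiable_on S"
    using Suc.prems by (auto intro!: derivative_intros)
  ultimately show ?case by auto
qed

lemma Ck_add: "open S \<Longrightarrow> Ck k S f \<Longrightarrow> Ck k S g \<Longrightarrow> Ck k S (\<lambda>z. f z + g z)"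
  using Ck_add_cmult[of S k f g 1 1] by simp

text \<open>Directional derivatives are combinations of the two Wirtinger derivatives with constant
coefficients. This makes the Leibniz and chain rules usable in inductions on the order.\<close>

lemma Ck_Suc_wirtinger:
  assumes "open S"
  shows "Ck (Suc k) S f \<longleftrightarrow> f differentiable_on S \<and> Ck k S (d_z f) \<and> Ck k S (d_zbar f)"
proof (cases "f differentiable_on S")
  case True
  have d: "f differentiable (at z)" if "z \<in> S" for z
    using True assms(1) that differentiable_on_openD by auto
  show ?thesis
  proof
    assume "Ck (Suc k) S f"
    then have a: "Ck k S (\<lambda>z. frechet_derivative f (at z) v)" for v by simp
    have "Ck k S (\<lambda>z. (1/2) * frechet_derivative f (at z) 1 + (c/2) * frechet_derivative f (at z) \<i>)" for c
      by (rule Ck_add_cmult[OF assms a a])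
    from this[of "-\<i>"] this[of \<i>]
    show "f differentiable_on S \<and> Ck k S (d_z f) \<and> Ck k S (d_zbar f)"
      using True by (simp add: d_z_def[abs_def] d_zbar_def[abs_def] diff_divide_distrib add_divide_distrib)
  next
    assume "f differentiable_on S \<and> Ck k S (d_z f) \<and> Ck k S (d_zbar f)"
    then have "Ck k S (\<lambda>z. v * d_z f z + cnj v * d_zbar f z)" for v
      using Ck_add_cmult[OF assms] by blast
    then have "Ck k S (\<lambda>z. frechet_derivative f (at z) v)" for v
      by (subst Ck_cong[OF assms]) (auto simp: frechet_wirtinger d algebra_simps)
    with True show "Ck (Suc k) S f" by simp
  qed
qed auto

lemma Ck_Suc_imp_Ck:
  assumes "open S"
  shows "Ck (Suc k) S f \<Longrightarrow> Ck k S f"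
proof (induction k arbitrary: f)
  case 0
  then show ?case using differentiable_imp_continuous_on by auto
next
  case (Suc k)
  then show ?case by (metis Ck.simps(2))
qed

lemma Ck_mult:
  assumes "open S" "Ck k S f" "Ck k S g"
  shows "Ck k S (\<lambda>z. f z * g z)"
  using assms(2,3)
proof (induction k arbitrary: f g)
  case 0
  then show ?case by (auto intro!: continuous_intros)
next
  case (Suc k)
  note P = Suc.prems[unfolded Ck_Suc_wirtinger[OF assms(1)]]
  have d: "f differentiable (at z)" "g differentiable (at z)" if "z \<in> S" for z
    using P assms(1) that differentiable_on_openD by auto
  have fg: "Ck k S f" "Ck k S g"
    using Suc.prems Ck_Suc_imp_Ck[OF assms(1)] by auto
  have D: "Ck k S (\<lambda>z. (d_z f z * g z) + (f z * d_z g z))"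
    "Ck k S (\<lambda>z. (d_zbar f z * g z) + (f z * d_zbar g z))"
    using P fg by (auto intro!: Ck_add Suc.IH assms(1))
  have "Ck k S (d_z (\<lambda>z. f z * g z))" "Ck k S (d_zbar (\<lambda>z. f z * g z))"
    by (rule Ck_transform[OF assms(1) D(1)], auto simp: wirtinger_mult d) (rule Ck_transform[OF assms(1) D(2)], auto simp: wirtinger_mult d)
  moreover have "(\<lambda>z. f z * g z) differentiable_on S"
    using P by (auto intro!: derivative_intros)
  ultimately show ?case by (simp add: Ck_Suc_wirtinger[OF assms(1)] del: Ck.simps)
qed

lemma Ck_cnj:
  assumes "open S" "Ck k S f"
  shows "Ck k S (\<lambda>z. cnj (f z))"
  using assms(2)
proof (induction k arbitrary: f)
  case 0
  then show ?case by (auto intro!: continuous_intros)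
next
  case (Suc k)
  note P = Suc.prems[unfolded Ck_Suc_wirtinger[OF assms(1)]]
  have d: "f differentiable (at z)" if "z \<in> S" for z
    using P assms(1) that differentiable_on_openD by auto
  have "Ck k S (d_z (\<lambda>z. cnj (f z)))" "Ck k S (d_zbar (\<lambda>z. cnj (f z)))"
    by (rule Ck_transform[OF assms(1) Suc.IH[of "d_zbar f"]]; use P in \<open>simp add: wirtinger_cnj d\<close>)
      (rule Ck_transform[OF assms(1) Suc.IH[of "d_z f"]]; use P in \<open>simp add: wirtinger_cnj d\<close>)
  moreover have "(\<lambda>z. cnj (f z)) differentiable_on S"
    using wirtinger_cnj(1)[OF d] by (simp add: differentiable_on_def differentiable_at_withinI)
  ultimately show ?case by (simp add: Ck_Suc_wirtinger[OF assms(1)] del: Ck.simps)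
qed

lemma Ck_compose:
  assumes "open S" "open T" "Ck k S g" "Ck k T f" "g ` S \<subseteq> T"
  shows "Ck k S (\<lambda>z. f (g z))"
  using assms(3,4)
proof (induction k arbitrary: f)
  case 0
  then show ?case using assms(5) continuous_on_compose2[of T f S g] by simp
next
  case (Suc k)
  note P = Suc.prems(1)[unfolded Ck_Suc_wirtinger[OF assms(1)]]
    and Q = Suc.prems(2)[unfolded Ck_Suc_wirtinger[OF assms(2)]]
  have g: "Ck k S g" using Suc.prems Ck_Suc_imp_Ck[OF assms(1)] by auto
  have d: "g differentiable (at z)" "f differentiable (at (g z))" if "z \<in> S" for z
    using P Q assms that differentiable_on_openD[of g] differentiable_on_openD[of f] by auto
  have D: "Ck k S (\<lambda>z. (d_z f (g z) * d_z g z) + (d_zbar f (g z) * cnj (d_zbar g z)))"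
    "Ck k S (\<lambda>z. (d_z f (g z) * d_zbar g z) + (d_zbar f (g z) * cnj (d_z g z)))"
    using P Q g by (auto intro!: Ck_add Ck_mult Ck_cnj Suc.IH assms(1))
  have "Ck k S (d_z (\<lambda>z. f (g z)))" "Ck k S (d_zbar (\<lambda>z. f (g z)))"
    by (rule Ck_transform[OF assms(1) D(1)], simp add: wirtinger_chain d) (rule Ck_transform[OF assms(1) D(2)], simp add: wirtinger_chain d)
  moreover have "(\<lambda>z. f (g z)) differentiable_on S"
    using wirtinger_chain(1)[OF d] by (simp add: differentiable_on_def differentiable_at_withinI)
  ultimately show ?case by (simp add: Ck_Suc_wirtinger[OF assms(1)] del: Ck.simps)
qed

lemma Ck_const [simp]: "open S \<Longrightarrow> Ck k S (\<lambda>_. c)"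
  by (induction k arbitrary: c) auto

lemma Ck_holomorphic:
  assumes "open S" "f holomorphic_on S"
  shows "Ck k S f"
  using assms(2)
proof (induction k arbitrary: f)
  case 0
  then show ?case using holomorphic_on_imp_continuous_on by simp
next
  case (Suc k)
  have d: "f field_differentiable (at z)" if "z \<in> S" for z
    using Suc.prems assms(1) that holomorphic_on_imp_differentiable_at by blast
  have "Ck k S (deriv f)"
    using Suc.IH Suc.prems assms(1) holomorphic_deriv by blast
  then have "Ck k S (d_z f)" "Ck k S (d_zbar f)"
    using wirtinger_holomorphic[OF d] Ck_cong[OF assms(1), of "d_z f" "deriv f" k]
      Ck_cong[OF assms(1), of "d_zbar f" "\<lambda>_. 0" k] assms(1) by auto
  moreover have "f differentiable_on S"
    using wirtinger_holomorphic(1)[OF d] by (simp add: differentiable_on_def differentiable_at_withinI)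
  ultimately show ?case by (simp add: Ck_Suc_wirtinger[OF assms(1)] del: Ck.simps)
qed

lemma Ck_subset: "Ck k S f \<Longrightarrow> T \<subseteq> S \<Longrightarrow> Ck k T f"
  by (induction k arbitrary: f)
     (auto intro: continuous_on_subset differentiable_on_subset)

lemma Ck_local:
  assumes "\<And>z. z \<in> S \<Longrightarrow> \<exists>T. open T \<and> z \<in> T \<and> Ck k T f"
  shows "Ck k S f"
  using assms
proof (induction k arbitrary: f)
  case 0
  have "isCont f z" if "z \<in> S" for z
    using 0[OF that] by (auto simp: continuous_on_eq_continuous_at)
  then show ?case by (simp add: continuous_at_imp_continuous_on)
next
  case (Suc k)
  have "f differentiable (at z)" if "z \<in> S" for z
    using Suc.prems[OF that] differentiable_on_openD by auto
  then have "f differentiable_on S"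
    by (simp add: differentiable_on_def differentiable_at_withinI)
  moreover have "Ck k S (\<lambda>z. frechet_derivative f (at z) v)" for v
    using Suc.prems by (intro Suc.IH) (metis Ck.simps(2))
  ultimately show ?case by auto
qed

named_theorems smooth_intros

lemma smooth_on_cong: "open S \<Longrightarrow> (\<And>z. z \<in> S \<Longrightarrow> f z = g z) \<Longrightarrow> smooth_on S f \<longleftrightarrow> smooth_on S g"
  using Ck_cong[of S f g] by (simp add: smooth_on_def)

lemma smooth_on_add [smooth_intros]:
  "open S \<Longrightarrow> smooth_on S f \<Longrightarrow> smooth_on S g \<Longrightarrow> smooth_on S (\<lambda>z. f z + g z)"
  using Ck_add_cmult[of S _ f g 1 1] by (simp add: smooth_on_def)

lemma smooth_on_diff [smooth_intros]:
  "open S \<Longrightarrow> smooth_on S f \<Longrightarrow> smooth_on S g \<Longrightarrow> smooth_on S (\<lambda>z. f z - g z)"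
  using Ck_add_cmult[of S _ f g 1 "-1"] by (simp add: smooth_on_def)

lemma smooth_on_mult [smooth_intros]:
  "open S \<Longrightarrow> smooth_on S f \<Longrightarrow> smooth_on S g \<Longrightarrow> smooth_on S (\<lambda>z. f z * g z)"
  by (simp add: smooth_on_def Ck_mult)

lemma smooth_on_cnj [smooth_intros]: "open S \<Longrightarrow> smooth_on S f \<Longrightarrow> smooth_on S (\<lambda>z. cnj (f z))"
  by (simp add: smooth_on_def Ck_cnj)

lemma smooth_on_const [smooth_intros]: "open S \<Longrightarrow> smooth_on S (\<lambda>_. c)"
  by (simp add: smooth_on_def)

lemma smooth_on_holomorphic: "open S \<Longrightarrow> f holomorphic_on S \<Longrightarrow> smooth_on S f"
  by (simp add: smooth_on_def Ck_holomorphic)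

lemma smooth_on_ident [smooth_intros]: "open S \<Longrightarrow> smooth_on S (\<lambda>z. z)"
  by (simp add: smooth_on_holomorphic)

lemma smooth_on_compose:
  "open S \<Longrightarrow> open T \<Longrightarrow> smooth_on S g \<Longrightarrow> smooth_on T f \<Longrightarrow> g ` S \<subseteq> T \<Longrightarrow> smooth_on S (\<lambda>z. f (g z))"
  using Ck_compose[of S T] by (simp add: smooth_on_def)

lemma smooth_on_divide [smooth_intros]:
  assumes "open S" "smooth_on S f" "smooth_on S g" "\<And>z. z \<in> S \<Longrightarrow> g z \<noteq> 0"
  shows "smooth_on S (\<lambda>z. f z / g z)"
proof -
  have "smooth_on (-{0}) (inverse :: complex \<Rightarrow> complex)"
    by (intro smooth_on_holomorphic holomorphic_intros) auto
  then have "smooth_on S (\<lambda>z. inverse (g z))"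
    by (rule smooth_on_compose[of S "-{0}" g inverse, rotated 3]) (use assms in auto)
  then have "smooth_on S (\<lambda>z. f z * inverse (g z))"
    using assms smooth_on_mult by blast
  then show ?thesis by (simp add: divide_inverse)
qed

lemma smooth_on_sum [smooth_intros]:
  "open S \<Longrightarrow> (\<And>i. i \<in> A \<Longrightarrow> smooth_on S (f i)) \<Longrightarrow> smooth_on S (\<lambda>z. \<Sum>i\<in>A. f i z)"
  by (induction A rule: infinite_finite_induct) (auto intro: smooth_intros)

lemma smooth_on_subset: "smooth_on S f \<Longrightarrow> T \<subseteq> S \<Longrightarrow> smooth_on T f"
  unfolding smooth_on_def using Ck_subset by blast

lemma smooth_on_local:
  assumes "\<And>z. z \<in> S \<Longrightarrow> \<exists>T. open T \<and> z \<in> T \<and> smooth_on T f"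
  shows "smooth_on S f"
  using Ck_local[of S _ f] assms unfolding smooth_on_def by meson

lemma smooth_onD:
  assumes "smooth_on S f" "open S"
  shows "\<And>z. z \<in> S \<Longrightarrow> f differentiable (at z)" "continuous_on S f"
    "smooth_on S (d_z f)" "smooth_on S (d_zbar f)"
proof -
  have "Ck (Suc k) S f" for k using assms by (simp add: smooth_on_def del: Ck.simps)
  note * = this[unfolded Ck_Suc_wirtinger[OF assms(2)]]
  show "smooth_on S (d_z f)" "smooth_on S (d_zbar f)" using * by (simp_all add: smooth_on_def)
  show "f differentiable (at z)" if "z \<in> S" for z
    using *[of 0] that assms(2) differentiable_on_openD by blast
  show "continuous_on S f" using assms(1) by (auto simp: smooth_on_def dest: spec[of _ 0])
qed

text \<open>The Cauchy-Riemann equation in Wirtinger form.\<close>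

lemma holomorphic_of_smooth:
  assumes "smooth_on S f" "open S" "\<And>z. z \<in> S \<Longrightarrow> d_zbar f z = 0"
  shows "f holomorphic_on S"
  using field_differentiable_of_d_zbar smooth_onD(1)[OF assms(1,2)] assms(2,3)
  unfolding holomorphic_on_open[OF assms(2)] by blast

section \<open>Cut-off functions\<close>

text \<open>With \<open>x = Re z\<close> this is \<open>x\<^sup>-\<^sup>m e\<^sup>-\<^sup>1\<^sup>/\<^sup>x\<close> for \<open>x > 0\<close>, continued by \<open>0\<close>. Differentiation only shifts the
exponent \<open>m\<close>, so the whole family is treated at once.\<close>

definition flat_exp :: "nat \<Rightarrow> complex \<Rightarrow> complex" where
  "flat_exp m z = (if Re z > 0
     then of_real (inverse (Re z) ^ m * exp (- inverse (Re z))) else 0)"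

lemma power_le_fact_exp:
  fixes y :: real
  assumes "y \<ge> 0"
  shows "y ^ n \<le> fact n * exp y"
proof -
  have "(\<Sum>k\<in>{n}. inverse (fact k) * y ^ k) \<le> (\<Sum>k. inverse (fact k) * y ^ k)"
    by (rule sum_le_suminf) (use assms summable_exp[of y] in auto)
  then have "inverse (fact n) * y ^ n \<le> exp y"
    by (simp add: exp_def scaleR_conv_of_real)
  then show ?thesis by (simp add: field_simps)
qed

text \<open>With \<open>y = 1/Re z\<close> this is \<open>y\<^sup>m\<^sup>+\<^sup>2 \<le> (m + 2)! e\<^sup>y\<close>. The quadratic bound makes the function flat along the
imaginary axis.\<close>

lemma norm_flat_exp_le: "norm (flat_exp m z) \<le> fact (m + 2) * (Re z)\<^sup>2"
proof (cases "Re z > 0")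
  case True
  define y where "y = inverse (Re z)"
  have y: "y > 0" "Re z = inverse y" using True by (auto simp: y_def)
  have "y ^ m * exp (- y) \<le> fact (m + 2) * (inverse y)\<^sup>2"
    using power_le_fact_exp[of y "m + 2"] y
    by (simp add: exp_minus field_simps power_add power2_eq_square)
  then show ?thesis using True y
    by (simp add: flat_exp_def norm_mult norm_power)
qed (simp add: flat_exp_def)

lemma wirtinger_Re: 
  "(\<lambda>z. of_real (Re z) :: complex) differentiable (at z)"
  "d_z (\<lambda>z. of_real (Re z)) z = 1/2" "d_zbar (\<lambda>z. of_real (Re z)) z = 1/2"
proof -
  have *: "((\<lambda>z. of_real (Re z) :: complex) has_derivative (\<lambda>v. (1/2) * v + (1/2) * cnj v)) (at z)"
    by (rule has_derivative_eq_rhs, (rule derivative_intros)+) (auto simp: complex_eq_iff)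
  then show "(\<lambda>z. of_real (Re z) :: complex) differentiable (at z)" by (auto simp: differentiable_def)
  from wirtinger_unique[OF *]
  show "d_z (\<lambda>z. of_real (Re z)) z = 1/2" "d_zbar (\<lambda>z. of_real (Re z)) z = 1/2" by auto
qed

text \<open>On the imaginary axis the derivative vanishes by the quadratic bound; elsewhere the chain rule
applies. Both derivatives are half the ordinary one, since the function depends on \<open>Re z\<close> only.\<close>

lemma wirtinger_flat_exp:
  "flat_exp m differentiable (at z)"
  "d_z (flat_exp m) z = (flat_exp (m + 2) z - of_nat m * flat_exp (m + 1) z) / 2"
  "d_zbar (flat_exp m) z = (flat_exp (m + 2) z - of_nat m * flat_exp (m + 1) z) / 2"
proof -
  have "flat_exp m differentiable (at z) \<and>
    d_z (flat_exp m) z = (flat_exp (m + 2) z - of_nat m * flat_exp (m + 1) z) / 2 \<and>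
    d_zbar (flat_exp m) z = (flat_exp (m + 2) z - of_nat m * flat_exp (m + 1) z) / 2"
  proof (cases "Re z" "0 :: real" rule: linorder_cases)
    case less
    have "(flat_exp m differentiable (at z)) = ((\<lambda>_. 0 :: complex) differentiable (at z))"
      "d_z (flat_exp m) z = d_z (\<lambda>_. 0) z" "d_zbar (flat_exp m) z = d_zbar (\<lambda>_. 0) z"
      by (rule wirtinger_cong[where S="{w. Re w < 0}"]; use less in \<open>auto simp: flat_exp_def open_halfspace_Re_lt\<close>)+
    then show ?thesis using less by (simp add: flat_exp_def)
  next
    case equal
    have "((\<lambda>w. norm (flat_exp m w - flat_exp m z - (0 * (w - z) + 0 * cnj (w - z))) / norm (w - z)) \<longlongrightarrow> 0) (at z)"
    proof (rule tendsto_sandwich[OF _ _ tendsto_const])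
      show "\<forall>\<^sub>F w in at z. 0 \<le> norm (flat_exp m w - flat_exp m z - (0 * (w - z) + 0 * cnj (w - z))) / norm (w - z)"
        by simp
      show "\<forall>\<^sub>F w in at z. norm (flat_exp m w - flat_exp m z - (0 * (w - z) + 0 * cnj (w - z))) / norm (w - z)
        \<le> fact (m + 2) * norm (w - z)"
        unfolding eventually_at_filter
      proof (rule always_eventually, intro allI impI)
        fix w assume "w \<noteq> z"
        have "\<bar>Re w\<bar> \<le> norm (w - z)" using abs_Re_le_cmod[of "w - z"] equal by simp
        then have "(Re w)\<^sup>2 \<le> norm (w - z) ^ 2"
          by (metis abs_ge_zero power2_abs power_mono)
        then have "norm (flat_exp m w) \<le> fact (m + 2) * norm (w - z) ^ 2"
          by (meson norm_flat_exp_le dual_order.trans fact_ge_zero mult_left_mono)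
        then show "norm (flat_exp m w - flat_exp m z - (0 * (w - z) + 0 * cnj (w - z))) / norm (w - z)
          \<le> fact (m + 2) * norm (w - z)"
          using \<open>w \<noteq> z\<close> equal by (simp add: flat_exp_def divide_le_eq power2_eq_square mult.assoc)
      qed
      show "((\<lambda>w. fact (m + 2) * norm (w - z)) \<longlongrightarrow> 0) (at z)"
        by (rule tendsto_eq_intros refl | simp)+
    qed
    moreover have "bounded_linear (\<lambda>v. 0 * v + 0 * cnj v :: complex)"
      by (simp add: bounded_linear_zero)
    ultimately have *: "(flat_exp m has_derivative (\<lambda>v. 0 * v + 0 * cnj v)) (at z)"
      unfolding has_derivative_iff_norm by simp
    then have "flat_exp m differentiable (at z)" by (auto simp: differentiable_def)
    with wirtinger_unique[OF *] equal show ?thesis by (simp add: flat_exp_def)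
  next
    case greater
    define g where "g = (\<lambda>w::complex. inverse w ^ m * exp (- inverse w))"
    have o: "open {w. Re w > 0}" by (simp add: open_halfspace_Re_gt)
    define x where "x = complex_of_real (Re z)"
    have x0: "x \<noteq> 0" using greater by (simp add: x_def)
    have "(g has_field_derivative
        (inverse x ^ (m + 2) - of_nat m * inverse x ^ (m + 1)) * exp (- inverse x)) (at x)"
      unfolding g_def using x0
      by (auto intro!: derivative_eq_intros simp: algebra_simps power2_eq_square)
         (cases m, auto simp: field_simps)
    then have g: "g field_differentiable (at x)"
      "deriv g x = (inverse x ^ (m + 2) - of_nat m * inverse x ^ (m + 1)) * exp (- inverse x)"
      by (auto simp: field_differentiable_def DERIV_imp_deriv)
    have eq: "flat_exp m w = g (of_real (Re w))" if "w \<in> {w. Re w > 0}" for w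
      using that by (simp add: flat_exp_def g_def exp_of_real [symmetric])
    have fl: "flat_exp k z = inverse x ^ k * exp (- inverse x)" for k
      using greater by (simp add: flat_exp_def x_def exp_of_real [symmetric])
    note gg = wirtinger_holomorphic[OF g(1)]
    have gd: "g differentiable (at (complex_of_real (Re z)))" using gg(1) by (simp add: x_def)
    note c = wirtinger_chain[OF wirtinger_Re(1) gd]
    note c' = wirtinger_cong[OF o, of z "flat_exp m" "\<lambda>w. g (of_real (Re w))"]
    have "flat_exp m differentiable (at z)" using c' c(1) eq greater by simp
    moreover have "d_z (flat_exp m) z = deriv g x * (1/2)" "d_zbar (flat_exp m) z = deriv g x * (1/2)"
      using c' c(2,3) eq greater gg(2,3) by (auto simp: wirtinger_Re x_def)
    ultimately show ?thesis by (simp add: g(2) fl algebra_simps)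
  qed
  then show "flat_exp m differentiable (at z)"
  "d_z (flat_exp m) z = (flat_exp (m + 2) z - of_nat m * flat_exp (m + 1) z) / 2"
  "d_zbar (flat_exp m) z = (flat_exp (m + 2) z - of_nat m * flat_exp (m + 1) z) / 2" by auto
qed

text \<open>The derivatives are combinations of members of the family, so differentiability of every member
gives smoothness of every member by induction on the order.\<close>

lemma smooth_flat_exp: "smooth_on UNIV (flat_exp m)"
proof -
  have "Ck k UNIV (flat_exp m)" for k
  proof (induction k arbitrary: m)
    case 0
    show ?case
      using differentiable_imp_continuous_within[OF wirtinger_flat_exp(1)]
      by (simp add: continuous_on_eq_continuous_at)
  next
    case (Suc k)
    have D: "Ck k UNIV (\<lambda>z. (1/2) * flat_exp (m + 2) z + (- of_nat m / 2) * flat_exp (m + 1) z)"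
      by (intro Ck_add_cmult Suc.IH open_UNIV)
    have "Ck k UNIV (d_z (flat_exp m))"
      by (rule Ck_transform[OF open_UNIV D]) (simp add: wirtinger_flat_exp field_simps)
    moreover have "Ck k UNIV (d_zbar (flat_exp m))"
      by (rule Ck_transform[OF open_UNIV D]) (simp add: wirtinger_flat_exp field_simps)
    moreover have "flat_exp m differentiable_on UNIV"
      using wirtinger_flat_exp(1) by (simp add: differentiable_on_def)
    ultimately show ?case by (simp add: Ck_Suc_wirtinger[OF open_UNIV] del: Ck.simps)
  qed
  then show ?thesis by (simp add: smooth_on_def)
qed

definition bump :: "complex \<Rightarrow> real" where
  "bump t = (if norm t < 1 then exp (- inverse (1 - (norm t)\<^sup>2)) else 0)"

lemma smooth_norm_square: "smooth_on UNIV (\<lambda>t. of_real ((norm t)\<^sup>2))"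
proof -
  have "smooth_on UNIV (\<lambda>t. t * cnj t)" by (intro smooth_intros open_UNIV)
  then show ?thesis by (simp add: complex_norm_square del: of_real_power)
qed

lemma smooth_bump: "smooth_on UNIV (\<lambda>t. of_real (bump t))"
proof -
  have "smooth_on UNIV (\<lambda>t. 1 - complex_of_real ((norm t)\<^sup>2))"
    by (intro smooth_intros open_UNIV smooth_norm_square)
  then have "smooth_on UNIV (\<lambda>t. flat_exp 0 (1 - of_real ((norm t)\<^sup>2)))"
    by (rule smooth_on_compose[OF open_UNIV open_UNIV _ smooth_flat_exp]) auto
  moreover have "flat_exp 0 (1 - of_real ((norm t)\<^sup>2)) = of_real (bump t)" for t :: complex
    by (auto simp: flat_exp_def bump_def abs_square_less_1 simp flip: of_real_power)
  ultimately show ?thesis by simp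
qed

text \<open>The quotient \<open>A/(A + B)\<close>, where \<open>A\<close> vanishes exactly on the small disk and \<open>B\<close> exactly outside the large
one, so that the denominator has no zeros.\<close>

lemma smooth_plateau:
  assumes "0 < a" "a < b"
  obtains m where "smooth_on UNIV m" "\<And>t. norm t \<le> a \<Longrightarrow> m t = 0" "\<And>t. norm t \<ge> b \<Longrightarrow> m t = 1"
proof -
  define A where "A = (\<lambda>t::complex. flat_exp 0 (of_real ((norm t)\<^sup>2) - of_real (a\<^sup>2)))"
  define B where "B = (\<lambda>t::complex. flat_exp 0 (of_real (b\<^sup>2) - of_real ((norm t)\<^sup>2)))"
  have "smooth_on UNIV (\<lambda>t. complex_of_real ((norm t)\<^sup>2) - of_real (a\<^sup>2))"
    by (intro smooth_intros open_UNIV smooth_norm_square)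
  then have A: "smooth_on UNIV A" unfolding A_def
    by (rule smooth_on_compose[OF open_UNIV open_UNIV _ smooth_flat_exp]) auto
  have "smooth_on UNIV (\<lambda>t. of_real (b\<^sup>2) - complex_of_real ((norm t)\<^sup>2))"
    by (intro smooth_intros open_UNIV smooth_norm_square)
  then have B: "smooth_on UNIV B" unfolding B_def
    by (rule smooth_on_compose[OF open_UNIV open_UNIV _ smooth_flat_exp]) auto
  have A0: "A t = 0 \<longleftrightarrow> norm t \<le> a" and B0: "B t = 0 \<longleftrightarrow> norm t \<ge> b" for t
    using assms by (auto simp: A_def B_def flat_exp_def abs_le_square_iff[symmetric]
        not_less[symmetric] power_strict_mono simp flip: of_real_power dest: power2_less_imp_less)
  have "Re (A t) \<ge> 0" "Re (B t) \<ge> 0" "Im (A t) = 0" "Im (B t) = 0" for t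
    by (auto simp: A_def B_def flat_exp_def simp flip: of_real_power of_real_diff)
  then have AB: "A t + B t \<noteq> 0" for t
    using A0[of t] B0[of t] assms by (auto simp: complex_eq_iff add_nonneg_eq_0_iff)
  show ?thesis
  proof
    show "smooth_on UNIV (\<lambda>t. A t / (A t + B t))" by (intro smooth_intros open_UNIV A B AB)
  qed (use A0 B0 AB in auto)
qed

section \<open>Change of variables and Fubini in the complex plane\<close>

text \<open>Used to carry Fubini's theorem from \<open>\<real> \<times> \<real>\<close> and the change of variables formula from \<open>\<real>\<^sup>2\<close> over to
the complex plane: Lebesgue measure is determined by its values on boxes, and such a map takes boxes
to boxes with the same side lengths.\<close>

lemma distr_lborel_basis_isometry:
  fixes T :: "'a::euclidean_space \<Rightarrow> 'b::euclidean_space"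
  assumes lin: "linear T" and bij: "bij_betw T Basis Basis" and surj: "surj T"
    and inner: "\<And>x y. T x \<bullet> T y = x \<bullet> y"
  shows "distr lborel borel T = lborel"
proof (rule lborel_eqI[symmetric])
  fix l u :: 'b assume le: "\<And>b. b \<in> Basis \<Longrightarrow> l \<bullet> b \<le> u \<bullet> b"
  obtain l' u' where lu: "l = T l'" "u = T u'" using surj by (metis surjD)
  have B: "Basis = T ` Basis" using bij by (simp add: bij_betw_def)
  have "T \<in> borel_measurable borel"
    using lin by (intro borel_measurable_continuous_onI linear_continuous_on)
      (simp_all add: linear_conv_bounded_linear)
  then have meas: "T \<in> borel_measurable lborel" by simp
  have vimage: "T -` box l u = box l' u'"
    by (auto simp: box_def B lu inner)
  have "emeasure (distr lborel borel T) (box l u) = emeasure lborel (box l' u')"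
    using meas by (subst emeasure_distr) (auto simp: vimage)
  also have "\<dots> = (\<Prod>b\<in>Basis. (u' - l') \<bullet> b)"
  proof (rule emeasure_lborel_box)
    show "l' \<bullet> b \<le> u' \<bullet> b" if "b \<in> Basis" for b
      using le[of "T b"] that by (simp add: lu B inner)
  qed
  also have "(\<Prod>b\<in>Basis. (u' - l') \<bullet> b) = (\<Prod>b\<in>Basis. (u - l) \<bullet> b)"
    using prod.reindex_bij_betw[OF bij, of "\<lambda>b. (u - l) \<bullet> b"]
    by (simp add: lu inner linear_diff[OF lin, symmetric])
  finally show "emeasure (distr lborel borel T) (box l u) = ennreal (\<Prod>b\<in>Basis. (u - l) \<bullet> b)" .
qed simp

definition to_prod :: "complex \<Rightarrow> real \<times> real" where
  "to_prod z = (Re z, Im z)"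

definition to_vec :: "complex \<Rightarrow> real ^ 2" where
  "to_vec z = (\<chi> i. if i = 1 then Re z else Im z)"

definition of_vec :: "real ^ 2 \<Rightarrow> complex" where
  "of_vec x = Complex (x $ 1) (x $ 2)"

lemma of_to_vec [simp]: "of_vec (to_vec z) = z" "to_vec (of_vec x) = x"
  by (auto simp: of_vec_def to_vec_def vec_eq_iff forall_2)

lemma bounded_linear_vec: "bounded_linear to_vec" "bounded_linear of_vec"
proof -
  have "linear to_vec" by (rule linearI) (auto simp: to_vec_def vec_eq_iff)
  then show "bounded_linear to_vec" by (simp add: linear_conv_bounded_linear)
  have "linear of_vec" by (rule linearI) (auto simp: of_vec_def complex_eq_iff)
  then show "bounded_linear of_vec" by (simp add: linear_conv_bounded_linear)
qed

lemma distr_to_vec: "distr lborel borel to_vec = lborel"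
proof (rule distr_lborel_basis_isometry)
  show "linear to_vec" using bounded_linear_vec(1) by (simp add: bounded_linear.linear)
  show "surj to_vec" by (metis of_to_vec(2) surjI)
  show "to_vec x \<bullet> to_vec y = x \<bullet> y" for x y
    by (simp add: to_vec_def inner_vec_def sum_2 inner_complex_def)
  have "to_vec 1 = axis 1 1" "to_vec \<i> = axis 2 1"
    by (auto simp: to_vec_def axis_def vec_eq_iff forall_2)
  then show "bij_betw to_vec Basis Basis"
    by (auto simp: bij_betw_def inj_on_def Basis_complex_def Basis_vec_def UNIV_2 axis_eq_axis)
qed

lemma distr_to_prod: "distr lborel borel to_prod = lborel"
proof (rule distr_lborel_basis_isometry)
  show "linear to_prod" by (rule linearI) (auto simp: to_prod_def)
  show "surj to_prod" by (rule surjI[of _ "\<lambda>(x, y). Complex x y"]) (auto simp: to_prod_def)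
  show "to_prod x \<bullet> to_prod y = x \<bullet> y" for x y
    by (simp add: to_prod_def inner_complex_def)
  show "bij_betw to_prod Basis Basis"
    by (auto simp: bij_betw_def inj_on_def Basis_complex_def Basis_prod_def to_prod_def)
qed

lemma absolutely_integrable_iff_lborel:
  fixes f :: "'a::euclidean_space \<Rightarrow> 'b::euclidean_space"
  assumes "(\<lambda>x. indicator A x *\<^sub>R f x) \<in> borel_measurable borel"
  shows "f absolutely_integrable_on A \<longleftrightarrow> integrable lborel (\<lambda>x. indicator A x *\<^sub>R f x)"
    "f absolutely_integrable_on A \<Longrightarrow> integral A f = (\<integral>x. indicator A x *\<^sub>R f x \<partial>lborel)"
proof -
  show "f absolutely_integrable_on A \<longleftrightarrow> integrable lborel (\<lambda>x. indicator A x *\<^sub>R f x)"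
    unfolding set_integrable_def using assms by (intro integrable_completion) simp
  assume "f absolutely_integrable_on A"
  then have "integral A f = (LINT x:A|lebesgue. f x)"
    by (simp add: set_lebesgue_integral_eq_integral(2))
  also have "\<dots> = (\<integral>x. indicator A x *\<^sub>R f x \<partial>lborel)"
    unfolding set_lebesgue_integral_def using assms by (intro integral_completion) simp
  finally show "integral A f = (\<integral>x. indicator A x *\<^sub>R f x \<partial>lborel)" .
qed

text \<open>Henstock-Kurzweil integrals over subsets agree with Lebesgue integrals of the function extended by
\<open>0\<close>, and the latter are transported by the measure-preserving map \<open>to_vec\<close>.\<close>

lemma integral_to_vec:
  fixes h :: "complex \<Rightarrow> complex"
  assumes meas: "(\<lambda>x. indicator A x *\<^sub>R h x) \<in> borel_measurable borel"
  shows "(\<lambda>x. to_vec (h (of_vec x))) absolutely_integrable_on (to_vec ` A) \<longleftrightarrow> h absolutely_integrable_on A"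
    and "h absolutely_integrable_on A \<Longrightarrow>
      integral (to_vec ` A) (\<lambda>x. to_vec (h (of_vec x))) = to_vec (integral A h)"
proof -
  let ?h = "\<lambda>x. indicator A x *\<^sub>R h x"
  let ?k = "\<lambda>x. indicator (to_vec ` A) x *\<^sub>R to_vec (h (of_vec x))"
  interpret V: bounded_linear to_vec by (rule bounded_linear_vec)
  interpret C: bounded_linear of_vec by (rule bounded_linear_vec)
  have mem: "x \<in> to_vec ` A \<longleftrightarrow> of_vec x \<in> A" for x by (metis image_iff of_to_vec)
  have k: "?k x = to_vec (?h (of_vec x))" for x
    by (auto simp: indicator_def mem)
  have kt: "indicator (to_vec ` A) (to_vec x) *\<^sub>R to_vec (h x) = to_vec (?h x)" for x
    using k[of "to_vec x"] by (simp only: of_to_vec)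
  have mv: "to_vec \<in> borel_measurable borel" "of_vec \<in> borel_measurable borel"
    by (auto intro!: borel_measurable_continuous_onI V.continuous_on C.continuous_on continuous_intros)
  have km: "?k \<in> borel_measurable borel"
    unfolding k using measurable_compose[OF measurable_compose[OF mv(2) meas] mv(1)] by (simp add: o_def)
  have "integrable lborel ?k \<longleftrightarrow> integrable (distr lborel borel to_vec) ?k"
    by (simp add: distr_to_vec)
  also have "\<dots> \<longleftrightarrow> integrable lborel (\<lambda>x. to_vec (?h x))"
    using km mv by (subst integrable_distr_eq) (simp_all add: kt del: V.scaleR C.scaleR)
  also have "\<dots> \<longleftrightarrow> integrable lborel ?h"
    using integrable_bounded_linear[OF bounded_linear_vec(1), of lborel ?h]
      integrable_bounded_linear[OF bounded_linear_vec(2), of lborel "\<lambda>x. to_vec (?h x)"]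
    by (auto simp del: V.scaleR C.scaleR)
  finally have i: "integrable lborel ?k \<longleftrightarrow> integrable lborel ?h" .
  then show "(\<lambda>x. to_vec (h (of_vec x))) absolutely_integrable_on (to_vec ` A) \<longleftrightarrow> h absolutely_integrable_on A"
    using absolutely_integrable_iff_lborel(1)[OF km] absolutely_integrable_iff_lborel(1)[OF meas] by simp
  assume ai: "h absolutely_integrable_on A"
  then have ih: "integrable lborel ?h" using absolutely_integrable_iff_lborel(1)[OF meas] by simp
  have "integral (to_vec ` A) (\<lambda>x. to_vec (h (of_vec x))) = (\<integral>x. ?k x \<partial>lborel)"
    using absolutely_integrable_iff_lborel[OF km] i ih by simp
  also have "\<dots> = (\<integral>x. ?k x \<partial>distr lborel borel to_vec)" by (simp add: distr_to_vec)
  also have "\<dots> = (\<integral>x. to_vec (?h x) \<partial>lborel)"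
    using km mv by (subst integral_distr) (simp_all add: kt del: V.scaleR C.scaleR)
  also have "\<dots> = to_vec (\<integral>x. ?h x \<partial>lborel)"
    by (rule integral_bounded_linear[OF bounded_linear_vec(1) ih])
  also have "(\<integral>x. ?h x \<partial>lborel) = integral A h"
    using absolutely_integrable_iff_lborel(2)[OF meas ai] by simp
  finally show "integral (to_vec ` A) (\<lambda>x. to_vec (h (of_vec x))) = to_vec (integral A h)" .
qed

lemma absolutely_integrable_compact_support:
  fixes g :: "complex \<Rightarrow> complex"
  assumes "continuous_on A g" "compact K" "K \<subseteq> A" "\<And>z. z \<in> A - K \<Longrightarrow> g z = 0"
  shows "g absolutely_integrable_on A"
proof -
  have "set_integrable lborel K g"
    using borel_integrable_compact[OF assms(2) continuous_on_subset[OF assms(1,3)]]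
    by (simp add: set_integrable_def indicator_scaleR_eq_if)
  then have "integrable lborel (\<lambda>x. indicator K x *\<^sub>R g x)" by (simp add: set_integrable_def)
  then have "integrable lebesgue (\<lambda>x. indicator K x *\<^sub>R g x)"
    by (subst integrable_completion) auto
  moreover have "(\<lambda>x. indicator K x *\<^sub>R g x) = (\<lambda>x. indicator A x *\<^sub>R g x)"
    using assms(3,4) by (auto simp: fun_eq_iff indicator_def)
  ultimately show ?thesis by (simp add: set_integrable_def)
qed

lemma det_complex_mult: "det (matrix (\<lambda>v. to_vec (c * of_vec v))) = (norm c)\<^sup>2"
  by (simp add: det_2 matrix_def to_vec_def of_vec_def axis_def cmod_def power2_eq_square)

text \<open>The Jacobian determinant of \<open>\<phi>\<close> is that of multiplication by \<open>\<phi>'\<close>, namely \<open>|\<phi>'|\<^sup>2\<close>. Compact support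
makes both sides integrable.\<close>

lemma holomorphic_change_of_variables:
  fixes g :: "complex \<Rightarrow> complex"
  assumes S: "open S" and hol: "\<phi> holomorphic_on S" and inj: "inj_on \<phi> S"
    and K: "compact K" "K \<subseteq> \<phi> ` S" "\<And>w. w \<in> \<phi> ` S - K \<Longrightarrow> g w = 0"
    and g: "continuous_on (\<phi> ` S) g"
  shows "integral (\<phi> ` S) g = integral S (\<lambda>z. of_real ((norm (deriv \<phi> z))\<^sup>2) * g (\<phi> z))"
proof -
  define A where "A = \<phi> ` S"
  have oA: "open A"
    unfolding A_def using S hol inj holomorphic_on_imp_continuous_on invariance_of_domain by blast
  interpret V: bounded_linear to_vec by (rule bounded_linear_vec)
  interpret C: bounded_linear of_vec by (rule bounded_linear_vec)
  have mem: "x \<in> to_vec ` B \<longleftrightarrow> of_vec x \<in> B" for x B by (metis image_iff of_to_vec)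
  have mA: "(\<lambda>x. indicator A x *\<^sub>R g x) \<in> borel_measurable borel"
    using borel_measurable_continuous_on_indicator[OF _ g] oA by (simp add: A_def)
  let ?h = "\<lambda>z. of_real ((norm (deriv \<phi> z))\<^sup>2) * g (\<phi> z)"
  have ch: "continuous_on S ?h"
    by (intro continuous_intros holomorphic_on_imp_continuous_on holomorphic_deriv hol S
        continuous_on_compose2[OF g]) auto
  then have mS: "(\<lambda>x. indicator S x *\<^sub>R ?h x) \<in> borel_measurable borel"
    using borel_measurable_continuous_on_indicator[OF _ ch] S by simp
  have gA: "g absolutely_integrable_on A"
    using absolutely_integrable_compact_support[of A g K] g K by (auto simp: A_def)
  let ?\<Phi> = "\<lambda>x. to_vec (\<phi> (of_vec x))"
  let ?D = "\<lambda>x v. to_vec (deriv \<phi> (of_vec x) * of_vec v)"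
  have im: "?\<Phi> ` to_vec ` S = to_vec ` A" by (simp add: image_image A_def)
  have "open (to_vec ` S)"
  proof -
    have "to_vec ` S = of_vec -` S" using mem by auto
    then show ?thesis using S linear_continuous_at[OF bounded_linear_vec(2)] continuous_open_vimage by metis
  qed
  then have sets: "to_vec ` S \<in> sets lebesgue" by (simp add: borel_open)
  have der: "(?\<Phi> has_derivative ?D x) (at x within to_vec ` S)" if "x \<in> to_vec ` S" for x
  proof -
    have "(\<phi> has_field_derivative deriv \<phi> (of_vec x)) (at (of_vec x))"
      using holomorphic_derivI[OF hol S] that[unfolded mem] by blast
    then have "(\<phi> has_derivative (*) (deriv \<phi> (of_vec x))) (at (of_vec x))"
      by (simp add: has_field_derivative_def)
    then have "((\<lambda>x. \<phi> (of_vec x)) has_derivative (\<lambda>v. deriv \<phi> (of_vec x) * of_vec v)) (at x)"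
      using has_derivative_compose[OF bounded_linear_imp_has_derivative[OF bounded_linear_vec(2)]] by blast
    then have "(?\<Phi> has_derivative ?D x) (at x)" by (rule V.has_derivative)
    then show ?thesis by (rule has_derivative_at_withinI)
  qed
  have inj': "inj_on ?\<Phi> (to_vec ` S)"
    using inj by (auto simp: inj_on_def) (metis of_to_vec(1))
  note cov = has_absolute_integral_change_of_variables[OF sets der inj',
      of "\<lambda>x. to_vec (g (of_vec x))" "to_vec (integral A g)", unfolded im]
  have eq: "\<bar>det (matrix (?D x))\<bar> *\<^sub>R to_vec (g (of_vec (?\<Phi> x))) = to_vec (?h (of_vec x))" for x
    by (simp add: det_complex_mult flip: V.scaleR scaleR_conv_of_real of_real_power)
  have "(\<lambda>x. to_vec (?h (of_vec x))) absolutely_integrable_on to_vec ` S \<and>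
      integral (to_vec ` S) (\<lambda>x. to_vec (?h (of_vec x))) = to_vec (integral A g)"
    using cov integral_to_vec[OF mA] gA unfolding eq by simp
  then have "to_vec (integral S ?h) = to_vec (integral A g)"
    using integral_to_vec[OF mS] by metis
  then show ?thesis unfolding A_def by (metis of_to_vec(1))
qed

lemma integral_cbox_to_prod:
  fixes g :: "complex \<Rightarrow> complex"
  assumes g: "continuous_on (cbox a b) g"
  shows "integral (cbox a b) g =
    integral (cbox (Re a) (Re b)) (\<lambda>x. integral (cbox (Im a) (Im b)) (\<lambda>y. g (Complex x y)))"
proof -
  let ?B = "cbox (Re a, Im a) (Re b, Im b)"
  let ?g = "\<lambda>(x, y). g (Complex x y)"
  have cg: "continuous_on ?B ?g"
    unfolding split_beta by (rule continuous_on_compose2[OF g])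
      (auto intro!: continuous_intros simp: in_cbox_complex_iff cbox_Pair_eq Complex_eq)
  have ga: "g absolutely_integrable_on cbox a b"
    by (rule absolutely_integrable_compact_support[OF g, of "cbox a b"]) auto
  have m: "(\<lambda>x. indicator (cbox a b) x *\<^sub>R g x) \<in> borel_measurable borel"
    using borel_measurable_continuous_on_indicator[OF _ g] by simp
  have m': "(\<lambda>x. indicator ?B x *\<^sub>R ?g x) \<in> borel_measurable borel"
    using borel_measurable_continuous_on_indicator[OF _ cg] by simp
  have tp: "to_prod \<in> borel_measurable borel"
    unfolding to_prod_def by (auto intro!: borel_measurable_continuous_onI continuous_intros)
  have ga': "?g absolutely_integrable_on ?B" 
    using absolutely_integrable_continuous[OF cg] .
  have "integral ?B ?g = (\<integral>x. indicator ?B x *\<^sub>R ?g x \<partial>distr lborel borel to_prod)"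
    unfolding distr_to_prod by (rule absolutely_integrable_iff_lborel(2)[OF m' ga'])
  also have "\<dots> = (\<integral>x. indicator ?B (to_prod x) *\<^sub>R ?g (to_prod x) \<partial>lborel)"
    using m' tp by (subst integral_distr) auto
  also have "(\<lambda>x. indicator ?B (to_prod x) *\<^sub>R ?g (to_prod x)) = (\<lambda>x. indicator (cbox a b) x *\<^sub>R g x)"
    by (auto simp: fun_eq_iff to_prod_def indicator_def in_cbox_complex_iff cbox_Pair_eq)
  also have "(\<integral>x. indicator (cbox a b) x *\<^sub>R g x \<partial>lborel) = integral (cbox a b) g"
    using absolutely_integrable_iff_lborel(2)[OF m ga] by simp
  finally show ?thesis using integral_prod_continuous[OF cg] by simp
qed

section \<open>Green's formula\<close>

lemma wirtinger_along_line:
  assumes "F differentiable (at (p + of_real t * e))"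
  shows "((\<lambda>t. F (p + of_real t * e)) has_vector_derivative
     (d_z F (p + of_real t * e) * e + d_zbar F (p + of_real t * e) * cnj e)) (at t within T)"
proof -
  have "((\<lambda>t. p + of_real t * e) has_derivative (\<lambda>s. of_real s * e)) (at t within T)"
    by (rule has_derivative_eq_rhs, (rule derivative_intros)+) auto
  from has_derivative_compose[OF this wirtinger_derivative[OF assms]]
  show ?thesis
    by (simp add: has_vector_derivative_def scaleR_conv_of_real algebra_simps)
qed

lemma integral_along_line:
  assumes "c \<le> d" "\<And>t. t \<in> {c..d} \<Longrightarrow> F differentiable (at (p + of_real t * e))"
  shows "((\<lambda>t. d_z F (p + of_real t * e) * e + d_zbar F (p + of_real t * e) * cnj e) has_integral
     (F (p + of_real d * e) - F (p + of_real c * e))) {c..d}"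
  by (rule fundamental_theorem_of_calculus[OF assms(1)]) (use wirtinger_along_line assms(2) in blast)

lemma Complex_as_lines:
  "Complex x y = \<i> * of_real y + of_real x * 1" "Complex x y = of_real x + of_real y * \<i>"
  by (auto simp: complex_eq_iff)

lemma integral_horizontal_line:
  assumes "c \<le> d" "\<And>x. x \<in> {c..d} \<Longrightarrow> F differentiable (at (Complex x y))"
  shows "((\<lambda>x. d_z F (Complex x y) + d_zbar F (Complex x y)) has_integral
    (F (Complex d y) - F (Complex c y))) {c..d}"
proof -
  have "((\<lambda>t. d_z F (\<i> * of_real y + of_real t * 1) * 1 + d_zbar F (\<i> * of_real y + of_real t * 1) * cnj 1)
       has_integral (F (\<i> * of_real y + of_real d * 1) - F (\<i> * of_real y + of_real c * 1))) {c..d}"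
    by (rule integral_along_line[OF assms(1)])
      (use assms(2) in \<open>simp flip: Complex_as_lines(1)[simplified]\<close>)
  then show ?thesis by (simp only: Complex_as_lines(1) complex_cnj_one mult_1_right)
qed

lemma integral_vertical_line:
  assumes "c \<le> d" "\<And>y. y \<in> {c..d} \<Longrightarrow> F differentiable (at (Complex x y))"
  shows "((\<lambda>y. \<i> * (d_z F (Complex x y) - d_zbar F (Complex x y))) has_integral
    (F (Complex x d) - F (Complex x c))) {c..d}"
proof -
  have "((\<lambda>t. d_z F (of_real x + of_real t * \<i>) * \<i> + d_zbar F (of_real x + of_real t * \<i>) * cnj \<i>)
       has_integral (F (of_real x + of_real d * \<i>) - F (of_real x + of_real c * \<i>))) {c..d}"
    by (rule integral_along_line[OF assms(1)])
      (use assms(2) in \<open>simp flip: Complex_as_lines(2)\<close>)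
  then show ?thesis unfolding Complex_as_lines(2) by (simp add: algebra_simps)
qed

lemma cbox_swap_integral:
  fixes g :: "complex \<Rightarrow> complex"
  assumes "continuous_on (cbox a b) g"
  shows "integral {Re a..Re b} (\<lambda>x. integral {Im a..Im b} (\<lambda>y. g (Complex x y))) =
         integral {Im a..Im b} (\<lambda>y. integral {Re a..Re b} (\<lambda>x. g (Complex x y)))"
proof -
  have "continuous_on (cbox (Re a, Im a) (Re b, Im b)) (\<lambda>(x, y). g (Complex x y))"
    unfolding split_beta by (rule continuous_on_compose2[OF assms])
      (auto intro!: continuous_intros simp: in_cbox_complex_iff cbox_Pair_eq Complex_eq)
  from integral_swap_continuous[OF this] show ?thesis by simp
qed

text \<open>Here \<open>\<partial>/\<partial>x\<close> is the sum of the Wirtinger derivatives and \<open>\<partial>/\<partial>y\<close> is \<open>i\<close> times their difference. Fubini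
reduces both formulas to the fundamental theorem of calculus on lines.\<close>

lemma integral_cbox_partials:
  assumes le: "Re a \<le> Re b" "Im a \<le> Im b" and S: "open S" "cbox a b \<subseteq> S"
    and F: "\<And>z. z \<in> S \<Longrightarrow> F differentiable (at z)"
    and c: "continuous_on S (d_z F)" "continuous_on S (d_zbar F)"
  shows "integral (cbox a b) (\<lambda>z. d_z F z + d_zbar F z) =
      integral {Im a..Im b} (\<lambda>y. F (Complex (Re b) y) - F (Complex (Re a) y))" (is ?X)
    and "integral (cbox a b) (\<lambda>z. \<i> * (d_z F z - d_zbar F z)) =
      integral {Re a..Re b} (\<lambda>x. F (Complex x (Im b)) - F (Complex x (Im a)))" (is ?Y)
proof -
  have mem: "Complex x y \<in> cbox a b" if "x \<in> {Re a..Re b}" "y \<in> {Im a..Im b}" for x y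
    using that by (auto simp: in_cbox_complex_iff)
  have c': "continuous_on (cbox a b) (\<lambda>z. d_z F z + d_zbar F z)"
    "continuous_on (cbox a b) (\<lambda>z. \<i> * (d_z F z - d_zbar F z))"
    by (intro continuous_intros continuous_on_subset[OF c(1) S(2)] continuous_on_subset[OF c(2) S(2)])+
  have x: "integral {Re a..Re b} (\<lambda>x. d_z F (Complex x y) + d_zbar F (Complex x y)) =
      F (Complex (Re b) y) - F (Complex (Re a) y)" if "y \<in> {Im a..Im b}" for y
    by (intro integral_unique integral_horizontal_line le(1)) (use F S mem that in auto)
  have y: "integral {Im a..Im b} (\<lambda>y. \<i> * (d_z F (Complex x y) - d_zbar F (Complex x y))) =
      F (Complex x (Im b)) - F (Complex x (Im a))" if "x \<in> {Re a..Re b}" for x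
    by (intro integral_unique integral_vertical_line le(2)) (use F S mem that in auto)
  show ?X
    using x unfolding integral_cbox_to_prod[OF c'(1)] cbox_interval cbox_swap_integral[OF c'(1)]
    by (intro integral_cong)
  show ?Y
    using y unfolding integral_cbox_to_prod[OF c'(2)] cbox_interval
    by (intro integral_cong)
qed

lemma has_integral_zero_imp_zero:
  fixes k :: "complex \<Rightarrow> complex"
  assumes S: "open S" "z0 \<in> S" and k: "continuous_on S k"
    and zero: "\<And>a b. Re a \<le> Re b \<Longrightarrow> Im a \<le> Im b \<Longrightarrow> cbox a b \<subseteq> S \<Longrightarrow> integral (cbox a b) k = 0"
  shows "k z0 = 0"
proof (rule ccontr)
  assume nz: "k z0 \<noteq> 0"
  define e where "e = norm (k z0) / 2"
  have e: "e > 0" using nz by (simp add: e_def)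
  obtain d where d: "d > 0" "\<And>z. dist z z0 < d \<Longrightarrow> z \<in> S \<Longrightarrow> dist (k z) (k z0) < e"
    using k S(2) e unfolding continuous_on_iff by (metis dist_commute)
  obtain d' where d': "d' > 0" "ball z0 d' \<subseteq> S" using S open_contains_ball by blast
  \<comment> \<open>A square of side \<open>r\<close> lies in the disk of radius \<open>r\<close> around its centre.\<close>
  define r where "r = min d d' / 2"
  have r: "r > 0" "cball z0 r \<subseteq> S" using d(1) d' by (auto simp: r_def subset_iff dist_commute)
  define a b where "a = z0 - Complex (r/2) (r/2)" and "b = z0 + Complex (r/2) (r/2)"
  have sub: "cbox a b \<subseteq> cball z0 r"
  proof
    fix w assume w: "w \<in> cbox a b"
    have "norm (w - z0) \<le> \<bar>Re (w - z0)\<bar> + \<bar>Im (w - z0)\<bar>" by (rule cmod_le)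
    also have "\<dots> \<le> r" using w by (auto simp: a_def b_def in_cbox_complex_iff)
    finally show "w \<in> cball z0 r" by (simp add: dist_norm norm_minus_commute)
  qed
  have near: "norm (k w - k z0) \<le> e" if "w \<in> cbox a b" for w
  proof -
    have "dist z0 w \<le> r" "w \<in> S" using sub r(2) that by auto
    then have "dist w z0 < d" using d(1) d'(1) by (auto simp: r_def dist_commute)
    then show ?thesis using d(2)[OF _ \<open>w \<in> S\<close>] by (simp add: dist_norm less_imp_le)
  qed
  have ki: "k integrable_on cbox a b"
    using sub r(2) by (intro integrable_continuous continuous_on_subset[OF k]) auto
  have z: "integral (cbox a b) k = 0"
    using zero[of a b] sub r by (auto simp: a_def b_def)
  have "((\<lambda>w. k w - k z0) has_integral (0 - measure lborel (cbox a b) *\<^sub>R k z0)) (cbox a b)"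
    using ki z by (intro has_integral_diff has_integral_const) (metis integrable_integral)
  from has_integral_bound[OF _ this near] e
  have "norm (measure lborel (cbox a b) *\<^sub>R k z0) \<le> e * measure lborel (cbox a b)" by simp
  moreover have "measure lborel (cbox a b) > 0"
    using r(1) by (subst content_pos_lt_eq) (auto simp: a_def b_def Basis_complex_def)
  ultimately show False using nz by (simp add: e_def)
qed

text \<open>Both orders of the mixed second partial derivatives integrate over a rectangle to the alternating
sum of the values of \<open>h\<close> at its corners. As this holds for all small rectangles, the continuous
integrands agree.\<close>

lemma wirtinger_commute:
  assumes h: "smooth_on S h" and S: "open S" and z: "z \<in> S"
  shows "d_z (d_zbar h) z = d_zbar (d_z h) z"
proof -
  note D = smooth_onD[OF _ S]
  have s: "smooth_on S (d_z h)" "smooth_on S (d_zbar h)" using D h by auto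
  note s2 = D(3)[OF s(1)] D(4)[OF s(1)] D(3)[OF s(2)] D(4)[OF s(2)]
  \<comment> \<open>These are \<open>\<partial>h/\<partial>x\<close> and \<open>\<partial>h/\<partial>y\<close>, and \<open>k\<close> is the difference of the two mixed derivatives.\<close>
  define hx hy where "hx = (\<lambda>z. d_z h z + d_zbar h z)" and "hy = (\<lambda>z. \<i> * (d_z h z - d_zbar h z))"
  have sm: "smooth_on S hx" "smooth_on S hy"
    unfolding hx_def hy_def by (intro smooth_intros S s)+
  have e1: "d_z hx w = d_z (d_z h) w + d_z (d_zbar h) w" "d_zbar hx w = d_zbar (d_z h) w + d_zbar (d_zbar h) w"
    if "w \<in> S" for w
    unfolding hx_def using D(1)[OF s(1) that] D(1)[OF s(2) that] by (auto simp: wirtinger_add)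
  have e2: "d_z hy w = \<i> * (d_z (d_z h) w - d_z (d_zbar h) w)" "d_zbar hy w = \<i> * (d_zbar (d_z h) w - d_zbar (d_zbar h) w)"
    if "w \<in> S" for w
    unfolding hy_def using D(1)[OF s(1) that] D(1)[OF s(2) that] by (auto simp: wirtinger_cmult wirtinger_minus)
  define k where "k = (\<lambda>w. (\<i> * (d_z hx w - d_zbar hx w)) - (d_z hy w + d_zbar hy w))"
  have c: "continuous_on S (d_z hx)" "continuous_on S (d_zbar hx)" "continuous_on S (d_z hy)" "continuous_on S (d_zbar hy)"
    using D sm by auto
  have ck: "continuous_on S k" unfolding k_def by (intro continuous_intros c)
  have "k z = 0"
  proof (rule has_integral_zero_imp_zero[OF S z ck])
    fix a b assume le: "Re a \<le> Re b" "Im a \<le> Im b" and sub: "cbox a b \<subseteq> S"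
    have mem: "Complex x y \<in> S" if "x \<in> {Re a..Re b}" "y \<in> {Im a..Im b}" for x y
      using that sub by (auto simp: in_cbox_complex_iff subset_iff)
    have ii: "g integrable_on cbox a b" if "continuous_on S g" for g :: "complex \<Rightarrow> complex"
      using that sub continuous_on_subset integrable_continuous by blast
    have "integral (cbox a b) (\<lambda>w. \<i> * (d_z hx w - d_zbar hx w)) =
      integral {Re a..Re b} (\<lambda>x. hx (Complex x (Im b)) - hx (Complex x (Im a)))"
      by (rule integral_cbox_partials(2)[OF le S sub D(1)[OF sm(1)] c(1,2)])
    also have "\<dots> = (h b - h (Complex (Re a) (Im b))) - (h (Complex (Re b) (Im a)) - h a)"
    proof -
      have "((\<lambda>x. hx (Complex x y)) has_integral (h (Complex (Re b) y) - h (Complex (Re a) y))) {Re a..Re b}"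
        if "y \<in> {Im a..Im b}" for y
        unfolding hx_def by (rule integral_horizontal_line[OF le(1)]) (use D(1)[OF h] mem that in auto)
      from has_integral_diff[OF this[of "Im b"] this[of "Im a"]] le show ?thesis
        by (simp add: integral_unique)
    qed
    finally have 1: "integral (cbox a b) (\<lambda>w. \<i> * (d_z hx w - d_zbar hx w)) =
        (h b - h (Complex (Re a) (Im b))) - (h (Complex (Re b) (Im a)) - h a)" .
    have "integral (cbox a b) (\<lambda>w. d_z hy w + d_zbar hy w) =
      integral {Im a..Im b} (\<lambda>y. hy (Complex (Re b) y) - hy (Complex (Re a) y))"
      by (rule integral_cbox_partials(1)[OF le S sub D(1)[OF sm(2)] c(3,4)])
    also have "\<dots> = (h b - h (Complex (Re b) (Im a))) - (h (Complex (Re a) (Im b)) - h a)"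
    proof -
      have "((\<lambda>y. hy (Complex x y)) has_integral (h (Complex x (Im b)) - h (Complex x (Im a)))) {Im a..Im b}"
        if "x \<in> {Re a..Re b}" for x
        unfolding hy_def by (rule integral_vertical_line[OF le(2)]) (use D(1)[OF h] mem that in auto)
      from has_integral_diff[OF this[of "Re b"] this[of "Re a"]] le show ?thesis
        by (simp add: integral_unique)
    qed
    finally have 2: "integral (cbox a b) (\<lambda>w. d_z hy w + d_zbar hy w) =
        (h b - h (Complex (Re b) (Im a))) - (h (Complex (Re a) (Im b)) - h a)" .
    have "integral (cbox a b) k = integral (cbox a b) (\<lambda>w. \<i> * (d_z hx w - d_zbar hx w))
        - integral (cbox a b) (\<lambda>w. d_z hy w + d_zbar hy w)"
      unfolding k_def by (intro Henstock_Kurzweil_Integration.integral_diff ii continuous_intros c)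
    then show "integral (cbox a b) k = 0" unfolding 1 2 by simp
  qed
  then show ?thesis by (simp add: k_def e1[OF z] e2[OF z] algebra_simps)
qed

lemma contour_integral_horizontal:
  assumes "c < d"
  shows "contour_integral (linepath (Complex c y) (Complex d y)) f = integral {c..d} (\<lambda>x. f (Complex x y))"
proof -
  have "linepath (Complex c y) (Complex d y) t = linepath (of_real c) (of_real d) t + \<i> * of_real y" for t
    by (auto simp: linepath_def complex_eq_iff algebra_simps)
  then have "contour_integral (linepath (Complex c y) (Complex d y)) f =
      contour_integral (linepath (of_real c) (of_real d)) (\<lambda>w. f (w + \<i> * of_real y))"
    by (simp add: contour_integral_integral Complex_eq)
  also have "\<dots> = integral {c..d} (\<lambda>x. f (of_real x + \<i> * of_real y))"
    using assms by (subst contour_integral_linepath_Reals_eq) auto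
  finally show ?thesis by (simp add: Complex_eq)
qed

lemma contour_integral_vertical:
  assumes "c < d"
  shows "contour_integral (linepath (Complex x c) (Complex x d)) f = \<i> * integral {c..d} (\<lambda>y. f (Complex x y))"
proof -
  have "linepath (Complex x c) (Complex x d) t = of_real x + \<i> * linepath (of_real c) (of_real d) t" for t
    by (auto simp: linepath_def complex_eq_iff algebra_simps)
  then have "contour_integral (linepath (Complex x c) (Complex x d)) f =
      contour_integral (linepath (of_real c) (of_real d)) (\<lambda>w. \<i> * f (of_real x + \<i> * w))"
    by (simp add: contour_integral_integral Complex_eq algebra_simps)
  also have "\<dots> = integral {c..d} (\<lambda>y. \<i> * f (of_real x + \<i> * of_real y))"
    using assms by (subst contour_integral_linepath_Reals_eq) auto
  finally show ?thesis by (simp add: Complex_eq)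
qed

text \<open>Green's formula for a rectangle, in the form \<open>d(F dz) = \<partial>F/\<partial>z' dz' \<and> dz\<close> with \<open>dz' \<and> dz = 2 i dx \<and> dy\<close>
and \<open>z'\<close> the conjugate coordinate.\<close>

lemma green_rectangle:
  assumes le: "Re a < Re b" "Im a < Im b" and S: "open S" "cbox a b \<subseteq> S" and F: "smooth_on S F"
  shows "2 * \<i> * integral (cbox a b) (d_zbar F) = contour_integral (rectpath a b) F"
proof -
  note D = smooth_onD[OF F S(1)]
  have c: "continuous_on S (d_z F)" "continuous_on S (d_zbar F)"
    using D(3,4) smooth_onD(2) S(1) by auto
  have cF: "continuous_on (cbox a b) F" using D(2) S(2) continuous_on_subset by blast
  have ii: "g integrable_on cbox a b" if "continuous_on S g" for g :: "complex \<Rightarrow> complex"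
    using that S(2) continuous_on_subset integrable_continuous by blast
  have le': "Re a \<le> Re b" "Im a \<le> Im b" using le by auto
  note P = integral_cbox_partials[OF le' S D(1) c]
  have ih: "(\<lambda>x. F (Complex x y)) integrable_on {Re a..Re b}" if "y \<in> {Im a..Im b}" for y
    by (intro integrable_continuous_real continuous_on_compose2[OF cF])
      (use that in \<open>auto intro!: continuous_intros simp: Complex_eq in_cbox_complex_iff\<close>)
  have iv: "(\<lambda>y. F (Complex x y)) integrable_on {Im a..Im b}" if "x \<in> {Re a..Re b}" for x
    by (intro integrable_continuous_real continuous_on_compose2[OF cF])
      (use that in \<open>auto intro!: continuous_intros simp: Complex_eq in_cbox_complex_iff\<close>)
  have ci: "F contour_integrable_on linepath u v" if "u \<in> cbox a b" "v \<in> cbox a b" for u v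
    using that by (intro contour_integrable_continuous_linepath continuous_on_subset[OF cF])
      (simp add: closed_segment_subset)
  have "2 * \<i> * integral (cbox a b) (d_zbar F) = integral (cbox a b) (\<lambda>z. 2 * \<i> * d_zbar F z)"
    by simp
  also have "\<dots> = integral (cbox a b) (\<lambda>z. \<i> * (d_z F z + d_zbar F z) - \<i> * (d_z F z - d_zbar F z))"
    by (simp add: algebra_simps)
  also have "\<dots> = \<i> * integral (cbox a b) (\<lambda>z. d_z F z + d_zbar F z)
      - integral (cbox a b) (\<lambda>z. \<i> * (d_z F z - d_zbar F z))"
    by (subst Henstock_Kurzweil_Integration.integral_diff) (auto intro!: ii continuous_intros c simp del: integral_mult_right integral_mult_left, simp)
  also have "\<dots> = \<i> * integral {Im a..Im b} (\<lambda>y. F (Complex (Re b) y) - F (Complex (Re a) y))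
      - integral {Re a..Re b} (\<lambda>x. F (Complex x (Im b)) - F (Complex x (Im a)))"
    by (simp only: P)
  also have "\<dots> = contour_integral (rectpath a b) F"
  proof -
    have corners: "a = Complex (Re a) (Im a)" "b = Complex (Re b) (Im b)" by auto
    have mem: "a \<in> cbox a b" "b \<in> cbox a b" "Complex (Re b) (Im a) \<in> cbox a b" "Complex (Re a) (Im b) \<in> cbox a b"
      using le by (auto simp: in_cbox_complex_iff)
    have e1: "contour_integral (rectpath a b) F =
        contour_integral (linepath a (Complex (Re b) (Im a))) F + contour_integral (linepath (Complex (Re b) (Im a)) b) F
        + contour_integral (linepath b (Complex (Re a) (Im b))) F + contour_integral (linepath (Complex (Re a) (Im b)) a) F"
      unfolding rectpath_def Let_def using ci mem by (simp add: contour_integral_join contour_integrable_joinI)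
    have e2: "contour_integral (linepath a (Complex (Re b) (Im a))) F = integral {Re a..Re b} (\<lambda>x. F (Complex x (Im a)))"
      using contour_integral_horizontal[OF le(1), of "Im a" F] by simp
    have e3: "contour_integral (linepath (Complex (Re b) (Im a)) b) F = \<i> * integral {Im a..Im b} (\<lambda>y. F (Complex (Re b) y))"
      using contour_integral_vertical[OF le(2), of "Re b" F] by simp
    have e4: "contour_integral (linepath b (Complex (Re a) (Im b))) F = - integral {Re a..Re b} (\<lambda>x. F (Complex x (Im b)))"
      using contour_integral_horizontal[OF le(1), of "Im b" F]
        contour_integral_reverse_linepath[of b "Complex (Re a) (Im b)" F] continuous_on_subset[OF cF closed_segment_subset[OF mem(2,4)]]
      by simp
    have e5: "contour_integral (linepath (Complex (Re a) (Im b)) a) F = - (\<i> * integral {Im a..Im b} (\<lambda>y. F (Complex (Re a) y)))"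
      using contour_integral_vertical[OF le(2), of "Re a" F]
        contour_integral_reverse_linepath[of "Complex (Re a) (Im b)" a F] continuous_on_subset[OF cF closed_segment_subset[OF mem(4,1)]]
      by simp
    have e6: "integral {Im a..Im b} (\<lambda>y. F (Complex (Re b) y) - F (Complex (Re a) y)) =
       integral {Im a..Im b} (\<lambda>y. F (Complex (Re b) y)) - integral {Im a..Im b} (\<lambda>y. F (Complex (Re a) y))"
      using iv le' by (intro Henstock_Kurzweil_Integration.integral_diff) auto
    have e7: "integral {Re a..Re b} (\<lambda>x. F (Complex x (Im b)) - F (Complex x (Im a))) =
       integral {Re a..Re b} (\<lambda>x. F (Complex x (Im b))) - integral {Re a..Re b} (\<lambda>x. F (Complex x (Im a)))"
      using ih le' by (intro Henstock_Kurzweil_Integration.integral_diff) auto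
    show ?thesis unfolding e1 e2 e3 e4 e5 e6 e7 by (simp add: right_diff_distrib)
  qed
  finally show ?thesis .
qed

lemma contour_integral_rectpath_zero:
  assumes "\<And>z. z \<in> path_image (rectpath a b) \<Longrightarrow> F z = 0"
  shows "contour_integral (rectpath a b) F = 0"
  using assms contour_integral_eq[of "rectpath a b" F "\<lambda>_. 0"] by simp

lemma integral_dbar_compact_support:
  assumes F: "smooth_on UNIV F" and R: "\<And>z. norm z > R \<Longrightarrow> F z = 0"
  shows "integral UNIV (d_zbar F) = 0"
proof -
  \<comment> \<open>A square so large that \<open>F\<close> vanishes on its boundary.\<close>
  define M where "M = \<bar>R\<bar> + 1"
  define a b where "a = - Complex M M" and "b = Complex M M"
  have out: "norm z > R" if "z \<notin> box a b" for z
  proof -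
    have "\<bar>Re z\<bar> \<ge> M \<or> \<bar>Im z\<bar> \<ge> M"
      using that by (auto simp: in_box_complex_iff a_def b_def M_def)
    then have "norm z \<ge> M" using abs_Re_le_cmod[of z] abs_Im_le_cmod[of z] by linarith
    then show ?thesis by (simp add: M_def)
  qed
  have lt: "Re a < Re b" "Im a < Im b" by (auto simp: a_def b_def M_def)
  have "contour_integral (rectpath a b) F = 0"
    using lt out R by (intro contour_integral_rectpath_zero) (auto simp: path_image_rectpath_cbox_minus_box)
  then have "integral (cbox a b) (d_zbar F) = 0"
    using green_rectangle[OF lt open_UNIV _ F] by simp
  moreover have "d_zbar F z = 0" if "z \<notin> cbox a b" for z
  proof -
    have "F w = 0" if "w \<notin> cbox a b" for w
      using out[of w] R[of w] box_subset_cbox[of a b] that by auto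
    then have "d_zbar F z = d_zbar (\<lambda>_. 0) z"
      using that by (intro wirtinger_cong(3)[of "- cbox a b"]) (auto simp: closed_cbox)
    then show ?thesis by simp
  qed
  then have "(\<lambda>z. if z \<in> cbox a b then d_zbar F z else 0) = d_zbar F" by auto
  then have "integral (cbox a b) (d_zbar F) = integral UNIV (d_zbar F)"
    using integral_restrict_UNIV[of "cbox a b" "d_zbar F"] by simp
  ultimately show ?thesis by simp
qed

text \<open>The cut-off function \<open>m\<close> vanishes near \<open>0\<close> and is \<open>1\<close> outside a small disk on which \<open>F\<close> is holomorphic,
so that \<open>G = m F\<close> is smooth on the plane. The integral of its \<open>\<partial>/\<partial>z'\<close> over the plane is zero. The part over
a small square around \<open>0\<close> is computed by Green's formula and the residue theorem; on the rest of
the plane \<open>G = F\<close>.\<close>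

lemma integral_dbar_residue:
  assumes F: "smooth_on (- {0}) F" and R: "\<And>z. norm z > R \<Longrightarrow> F z = 0"
    and r: "0 < r" and hol: "F holomorphic_on ball 0 r - {0}"
  shows "integral UNIV (\<lambda>z. if z = 0 then 0 else d_zbar F z) = - of_real pi * residue F 0"
proof -
  obtain m where m: "smooth_on UNIV m" "\<And>t. norm t \<le> r/8 \<Longrightarrow> m t = 0" "\<And>t. norm t \<ge> r/4 \<Longrightarrow> m t = 1"
    using smooth_plateau[of "r/8" "r/4"] r by auto
  define G where "G = (\<lambda>z. m z * F z)"
  define s where "s = (\<lambda>z. if z = 0 then 0 else d_zbar F z)"
  \<comment> \<open>The square lies in the disk of radius \<open>r\<close>, and its boundary lies where \<open>m = 1\<close>.\<close>
  define a b where "a = - Complex (r/3) (r/3)" and "b = Complex (r/3) (r/3)"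
  have lt: "Re a < Re b" "Im a < Im b" using r by (auto simp: a_def b_def)
  have inb: "cbox a b \<subseteq> ball 0 r"
  proof
    fix z assume "z \<in> cbox a b"
    then have "\<bar>Re z\<bar> \<le> r/3" "\<bar>Im z\<bar> \<le> r/3" by (auto simp: a_def b_def in_cbox_complex_iff)
    then show "z \<in> ball 0 r" using cmod_le[of z] r by auto
  qed
  have out: "norm z \<ge> r/3" if "z \<notin> box a b" for z
  proof -
    have "\<bar>Re z\<bar> \<ge> r/3 \<or> \<bar>Im z\<bar> \<ge> r/3"
      using that by (auto simp: in_box_complex_iff a_def b_def)
    then show ?thesis using abs_Re_le_cmod[of z] abs_Im_le_cmod[of z] by linarith
  qed
  have sG: "smooth_on UNIV G"
  proof (rule smooth_on_local)
    fix z :: complex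
    show "\<exists>T. open T \<and> z \<in> T \<and> smooth_on T G"
    proof (cases "z = 0")
      case True
      have "smooth_on (ball 0 (r/8)) (\<lambda>_. 0)" by (intro smooth_intros) auto
      then have "smooth_on (ball 0 (r/8)) G"
        by (subst smooth_on_cong[where g = "\<lambda>_. 0"]) (auto simp: G_def m(2))
      then show ?thesis using True r by (intro exI[of _ "ball 0 (r/8)"]) auto
    next
      case False
      have "smooth_on (- {0}) G" unfolding G_def
        by (intro smooth_intros smooth_on_subset[OF m(1)] F) auto
      then show ?thesis using False by (intro exI[of _ "-{0}"]) auto
    qed
  qed
  have dF: "d_zbar F z = 0" if "z \<in> ball 0 r - {0}" for z
    using hol that wirtinger_holomorphic(3) holomorphic_on_imp_differentiable_at[OF hol]
    by (simp add: open_delete)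
  have dG: "d_zbar G z = s z + (if z \<in> cbox a b then d_zbar G z else 0)" for z
  proof (cases "z \<in> cbox a b")
    case True
    then show ?thesis using inb dF[of z] by (auto simp: s_def)
  next
    case False
    then have z: "z \<noteq> 0" using lt by (auto simp: in_cbox_complex_iff a_def b_def)
    have "m w = 1" if "w \<in> - cbox a b" for w
    proof (rule m(3))
      have "w \<notin> box a b" using that box_subset_cbox[of a b] by auto
      then show "r / 4 \<le> norm w" using out[of w] r by simp
    qed
    then have "d_zbar G z = d_zbar F z"
      using False by (intro wirtinger_cong(3)[of "- cbox a b"]) (auto simp: closed_cbox G_def)
    then show ?thesis using False z by (simp add: s_def)
  qed
  have cG: "continuous_on UNIV (d_zbar G)"
    using smooth_onD(2)[OF smooth_onD(4)[OF sG open_UNIV] open_UNIV] .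
  have G0: "G z = 0" if "norm z > R" for z using R[OF that] by (simp add: G_def)
  have "0 = integral UNIV (d_zbar G)"
    using integral_dbar_compact_support[OF sG, of R] G0 by simp
  moreover have ii: "d_zbar G integrable_on UNIV"
  proof -
    have "d_zbar G z = 0" if "z \<in> UNIV - cball 0 R" for z
    proof -
      have "d_zbar G z = d_zbar (\<lambda>_. 0) z"
        using that by (intro wirtinger_cong(3)[of "- cball 0 R"]) (auto simp: G0)
      then show ?thesis by simp
    qed
    then have "d_zbar G absolutely_integrable_on UNIV"
      by (intro absolutely_integrable_compact_support[OF cG, of "cball 0 R"]) auto
    then show ?thesis by (simp add: absolutely_integrable_on_def)
  qed
  moreover have ib: "(\<lambda>z. if z \<in> cbox a b then d_zbar G z else 0) integrable_on UNIV"
    by (subst integrable_restrict_UNIV) (intro integrable_continuous continuous_on_subset[OF cG], simp)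
  ultimately have "integral UNIV s = - integral UNIV (\<lambda>z. if z \<in> cbox a b then d_zbar G z else 0)"
  proof -
    have "s = (\<lambda>z. d_zbar G z - (if z \<in> cbox a b then d_zbar G z else 0))"
      using dG by (metis (no_types, lifting) add_diff_cancel_right')
    then have "integral UNIV s = integral UNIV (d_zbar G) - integral UNIV (\<lambda>z. if z \<in> cbox a b then d_zbar G z else 0)"
      using Henstock_Kurzweil_Integration.integral_diff[OF ii ib] by simp
    then show ?thesis using \<open>0 = integral UNIV (d_zbar G)\<close> by simp
  qed
  also have "\<dots> = - integral (cbox a b) (d_zbar G)" by (simp only: integral_restrict_UNIV)
  finally have 1: "integral UNIV s = - integral (cbox a b) (d_zbar G)" .
  have "2 * \<i> * integral (cbox a b) (d_zbar G) = contour_integral (rectpath a b) G"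
    by (rule green_rectangle[OF lt open_UNIV _ sG]) simp
  also have "\<dots> = contour_integral (rectpath a b) F"
    by (rule contour_integral_eq)
      (use lt out r in \<open>force simp: path_image_rectpath_cbox_minus_box G_def intro!: m(3)\<close>)
  also have "\<dots> = 2 * pi * \<i> * (\<Sum>p\<in>{0}. winding_number (rectpath a b) p * residue F p)"
  proof (rule Residue_theorem[of "ball 0 r"])
    show "path_image (rectpath a b) \<subseteq> ball 0 r - {0}"
      using lt inb by (auto simp: path_image_rectpath_cbox_minus_box in_box_complex_iff a_def b_def)
    show "\<forall>z. z \<notin> ball 0 r \<longrightarrow> winding_number (rectpath a b) z = 0"
      using lt inb by (auto intro!: winding_number_rectpath_outside)
  qed (use hol in auto)
  also have "(\<Sum>p\<in>{0}. winding_number (rectpath a b) p * residue F p) = residue F 0"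
    using lt winding_number_rectpath[of 0 a b] by (simp add: in_box_complex_iff a_def b_def)
  finally have "integral (cbox a b) (d_zbar G) = of_real pi * residue F 0" by simp
  then show ?thesis using 1 by (simp add: s_def)
qed

section \<open>Charts and tensor fields\<close>

locale riemann =
  fixes X :: "'a::t2_space chart set"
  assumes riemann_surface: "riemann_surface X"
begin

lemma chart:
  assumes "c \<in> X"
  shows "open (fst c)" "open (chart_image c)"
    "continuous_on (fst c) (snd c)" "continuous_on (chart_image c) (chart_inv c)"
    "p \<in> fst c \<Longrightarrow> chart_inv c (snd c p) = p" "p \<in> fst c \<Longrightarrow> snd c p \<in> chart_image c"
    "z \<in> chart_image c \<Longrightarrow> chart_inv c z \<in> fst c" "z \<in> chart_image c \<Longrightarrow> snd c (chart_inv c z) = z"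
proof -
  have c: "open (fst c)" "open (chart_image c)"
    "homeomorphism (fst c) (chart_image c) (snd c) (chart_inv c)"
    using assms riemann_surface by (auto simp: riemann_surface_def is_chart_def)
  then show "open (fst c)" "open (chart_image c)"
    "continuous_on (fst c) (snd c)" "continuous_on (chart_image c) (chart_inv c)"
    "p \<in> fst c \<Longrightarrow> chart_inv c (snd c p) = p" "p \<in> fst c \<Longrightarrow> snd c p \<in> chart_image c"
    "z \<in> chart_image c \<Longrightarrow> chart_inv c z \<in> fst c" "z \<in> chart_image c \<Longrightarrow> snd c (chart_inv c z) = z"
    by (auto simp: homeomorphism_def)
qed

lemma chart_at: "chart_at X p \<in> X" "p \<in> fst (chart_at X p)"
proof -
  have "(\<Union>c\<in>X. fst c) = UNIV"
    using riemann_surface unfolding riemann_surface_def by (elim conjE)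
  then have "\<exists>c. c \<in> X \<and> p \<in> fst c" by blast
  from someI_ex[OF this] show "chart_at X p \<in> X" "p \<in> fst (chart_at X p)"
    by (auto simp: chart_at_def)
qed

definition overlap :: "'a chart \<Rightarrow> 'a chart \<Rightarrow> complex set" where
  "overlap c d = snd c ` (fst c \<inter> fst d)"

lemma mem_overlap:
  assumes "c \<in> X"
  shows "z \<in> overlap c d \<longleftrightarrow> z \<in> chart_image c \<and> chart_inv c z \<in> fst d"
  using chart[OF assms] by (force simp: overlap_def chart_image_def)

lemma open_chart_preimage:
  assumes "c \<in> X" "open V"
  shows "open {p \<in> fst c. snd c p \<in> V}"
proof -
  have "{p \<in> fst c. snd c p \<in> V} = fst c \<inter> snd c -` V" by auto
  then show ?thesis
    using continuous_on_open_vimage[OF chart(1)[OF assms(1)]] chart(3) assms by (metis Int_commute)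
qed

lemma open_chart_image_of:
  assumes "c \<in> X" "open W"
  shows "open {z \<in> chart_image c. chart_inv c z \<in> W}"
proof -
  have "{z \<in> chart_image c. chart_inv c z \<in> W} = chart_image c \<inter> chart_inv c -` W" by auto
  then show ?thesis
    using continuous_on_open_vimage[OF chart(2)[OF assms(1)]] chart(4) assms by (metis Int_commute)
qed

lemma open_overlap:
  assumes "c \<in> X" "d \<in> X"
  shows "open (overlap c d)"
proof -
  have "overlap c d = {z \<in> chart_image c. chart_inv c z \<in> fst d}"
    by (simp add: set_eq_iff mem_overlap[OF assms(1)])
  then show ?thesis using open_chart_image_of[OF assms(1) chart(1)[OF assms(2)]] by simp
qed

lemma transition_map:
  assumes "c \<in> X" "d \<in> X"
  shows "(snd d \<circ> chart_inv c) holomorphic_on overlap c d"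
    "inj_on (snd d \<circ> chart_inv c) (overlap c d)"
    "(snd d \<circ> chart_inv c) ` overlap c d = overlap d c"
    "z \<in> overlap c d \<Longrightarrow> (snd c \<circ> chart_inv d) ((snd d \<circ> chart_inv c) z) = z"
    "z \<in> overlap c d \<Longrightarrow> (snd d \<circ> chart_inv c) z \<in> overlap d c"
    "z \<in> overlap c d \<Longrightarrow> chart_inv d ((snd d \<circ> chart_inv c) z) = chart_inv c z"
    "z \<in> overlap c d \<Longrightarrow> transition c d (chart_inv c z) = deriv (snd d \<circ> chart_inv c) z"
proof -
  have "\<forall>c\<in>X. \<forall>d\<in>X. compatible c d"
    using riemann_surface unfolding riemann_surface_def by (elim conjE)
  then have "compatible c d" using assms by blast
  then show "(snd d \<circ> chart_inv c) holomorphic_on overlap c d"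
    by (simp add: compatible_def overlap_def)
  have z: "chart_inv d ((snd d \<circ> chart_inv c) z) = chart_inv c z" if "z \<in> overlap c d" for z
    using that mem_overlap assms chart by simp
  then show "z \<in> overlap c d \<Longrightarrow> chart_inv d ((snd d \<circ> chart_inv c) z) = chart_inv c z" .
  have z': "(snd c \<circ> chart_inv d) ((snd d \<circ> chart_inv c) z) = z" if "z \<in> overlap c d" for z
    using z[OF that] that mem_overlap assms chart by simp
  then show "z \<in> overlap c d \<Longrightarrow> (snd c \<circ> chart_inv d) ((snd d \<circ> chart_inv c) z) = z" .
  then show "inj_on (snd d \<circ> chart_inv c) (overlap c d)"
    using z' by (metis inj_onI)
  show "(snd d \<circ> chart_inv c) ` overlap c d = overlap d c"
    unfolding overlap_def using chart(5)[OF assms(1)] by (force simp: image_image)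
  then show "z \<in> overlap c d \<Longrightarrow> (snd d \<circ> chart_inv c) z \<in> overlap d c" by blast
  show "z \<in> overlap c d \<Longrightarrow> transition c d (chart_inv c z) = deriv (snd d \<circ> chart_inv c) z"
    using mem_overlap assms chart by (simp add: transition_def)
qed

text \<open>In particular the derivatives of coordinate changes have no zeros, so that tensor powers with
negative exponents behave as expected.\<close>

lemma transition_inverse:
  assumes "c \<in> X" "d \<in> X" "p \<in> fst c" "p \<in> fst d"
  shows "transition c d p * transition d c p = 1"
proof -
  let ?f = "snd d \<circ> chart_inv c" and ?g = "snd c \<circ> chart_inv d"
  have z: "snd c p \<in> overlap c d" using assms by (auto simp: overlap_def)
  have fz: "?f (snd c p) = snd d p" using assms chart by simp
  have f: "?f field_differentiable (at (snd c p))"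
    using transition_map(1)[OF assms(1,2)] open_overlap[OF assms(1,2)] z
    by (rule holomorphic_on_imp_differentiable_at)
  have w: "snd d p \<in> overlap d c" using assms by (auto simp: overlap_def)
  have g: "?g field_differentiable (at (?f (snd c p)))"
    unfolding fz using transition_map(1)[OF assms(2,1)] open_overlap[OF assms(2,1)] w
    by (rule holomorphic_on_imp_differentiable_at)
  have "deriv (?g \<circ> ?f) (snd c p) = deriv ?g (?f (snd c p)) * deriv ?f (snd c p)"
    by (rule deriv_chain[OF f g])
  moreover have "deriv (?g \<circ> ?f) (snd c p) = deriv (\<lambda>z. z) (snd c p)"
  proof (rule deriv_cong_ev)
    show "\<forall>\<^sub>F x in nhds (snd c p). (?g \<circ> ?f) x = x"
      using transition_map(4)[OF assms(1,2)] open_overlap[OF assms(1,2)] z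
      unfolding eventually_nhds by (auto intro!: exI[of _ "overlap c d"])
  qed simp
  ultimately show ?thesis using fz by (simp add: transition_def mult.commute)
qed

lemma transition_nonzero: "c \<in> X \<Longrightarrow> d \<in> X \<Longrightarrow> p \<in> fst c \<Longrightarrow> p \<in> fst d \<Longrightarrow> transition c d p \<noteq> 0"
  by (metis transition_inverse mult_zero_left zero_neq_one)

lemma tensor_fieldD:
  assumes "tensor_field X m n \<sigma>"
  shows "c \<notin> X \<or> p \<notin> fst c \<Longrightarrow> \<sigma> c p = 0"
    "c \<in> X \<Longrightarrow> d \<in> X \<Longrightarrow> p \<in> fst c \<Longrightarrow> p \<in> fst d \<Longrightarrow>
      \<sigma> c p = \<sigma> d p * transition c d p powi m * cnj (transition c d p) powi n"
  using assms unfolding tensor_field_def by blast+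

lemma tensor_fieldI:
  assumes "\<And>c p. c \<notin> X \<or> p \<notin> fst c \<Longrightarrow> \<sigma> c p = 0"
    "\<And>c d p. c \<in> X \<Longrightarrow> d \<in> X \<Longrightarrow> p \<in> fst c \<Longrightarrow> p \<in> fst d \<Longrightarrow>
      \<sigma> c p = \<sigma> d p * transition c d p powi m * cnj (transition c d p) powi n"
  shows "tensor_field X m n \<sigma>"
  using assms unfolding tensor_field_def by blast

lemma tensor_field_zero_iff:
  assumes "tensor_field X m n \<sigma>" "c \<in> X" "d \<in> X" "p \<in> fst c" "p \<in> fst d"
  shows "\<sigma> c p = 0 \<longleftrightarrow> \<sigma> d p = 0"
  using tensor_fieldD(2)[OF assms] transition_nonzero[OF assms(2-5)] by simp

lemma coeff_overlap:
  assumes "tensor_field X m n \<sigma>" "c \<in> X" "d \<in> X" "z \<in> overlap c d"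
  shows "coeff \<sigma> c z = coeff \<sigma> d ((snd d \<circ> chart_inv c) z)
     * deriv (snd d \<circ> chart_inv c) z powi m * cnj (deriv (snd d \<circ> chart_inv c) z) powi n"
proof -
  have "chart_inv c z \<in> fst c" "chart_inv c z \<in> fst d"
    using assms mem_overlap[OF assms(2)] chart(7)[OF assms(2)] by auto
  then show ?thesis
    unfolding coeff_def using tensor_fieldD(2)[OF assms(1-3)] transition_map(6,7)[OF assms(2-4)] by metis
qed

lemma tensor_field_mult:
  assumes "tensor_field X m n \<sigma>" "tensor_field X m' n' \<tau>"
  shows "tensor_field X (m + m') (n + n') (\<lambda>c p. \<sigma> c p * \<tau> c p)"
proof (rule tensor_fieldI)
  fix c d p assume p: "c \<in> X" "d \<in> X" "p \<in> fst c" "p \<in> fst d"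
  from tensor_fieldD(2)[OF assms(1) p] tensor_fieldD(2)[OF assms(2) p] transition_nonzero[OF p]
  show "\<sigma> c p * \<tau> c p = \<sigma> d p * \<tau> d p * transition c d p powi (m + m') * cnj (transition c d p) powi (n + n')"
    by (simp add: power_int_add)
qed (use tensor_fieldD(1)[OF assms(1)] in auto)

lemma tensor_field_scale:
  assumes "tensor_field X m n \<sigma>"
  shows "tensor_field X m n (\<lambda>c p. h p * \<sigma> c p)"
proof (rule tensor_fieldI)
  fix c d p assume "c \<in> X" "d \<in> X" "p \<in> fst c" "p \<in> fst d"
  from tensor_fieldD(2)[OF assms this]
  show "h p * \<sigma> c p = h p * \<sigma> d p * transition c d p powi m * cnj (transition c d p) powi n" by simp
qed (use tensor_fieldD(1)[OF assms] in auto)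

lemma tensor_field_add:
  assumes "tensor_field X m n \<sigma>" "tensor_field X m n \<tau>"
  shows "tensor_field X m n (\<lambda>c p. \<sigma> c p + \<tau> c p)"
proof (rule tensor_fieldI)
  fix c d p assume p: "c \<in> X" "d \<in> X" "p \<in> fst c" "p \<in> fst d"
  from tensor_fieldD(2)[OF assms(1) p] tensor_fieldD(2)[OF assms(2) p]
  show "\<sigma> c p + \<tau> c p = (\<sigma> d p + \<tau> d p) * transition c d p powi m * cnj (transition c d p) powi n"
    by (simp add: algebra_simps)
qed (use tensor_fieldD(1)[OF assms(1)] tensor_fieldD(1)[OF assms(2)] in auto)

lemma tensor_field_sum:
  assumes "\<And>i. i \<in> A \<Longrightarrow> tensor_field X m n (\<sigma> i)"
  shows "tensor_field X m n (\<lambda>c p. \<Sum>i\<in>A. \<sigma> i c p)"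
  using assms
proof (induction A rule: infinite_finite_induct)
  case (insert x F)
  then show ?case using tensor_field_add[of m n "\<sigma> x" "\<lambda>c p. \<Sum>i\<in>F. \<sigma> i c p"] by simp
qed (simp_all add: tensor_field_def)

lemma smooth_field_mult:
  assumes "smooth_field X m n \<sigma>" "smooth_field X m' n' \<tau>"
  shows "smooth_field X (m + m') (n + n') (\<lambda>c p. \<sigma> c p * \<tau> c p)"
  using assms tensor_field_mult smooth_on_mult[OF chart(2)]
  unfolding smooth_field_def coeff_def by blast

lemma smooth_field_scale:
  assumes "smooth_fun X h" "smooth_field X m n \<sigma>"
  shows "smooth_field X m n (\<lambda>c p. h p * \<sigma> c p)"
  using assms tensor_field_scale smooth_on_mult[OF chart(2)]
  unfolding smooth_field_def smooth_fun_def coeff_def comp_def by blast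

lemma smooth_field_add:
  assumes "smooth_field X m n \<sigma>" "smooth_field X m n \<tau>"
  shows "smooth_field X m n (\<lambda>c p. \<sigma> c p + \<tau> c p)"
  using assms tensor_field_add smooth_on_add[OF chart(2)]
  unfolding smooth_field_def coeff_def by blast

lemma smooth_field_sum:
  assumes "\<And>i. i \<in> A \<Longrightarrow> smooth_field X m n (\<sigma> i)"
  shows "smooth_field X m n (\<lambda>c p. \<Sum>i\<in>A. \<sigma> i c p)"
  unfolding smooth_field_def
proof (intro conjI ballI)
  show "tensor_field X m n (\<lambda>c p. \<Sum>i\<in>A. \<sigma> i c p)"
    using assms by (intro tensor_field_sum) (simp add: smooth_field_def)
  fix c assume c: "c \<in> X"
  have "smooth_on (chart_image c) (\<lambda>z. \<Sum>i\<in>A. coeff (\<sigma> i) c z)"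
    using assms c by (intro smooth_on_sum chart(2)) (auto simp: smooth_field_def)
  then show "smooth_on (chart_image c) (coeff (\<lambda>c p. \<Sum>i\<in>A. \<sigma> i c p) c)"
    by (simp add: coeff_def[abs_def])
qed

lemma H0K_smooth_field: "\<sigma> \<in> H0K X m \<Longrightarrow> smooth_field X m 0 \<sigma>"
  unfolding H0K_def smooth_field_def using smooth_on_holomorphic chart(2) by blast

section \<open>Smooth functions on a surface\<close>

text \<open>Smoothness needs to be checked in one coordinate around each point only, because coordinate changes
are holomorphic.\<close>

lemma smooth_fun_localI:
  assumes "\<And>p. \<exists>c\<in>X. \<exists>W. p \<in> fst c \<and> open W \<and> W \<subseteq> chart_image c \<and> snd c p \<in> W \<and> smooth_on W (h \<circ> chart_inv c)"
  shows "smooth_fun X h"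
  unfolding smooth_fun_def
proof (intro ballI smooth_on_local)
  fix d z assume d: "d \<in> X" and z: "z \<in> chart_image d"
  let ?p = "chart_inv d z"
  obtain c W where c: "c \<in> X" "?p \<in> fst c" and W: "open W" "W \<subseteq> chart_image c" "snd c ?p \<in> W"
    "smooth_on W (h \<circ> chart_inv c)" using assms by blast
  let ?\<phi> = "snd c \<circ> chart_inv d"
  let ?T = "{w \<in> overlap d c. ?\<phi> w \<in> W}"
  have zo: "z \<in> overlap d c" using mem_overlap[OF d] z c by auto
  have hol: "?\<phi> holomorphic_on overlap d c" by (rule transition_map(1)[OF d c(1)])
  have oT: "open ?T"
  proof -
    have "?T = overlap d c \<inter> ?\<phi> -` W" by auto
    then show ?thesis using continuous_on_open_vimage[OF open_overlap[OF d c(1)]]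
        holomorphic_on_imp_continuous_on[OF hol] W(1) by (metis Int_commute)
  qed
  have "smooth_on ?T ?\<phi>"
    using hol oT by (intro smooth_on_holomorphic) (auto intro: holomorphic_on_subset)
  then have "smooth_on ?T (\<lambda>w. (h \<circ> chart_inv c) (?\<phi> w))"
    by (rule smooth_on_compose[OF oT W(1) _ W(4)]) auto
  then have "smooth_on ?T (h \<circ> chart_inv d)"
    by (subst smooth_on_cong[OF oT, of _ "\<lambda>w. (h \<circ> chart_inv c) (?\<phi> w)"])
      (use transition_map(6)[OF d c(1)] in auto)
  then show "\<exists>T. open T \<and> z \<in> T \<and> smooth_on T (h \<circ> chart_inv d)"
    using oT zo W(3) by (intro exI[of _ ?T]) auto
qed

lemma smooth_fun_extend_zero:
  assumes c: "c \<in> X" and g: "smooth_on (chart_image c) g"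
    and K: "compact K" "K \<subseteq> chart_image c" "\<And>z. z \<in> chart_image c - K \<Longrightarrow> g z = 0"
  shows "smooth_fun X (\<lambda>p. if p \<in> fst c then g (snd c p) else 0)" (is "smooth_fun X ?h")
proof (rule smooth_fun_localI)
  fix p
  show "\<exists>d\<in>X. \<exists>W. p \<in> fst d \<and> open W \<and> W \<subseteq> chart_image d \<and> snd d p \<in> W \<and> smooth_on W (?h \<circ> chart_inv d)"
  proof (cases "p \<in> fst c")
    case True
    have "smooth_on (chart_image c) (?h \<circ> chart_inv c)"
      by (subst smooth_on_cong[OF chart(2)[OF c], of _ g]) (use g chart[OF c] in auto)
    then show ?thesis using True c chart(2)[OF c] chart(6)[OF c True] by blast
  next
    case False
    let ?d = "chart_at X p"
    let ?L = "chart_inv c ` K"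
    let ?W = "{z \<in> chart_image ?d. chart_inv ?d z \<in> - ?L}"
    have "compact ?L" using K(1) chart(4)[OF c] K(2) compact_continuous_image continuous_on_subset by blast
    then have oW: "open ?W"
      by (intro open_chart_image_of[OF chart_at(1)]) (simp add: compact_imp_closed open_Compl)
    have zero: "?h q = 0" if "q \<notin> ?L" for q
    proof (cases "q \<in> fst c")
      case True
      then have "snd c q \<notin> K" using that chart(5)[OF c] by (metis image_eqI)
      then show ?thesis using True K(3) chart(6)[OF c] by auto
    qed simp
    have "smooth_on ?W (\<lambda>_. 0)" by (intro smooth_intros oW)
    then have "smooth_on ?W (?h \<circ> chart_inv ?d)"
      by (subst smooth_on_cong[OF oW, of _ "\<lambda>_. 0"]) (use zero in auto)
    moreover have "p \<notin> ?L" using False K(2) chart(7)[OF c] by auto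
    ultimately show ?thesis
      using oW chart_at[of p] chart(5,6)[OF chart_at(1) chart_at(2)[of p]]
      by (intro bexI[of _ ?d] exI[of _ ?W] conjI) simp_all
  qed
qed

lemma smooth_fun_diff: "smooth_fun X f \<Longrightarrow> smooth_fun X g \<Longrightarrow> smooth_fun X (\<lambda>p. f p - g p)"
  unfolding smooth_fun_def comp_def using smooth_on_diff[OF chart(2)] by blast

lemma smooth_fun_mult: "smooth_fun X f \<Longrightarrow> smooth_fun X g \<Longrightarrow> smooth_fun X (\<lambda>p. f p * g p)"
  unfolding smooth_fun_def comp_def using smooth_on_mult[OF chart(2)] by blast

lemma smooth_fun_divide:
  "smooth_fun X f \<Longrightarrow> smooth_fun X g \<Longrightarrow> (\<And>p. g p \<noteq> 0) \<Longrightarrow> smooth_fun X (\<lambda>p. f p / g p)"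
  unfolding smooth_fun_def comp_def using smooth_on_divide[OF chart(2)] by blast

lemma smooth_fun_sum: "(\<And>i. i \<in> A \<Longrightarrow> smooth_fun X (f i)) \<Longrightarrow> smooth_fun X (\<lambda>p. \<Sum>i\<in>A. f i p)"
  unfolding smooth_fun_def comp_def by (intro ballI smooth_on_sum chart(2)) auto

lemma smooth_fun_const: "smooth_fun X (\<lambda>_. a)"
  unfolding smooth_fun_def comp_def using smooth_on_const[OF chart(2)] by blast

lemma smooth_fun_cnj: "smooth_fun X f \<Longrightarrow> smooth_fun X (\<lambda>p. cnj (f p))"
  unfolding smooth_fun_def comp_def using smooth_on_cnj[OF chart(2)] by blast

text \<open>A section of type \<open>(0,0)\<close> is a function.\<close>

lemma smooth_fun_of_field:
  assumes "smooth_field X 0 0 \<sigma>"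
  shows "smooth_fun X (\<lambda>p. \<sigma> (chart_at X p) p)"
    "c \<in> X \<Longrightarrow> p \<in> fst c \<Longrightarrow> \<sigma> c p = \<sigma> (chart_at X p) p"
proof -
  have t: "tensor_field X 0 0 \<sigma>" using assms by (simp add: smooth_field_def)
  show eq: "\<sigma> c p = \<sigma> (chart_at X p) p" if "c \<in> X" "p \<in> fst c" for c p
    using tensor_fieldD(2)[OF t that(1) chart_at(1) that(2) chart_at(2)] by simp
  show "smooth_fun X (\<lambda>p. \<sigma> (chart_at X p) p)"
    unfolding smooth_fun_def
  proof
    fix c assume c: "c \<in> X"
    have "smooth_on (chart_image c) (coeff \<sigma> c)" using assms c by (simp add: smooth_field_def)
    then show "smooth_on (chart_image c) ((\<lambda>p. \<sigma> (chart_at X p) p) \<circ> chart_inv c)"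
      by (subst smooth_on_cong[OF chart(2)[OF c], of _ "coeff \<sigma> c"])
        (use eq[OF c] chart(7)[OF c] in \<open>auto simp: coeff_def\<close>)
  qed
qed

section \<open>The operators \<open>\<partial>\<close> and \<open>\<partial>\<close>-bar on tensor fields\<close>

lemma coeff_dbar: "c \<in> X \<Longrightarrow> z \<in> chart_image c \<Longrightarrow> coeff (dbar X \<sigma>) c z = d_zbar (coeff \<sigma> c) z"
  unfolding coeff_def[of "dbar X \<sigma>"] by (simp add: dbar_def chart)

lemma coeff_del: "c \<in> X \<Longrightarrow> z \<in> chart_image c \<Longrightarrow> coeff (del X h) c z = d_z (h \<circ> chart_inv c) z"
  by (simp add: coeff_def del_def chart)

lemma smooth_coeff_dbar:
  assumes "smooth_field X m n \<sigma>" "c \<in> X"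
  shows "smooth_on (chart_image c) (coeff (dbar X \<sigma>) c)"
proof -
  have "smooth_on (chart_image c) (d_zbar (coeff \<sigma> c))"
    using assms smooth_onD(4)[OF _ chart(2)] by (auto simp: smooth_field_def)
  then show ?thesis
    by (subst smooth_on_cong[OF chart(2)[OF assms(2)] coeff_dbar[OF assms(2)]])
qed

text \<open>The factor \<open>\<phi>'\<close> by which \<open>(1,0)\<close>-forms transform is holomorphic and passes through \<open>\<partial>/\<partial>z'\<close>; the chain
rule contributes the conjugate of \<open>\<phi>'\<close>.\<close>

lemma tensor_field_dbar:
  assumes W: "smooth_field X 1 0 W"
  shows "tensor_field X 1 1 (dbar X W)"
  unfolding tensor_field_def
proof (intro conjI allI impI ballI)
  fix c p assume "c \<notin> X \<or> p \<notin> fst c"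
  then show "dbar X W c p = 0" by (auto simp: dbar_def)
next
  fix c d p assume c: "c \<in> X" and d: "d \<in> X" and p: "p \<in> fst c \<inter> fst d"
  let ?\<phi> = "snd d \<circ> chart_inv c"
  let ?z = "snd c p"
  have z: "?z \<in> overlap c d" using p by (auto simp: overlap_def)
  note o = open_overlap[OF c d]
  have hol: "?\<phi> field_differentiable (at ?z)"
    using holomorphic_on_imp_differentiable_at[OF transition_map(1)[OF c d] o z] .
  have hol': "deriv ?\<phi> field_differentiable (at ?z)"
    using holomorphic_on_imp_differentiable_at[OF holomorphic_deriv[OF transition_map(1)[OF c d] o] o z] .
  have fz: "?\<phi> ?z = snd d p" using c p chart(5)[OF c] by simp
  have cd: "coeff W d differentiable (at (?\<phi> ?z))"
    unfolding fz using W d p smooth_onD(1)[OF _ chart(2)[OF d]] chart(6)[OF d] by (auto simp: smooth_field_def)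
  note ch = wirtinger_chain[OF wirtinger_holomorphic(1)[OF hol] cd]
  have "d_zbar (coeff W c) ?z = d_zbar (\<lambda>w. coeff W d (?\<phi> w) * deriv ?\<phi> w) ?z"
    using W coeff_overlap[OF _ c d] by (intro wirtinger_cong(3)[OF o z]) (auto simp: smooth_field_def)
  also have "\<dots> = d_zbar (\<lambda>w. coeff W d (?\<phi> w)) ?z * deriv ?\<phi> ?z"
    using wirtinger_mult(2)[OF ch(1) wirtinger_holomorphic(1)[OF hol']] wirtinger_holomorphic(3)[OF hol'] by simp
  also have "\<dots> = d_zbar (coeff W d) (snd d p) * cnj (deriv ?\<phi> ?z) * deriv ?\<phi> ?z"
    unfolding ch(3) fz wirtinger_holomorphic(2,3)[OF hol] by (simp only: mult_zero_right add_0)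
  finally show "dbar X W c p = dbar X W d p * transition c d p powi 1 * cnj (transition c d p) powi 1"
    using c d p by (simp add: dbar_def transition_def)
qed

lemma smooth_field_dbar: "smooth_field X 1 0 W \<Longrightarrow> smooth_field X 1 1 (dbar X W)"
  using tensor_field_dbar smooth_coeff_dbar unfolding smooth_field_def by blast

lemma smooth_field_del:
  assumes h: "smooth_fun X h"
  shows "smooth_field X 1 0 (del X h)"
  unfolding smooth_field_def tensor_field_def
proof (intro conjI allI impI ballI)
  fix c p assume "c \<notin> X \<or> p \<notin> fst c"
  then show "del X h c p = 0" by (auto simp: del_def)
next
  fix c assume c: "c \<in> X"
  have "smooth_on (chart_image c) (d_z (h \<circ> chart_inv c))"
    using h c smooth_onD(3)[OF _ chart(2)[OF c]] by (simp add: smooth_fun_def)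
  then show "smooth_on (chart_image c) (coeff (del X h) c)"
    by (subst smooth_on_cong[OF chart(2)[OF c] coeff_del[OF c]])
next
  fix c d p assume c: "c \<in> X" and d: "d \<in> X" and p: "p \<in> fst c \<inter> fst d"
  let ?\<phi> = "snd d \<circ> chart_inv c"
  let ?z = "snd c p"
  have z: "?z \<in> overlap c d" using p by (auto simp: overlap_def)
  note o = open_overlap[OF c d]
  have hol: "?\<phi> field_differentiable (at ?z)"
    using holomorphic_on_imp_differentiable_at[OF transition_map(1)[OF c d] o z] .
  have fz: "?\<phi> ?z = snd d p" using c p chart(5)[OF c] by simp
  have cd: "(h \<circ> chart_inv d) differentiable (at (?\<phi> ?z))"
    unfolding fz using h d p smooth_onD(1)[OF _ chart(2)[OF d]] chart(6)[OF d] by (auto simp: smooth_fun_def)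
  note ch = wirtinger_chain[OF wirtinger_holomorphic(1)[OF hol] cd]
  have "d_z (h \<circ> chart_inv c) ?z = d_z (\<lambda>w. (h \<circ> chart_inv d) (?\<phi> w)) ?z"
    by (intro wirtinger_cong(2)[OF o z]) (use transition_map(6)[OF c d] in auto)
  also have "\<dots> = d_z (h \<circ> chart_inv d) (snd d p) * deriv ?\<phi> ?z"
    unfolding ch(2) fz wirtinger_holomorphic(2,3)[OF hol] by (simp only: complex_cnj_zero mult_zero_right add_0_right)
  finally show "del X h c p = del X h d p * transition c d p powi 1 * cnj (transition c d p) powi 0"
    using c d p by (simp add: del_def transition_def)
qed

end

section \<open>Partitions of unity and Stokes' theorem\<close>

definition partition_integral ::
  "nat \<Rightarrow> (nat \<Rightarrow> 'a chart) \<Rightarrow> (nat \<Rightarrow> 'a \<Rightarrow> real) \<Rightarrow> 'a sect \<Rightarrow> complex" where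
  "partition_integral N c \<psi> \<sigma> = (\<Sum>k<N. integral (chart_image (c k))
     (\<lambda>z. -2 * \<i> * of_real (\<psi> k (chart_inv (c k) z)) * coeff \<sigma> (c k) z))"

lemma integral_zero_outside:
  fixes f :: "'n::euclidean_space \<Rightarrow> 'b::banach"
  assumes "T \<subseteq> S" "\<And>z. z \<in> S - T \<Longrightarrow> f z = 0"
  shows "integral S f = integral T f"
proof -
  have "(\<lambda>z. if z \<in> S then f z else 0) = (\<lambda>z. if z \<in> T then f z else 0)"
    using assms by (auto simp: fun_eq_iff)
  then show ?thesis using integral_restrict_UNIV[of S f] integral_restrict_UNIV[of T f] by simp
qed

lemma continuous_nonneg_integral_zero:
  fixes g :: "complex \<Rightarrow> real"
  assumes S: "open S" and g: "continuous_on S g" "\<And>z. z \<in> S \<Longrightarrow> 0 \<le> g z"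
    and int: "g integrable_on S" "integral S g = 0" and z: "z \<in> S"
  shows "g z = 0"
proof -
  obtain a b where ab: "z \<in> box a b" "cbox a b \<subseteq> S"
    using open_contains_cbox[OF S z] by metis
  have i: "g integrable_on cbox a b"
    using g(1) ab(2) continuous_on_subset integrable_continuous by blast
  have "integral (cbox a b) g \<le> integral S g"
    by (rule integral_subset_le[OF ab(2) i int(1)]) (use g in auto)
  moreover have "0 \<le> integral (cbox a b) g"
    by (rule integral_nonneg[OF i]) (use g ab in auto)
  ultimately have "(g has_integral 0) (cbox a b)" using int(2) i by (metis has_integral_integral order_antisym)
  then show ?thesis
    using has_integral_0_cbox_imp_0[of a b g z] ab g continuous_on_subset box_subset_cbox[of a b] by (metis empty_iff subset_iff)
qed

lemma zero_outside_support: "p \<notin> closure {q. f q \<noteq> (0 :: 'b::zero)} \<Longrightarrow> f p = 0"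
  using closure_subset[of "{q. f q \<noteq> 0}"] by blast

context riemann begin

definition continuous_form :: "'a sect \<Rightarrow> bool" where
  "continuous_form \<sigma> \<longleftrightarrow> tensor_field X 1 1 \<sigma> \<and> (\<forall>c\<in>X. continuous_on (chart_image c) (coeff \<sigma> c))"

lemma continuous_form_of_smooth: "smooth_field X 1 1 \<sigma> \<Longrightarrow> continuous_form \<sigma>"
  unfolding smooth_field_def continuous_form_def using smooth_onD(2) chart(2) by blast

text \<open>The coefficients of a \<open>2\<close>-form in two charts differ by \<open>|\<phi>'|\<^sup>2\<close>, which is the Jacobian of the
coordinate change \<open>\<phi>\<close>.\<close>

lemma form_integral_invariant:
  assumes c: "c \<in> X" and d: "d \<in> X" and \<sigma>: "continuous_form \<sigma>"
    and L: "compact L" "L \<subseteq> fst c \<inter> fst d" "\<And>e p. p \<notin> L \<Longrightarrow> \<sigma> e p = 0"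
  shows "integral (chart_image c) (coeff \<sigma> c) = integral (chart_image d) (coeff \<sigma> d)"
proof -
  let ?\<phi> = "snd d \<circ> chart_inv c"
  note t = transition_map[OF c d]
  have cont: "continuous_on (chart_image d) (coeff \<sigma> d)" and tf: "tensor_field X 1 1 \<sigma>"
    using \<sigma> d by (auto simp: continuous_form_def)
  have res: "integral (chart_image e) (coeff \<sigma> e) = integral (overlap e e') (coeff \<sigma> e)"
    if "e \<in> X" "L \<subseteq> fst e'" for e e'
  proof (rule integral_zero_outside)
    show "overlap e e' \<subseteq> chart_image e" by (auto simp: overlap_def chart_image_def)
    show "coeff \<sigma> e z = 0" if "z \<in> chart_image e - overlap e e'" for z
    proof -
      have "chart_inv e z \<notin> L"
        using that mem_overlap[OF \<open>e \<in> X\<close>, of z e'] \<open>L \<subseteq> fst e'\<close> by blast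
      then show ?thesis unfolding coeff_def by (rule L(3))
    qed
  qed
  have "integral (chart_image d) (coeff \<sigma> d) = integral (?\<phi> ` overlap c d) (coeff \<sigma> d)"
    unfolding t(3) using res[OF d, of c] L(2) by auto
  also have "\<dots> = integral (overlap c d) (\<lambda>z. of_real ((norm (deriv ?\<phi> z))\<^sup>2) * coeff \<sigma> d (?\<phi> z))"
  proof (rule holomorphic_change_of_variables[OF open_overlap[OF c d] t(1,2)])
    have "continuous_on L (snd d)" using chart(3)[OF d] L(2) continuous_on_subset by blast
    then show "compact (snd d ` L)" using L(1) compact_continuous_image by blast
    have "snd d ` L \<subseteq> overlap d c" unfolding overlap_def using L(2) by blast
    then show "snd d ` L \<subseteq> ?\<phi> ` overlap c d" by (simp only: t(3))
    show "coeff \<sigma> d w = 0" if "w \<in> ?\<phi> ` overlap c d - snd d ` L" for w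
    proof -
      have "w \<in> chart_image d" using that unfolding t(3) by (simp add: mem_overlap[OF d])
      then have "chart_inv d w \<notin> L" using that chart(8)[OF d] by (metis DiffD2 image_eqI)
      then show ?thesis unfolding coeff_def by (rule L(3))
    qed
    show "continuous_on (?\<phi> ` overlap c d) (coeff \<sigma> d)"
      unfolding t(3) by (rule continuous_on_subset[OF cont]) (auto simp: overlap_def chart_image_def)
  qed
  also have "\<dots> = integral (overlap c d) (coeff \<sigma> c)"
  proof (rule integral_cong)
    fix z assume "z \<in> overlap c d"
    from coeff_overlap[OF tf c d this]
    show "of_real ((norm (deriv ?\<phi> z))\<^sup>2) * coeff \<sigma> d (?\<phi> z) = coeff \<sigma> c z"
      unfolding complex_norm_square by (simp only: power_int_1_right mult_ac)
  qed
  also have "\<dots> = integral (chart_image c) (coeff \<sigma> c)"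
    using res[OF c, of d] L(2) by auto
  finally show ?thesis by simp
qed

lemma integrable_compact_support_coeff:
  fixes g :: "complex \<Rightarrow> complex"
  assumes c: "c \<in> X" and cont: "continuous_on (chart_image c) g"
    and L: "compact L" "L \<subseteq> fst c" "\<And>z. z \<in> chart_image c \<Longrightarrow> chart_inv c z \<notin> L \<Longrightarrow> g z = 0"
  shows "g absolutely_integrable_on chart_image c"
proof (rule absolutely_integrable_compact_support[OF cont])
  have "continuous_on L (snd c)" using chart(3)[OF c] L(2) continuous_on_subset by blast
  then show "compact (snd c ` L)" using L(1) compact_continuous_image by blast
  show "snd c ` L \<subseteq> chart_image c" using L(2) by (auto simp: chart_image_def)
  show "g z = 0" if "z \<in> chart_image c - snd c ` L" for z
  proof -
    have "chart_inv c z \<notin> L" using that chart(8)[OF c] by (metis DiffE image_eqI)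
    then show ?thesis using L(3) that by blast
  qed
qed

end

locale compact_riemann = riemann X for X :: "'a::t2_space chart set" +
  assumes compact: "compact (UNIV :: 'a set)" and connected: "connected (UNIV :: 'a set)"
begin

lemma compact_closed: "closed (S :: 'a set) \<Longrightarrow> compact S"
  using compact_Int_closed[OF compact] by simp

lemma partition_of_unityD:
  assumes "partition_of_unity X N c \<psi>"
  shows "k < N \<Longrightarrow> c k \<in> X" "k < N \<Longrightarrow> smooth_fun X (\<lambda>p. of_real (\<psi> k p))" "k < N \<Longrightarrow> 0 \<le> \<psi> k p"
    "k < N \<Longrightarrow> closure {p. \<psi> k p \<noteq> 0} \<subseteq> fst (c k)" "(\<Sum>k<N. \<psi> k p) = 1"
  using assms unfolding partition_of_unity_def by blast+

lemma smooth_fun_continuous: "smooth_fun X h \<Longrightarrow> c \<in> X \<Longrightarrow> continuous_on (chart_image c) (\<lambda>z. h (chart_inv c z))"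
  unfolding smooth_fun_def comp_def using smooth_onD(2) chart(2) by blast

lemma continuous_form_scale:
  assumes "smooth_fun X h" "continuous_form \<sigma>"
  shows "continuous_form (\<lambda>c p. h p * \<sigma> c p)"
  unfolding continuous_form_def coeff_def
proof (intro conjI ballI continuous_on_mult smooth_fun_continuous[OF assms(1)])
  show "tensor_field X 1 1 (\<lambda>c p. h p * \<sigma> c p)"
    using assms(2) by (intro tensor_field_scale) (simp add: continuous_form_def)
  show "continuous_on (chart_image c) (\<lambda>z. \<sigma> c (chart_inv c z))" if "c \<in> X" for c
    using assms(2) that by (simp add: continuous_form_def coeff_def[abs_def])
qed

lemma integrable_partition:
  assumes P: "partition_of_unity X N c \<psi>" and k: "k < N" and \<sigma>: "continuous_form \<sigma>"
  shows "(\<lambda>z. of_real (\<psi> k (chart_inv (c k) z)) * coeff \<sigma> (c k) z) absolutely_integrable_on chart_image (c k)"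
proof (rule integrable_compact_support_coeff)
  show ck: "c k \<in> X" by (rule partition_of_unityD(1)[OF P k])
  show "continuous_on (chart_image (c k)) (\<lambda>z. of_real (\<psi> k (chart_inv (c k) z)) * coeff \<sigma> (c k) z)"
    using smooth_fun_continuous[OF partition_of_unityD(2)[OF P k] ck] \<sigma> ck
    by (auto simp: continuous_form_def intro!: continuous_on_mult)
  show "compact (closure {p. \<psi> k p \<noteq> 0})" by (simp add: compact_closed)
  show "closure {p. \<psi> k p \<noteq> 0} \<subseteq> fst (c k)" by (rule partition_of_unityD(4)[OF P k])
  show "of_real (\<psi> k (chart_inv (c k) z)) * coeff \<sigma> (c k) z = 0"
    if "chart_inv (c k) z \<notin> closure {p. \<psi> k p \<noteq> 0}" for z
  proof -
    have "\<psi> k (chart_inv (c k) z) = 0" using that by (rule zero_outside_support)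
    then show ?thesis by simp
  qed
qed

lemma partition_integral_eq:
  "partition_integral N c \<psi> \<sigma> = -2 * \<i> * (\<Sum>k<N. integral (chart_image (c k))
     (\<lambda>z. of_real (\<psi> k (chart_inv (c k) z)) * coeff \<sigma> (c k) z))"
  by (simp add: partition_integral_def mult.assoc sum_distrib_left)

lemma partition_integral_sum:
  assumes P: "partition_of_unity X N c \<psi>" and A: "finite A" "\<And>i. i \<in> A \<Longrightarrow> continuous_form (\<sigma> i)"
  shows "partition_integral N c \<psi> (\<lambda>d p. \<Sum>i\<in>A. \<sigma> i d p) = (\<Sum>i\<in>A. partition_integral N c \<psi> (\<sigma> i))"
proof -
  have "integral (chart_image (c k)) (\<lambda>z. of_real (\<psi> k (chart_inv (c k) z)) * coeff (\<lambda>d p. \<Sum>i\<in>A. \<sigma> i d p) (c k) z)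
    = (\<Sum>i\<in>A. integral (chart_image (c k)) (\<lambda>z. of_real (\<psi> k (chart_inv (c k) z)) * coeff (\<sigma> i) (c k) z))"
    if "k < N" for k
  proof -
    have "integral (chart_image (c k)) (\<lambda>z. of_real (\<psi> k (chart_inv (c k) z)) * coeff (\<lambda>d p. \<Sum>i\<in>A. \<sigma> i d p) (c k) z)
      = integral (chart_image (c k)) (\<lambda>z. \<Sum>i\<in>A. of_real (\<psi> k (chart_inv (c k) z)) * coeff (\<sigma> i) (c k) z)"
      by (simp add: coeff_def sum_distrib_left)
    also have "\<dots> = (\<Sum>i\<in>A. integral (chart_image (c k)) (\<lambda>z. of_real (\<psi> k (chart_inv (c k) z)) * coeff (\<sigma> i) (c k) z))"
      using integrable_partition[OF P that A(2)] A(1)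
      by (intro integral_sum) (auto simp: absolutely_integrable_on_def)
    finally show ?thesis .
  qed
  then have "partition_integral N c \<psi> (\<lambda>d p. \<Sum>i\<in>A. \<sigma> i d p) = -2 * \<i> * (\<Sum>k<N. \<Sum>i\<in>A.
      integral (chart_image (c k)) (\<lambda>z. of_real (\<psi> k (chart_inv (c k) z)) * coeff (\<sigma> i) (c k) z))"
    unfolding partition_integral_eq by simp
  then show ?thesis
    unfolding partition_integral_eq by (subst (asm) sum.swap) (simp add: sum_distrib_left)
qed

lemma partition_integral_add:
  assumes P: "partition_of_unity X N c \<psi>" and "continuous_form \<sigma>" "continuous_form \<tau>"
  shows "partition_integral N c \<psi> (\<lambda>d p. \<sigma> d p + \<tau> d p) = partition_integral N c \<psi> \<sigma> + partition_integral N c \<psi> \<tau>"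
  using partition_integral_sum[OF P, of "{False, True}" "\<lambda>b. if b then \<tau> else \<sigma>"] assms(2,3) by simp

text \<open>Each term of the sum is moved to the chart \<open>d\<close>, which contains the support of \<open>\<sigma>\<close>. There the functions
\<open>\<psi>\<^sub>k\<close> add up to \<open>1\<close>.\<close>

lemma partition_integral_localized:
  assumes P: "partition_of_unity X N c \<psi>" and \<sigma>: "continuous_form \<sigma>" and d: "d \<in> X"
    and L: "compact L" "L \<subseteq> fst d" "\<And>e p. p \<notin> L \<Longrightarrow> \<sigma> e p = 0"
  shows "partition_integral N c \<psi> \<sigma> = -2 * \<i> * integral (chart_image d) (coeff \<sigma> d)"
proof -
  have cd: "continuous_on (chart_image d) (coeff \<sigma> d)" using \<sigma> d by (simp add: continuous_form_def)
  have "integral (chart_image (c k)) (\<lambda>z. of_real (\<psi> k (chart_inv (c k) z)) * coeff \<sigma> (c k) z)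
    = integral (chart_image d) (\<lambda>z. of_real (\<psi> k (chart_inv d z)) * coeff \<sigma> d z)" if k: "k < N" for k
  proof -
    let ?\<tau> = "\<lambda>e p. of_real (\<psi> k p) * \<sigma> e p"
    let ?L = "L \<inter> closure {p. \<psi> k p \<noteq> 0}"
    have "integral (chart_image (c k)) (coeff ?\<tau> (c k)) = integral (chart_image d) (coeff ?\<tau> d)"
    proof (rule form_integral_invariant[OF partition_of_unityD(1)[OF P k] d])
      show "continuous_form ?\<tau>" by (rule continuous_form_scale[OF partition_of_unityD(2)[OF P k] \<sigma>])
      show "compact ?L" using L(1) by (simp add: compact_Int_closed)
      show "?L \<subseteq> fst (c k) \<inter> fst d" using L(2) partition_of_unityD(4)[OF P k] by blast
      show "of_real (\<psi> k p) * \<sigma> e p = 0" if "p \<notin> ?L" for e p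
      proof (cases "p \<in> L")
        case True
        then have "p \<notin> closure {p. \<psi> k p \<noteq> 0}" using that by blast
        then have "\<psi> k p = 0" by (rule zero_outside_support)
        then show ?thesis by simp
      qed (simp add: L(3))
    qed
    then show ?thesis by (simp add: coeff_def[abs_def])
  qed
  then have "partition_integral N c \<psi> \<sigma> =
      -2 * \<i> * (\<Sum>k<N. integral (chart_image d) (\<lambda>z. of_real (\<psi> k (chart_inv d z)) * coeff \<sigma> d z))"
    unfolding partition_integral_eq by simp
  also have "(\<Sum>k<N. integral (chart_image d) (\<lambda>z. of_real (\<psi> k (chart_inv d z)) * coeff \<sigma> d z)) =
      integral (chart_image d) (\<lambda>z. \<Sum>k<N. of_real (\<psi> k (chart_inv d z)) * coeff \<sigma> d z)"
  proof (rule integral_sum[symmetric])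
    fix k assume "k \<in> {..<N}"
    then have k: "k < N" by simp
    have "(\<lambda>z. of_real (\<psi> k (chart_inv d z)) * coeff \<sigma> d z) absolutely_integrable_on chart_image d"
    proof (rule integrable_compact_support_coeff[OF d _ L(1,2)])
      show "continuous_on (chart_image d) (\<lambda>z. of_real (\<psi> k (chart_inv d z)) * coeff \<sigma> d z)"
        by (intro continuous_on_mult smooth_fun_continuous[OF partition_of_unityD(2)[OF P k] d] cd)
      show "of_real (\<psi> k (chart_inv d z)) * coeff \<sigma> d z = 0" if "chart_inv d z \<notin> L" for z
        using L(3)[OF that] by (simp add: coeff_def)
    qed
    then show "(\<lambda>z. of_real (\<psi> k (chart_inv d z)) * coeff \<sigma> d z) integrable_on chart_image d"
      by (simp add: absolutely_integrable_on_def)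
  qed simp
  also have "(\<lambda>z. \<Sum>k<N. of_real (\<psi> k (chart_inv d z)) * coeff \<sigma> d z) = coeff \<sigma> d"
    using partition_of_unityD(5)[OF P] by (simp add: fun_eq_iff flip: sum_distrib_right of_real_sum)
  finally show ?thesis .
qed

text \<open>Stokes' theorem for a form supported in one chart is the vanishing of the integral of a compactly
supported \<open>\<partial>/\<partial>z'\<close>-derivative over the plane.\<close>

lemma partition_integral_dbar_localized:
  assumes P: "partition_of_unity X N c \<psi>" and W: "smooth_field X 1 0 W" and d: "d \<in> X"
    and L: "compact L" "L \<subseteq> fst d" "\<And>e p. p \<notin> L \<Longrightarrow> W e p = 0"
  shows "partition_integral N c \<psi> (dbar X W) = 0"
proof -
  have zero: "dbar X W e p = 0" if "p \<notin> L" for e p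
  proof (cases "e \<in> X \<and> p \<in> fst e")
    case True
    let ?T = "{z \<in> chart_image e. chart_inv e z \<in> - L}"
    have "open ?T" using True L(1) by (intro open_chart_image_of) (auto simp: compact_imp_closed)
    then have "d_zbar (coeff W e) (snd e p) = d_zbar (\<lambda>_. 0) (snd e p)"
      using True that chart(5,6)[of e p] L(3) by (intro wirtinger_cong(3)[of ?T]) (auto simp: coeff_def)
    then show ?thesis by (simp add: dbar_def)
  qed (auto simp: dbar_def)
  have "partition_integral N c \<psi> (dbar X W) = -2 * \<i> * integral (chart_image d) (coeff (dbar X W) d)"
    by (rule partition_integral_localized[OF P continuous_form_of_smooth[OF smooth_field_dbar[OF W]] d L(1,2) zero])
  also have "integral (chart_image d) (coeff (dbar X W) d) = integral (chart_image d) (d_zbar (coeff W d))"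
    by (rule integral_cong) (rule coeff_dbar[OF d])
  also have "\<dots> = 0"
  proof -
    define F where "F = (\<lambda>z. if z \<in> chart_image d then coeff W d z else 0)"
    let ?K = "snd d ` L"
    have "continuous_on L (snd d)" using chart(3)[OF d] L(2) continuous_on_subset by blast
    then have K: "compact ?K" "?K \<subseteq> chart_image d"
      using L(1,2) compact_continuous_image by (auto simp: chart_image_def)
    have F0: "F z = 0" if "z \<notin> ?K" for z
    proof (cases "z \<in> chart_image d")
      case True
      then have "chart_inv d z \<notin> L" using that chart(8)[OF d] by (metis image_eqI)
      then show ?thesis by (simp add: F_def coeff_def L(3))
    qed (simp add: F_def)
    have F1: "smooth_on (chart_image d) F"
      by (subst smooth_on_cong[OF chart(2)[OF d], of _ "coeff W d"])
        (use W d in \<open>auto simp: F_def smooth_field_def\<close>)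
    have oK: "open (- ?K)" using K(1) compact_imp_closed by auto
    have F2: "smooth_on (- ?K) F"
      by (subst smooth_on_cong[OF oK, of _ "\<lambda>_. 0"]) (use F0 in \<open>auto intro!: smooth_intros oK\<close>)
    have sF: "smooth_on UNIV F"
    proof (rule smooth_on_local)
      fix z show "\<exists>T. open T \<and> z \<in> T \<and> smooth_on T F"
        using F1 F2 oK chart(2)[OF d] K(2) by (cases "z \<in> ?K") blast+
    qed
    obtain R where "\<And>z. z \<in> ?K \<Longrightarrow> norm z \<le> R"
      using compact_imp_bounded[OF K(1)] unfolding bounded_iff by blast
    then have "integral UNIV (d_zbar F) = 0"
      using F0 by (intro integral_dbar_compact_support[OF sF, of R]) (meson not_le)
    moreover have "integral UNIV (d_zbar F) = integral (chart_image d) (d_zbar F)"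
    proof (rule integral_zero_outside)
      fix z assume "z \<in> UNIV - chart_image d"
      then have "d_zbar F z = d_zbar (\<lambda>_. 0) z"
        using F0 K(2) by (intro wirtinger_cong(3)[OF oK]) auto
      then show "d_zbar F z = 0" by simp
    qed simp
    moreover have "integral (chart_image d) (d_zbar F) = integral (chart_image d) (d_zbar (coeff W d))"
      by (intro integral_cong wirtinger_cong(3)[OF chart(2)[OF d]]) (auto simp: F_def)
    ultimately show ?thesis by simp
  qed
  finally show ?thesis by simp
qed

text \<open>The form \<open>W\<close> is the sum of the forms \<open>\<psi>\<^sub>k W\<close>, each of which is supported in a chart.\<close>

lemma stokes:
  assumes P: "partition_of_unity X N c \<psi>" and W: "smooth_field X 1 0 W"
  shows "partition_integral N c \<psi> (dbar X W) = 0"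
proof -
  let ?W = "\<lambda>k e p. of_real (\<psi> k p) * W e p"
  have sW: "smooth_field X 1 0 (?W k)" if "k < N" for k
    by (rule smooth_field_scale[OF partition_of_unityD(2)[OF P that] W])
  have "dbar X W = (\<lambda>e p. \<Sum>k<N. dbar X (?W k) e p)"
  proof (intro ext)
    fix e p
    show "dbar X W e p = (\<Sum>k<N. dbar X (?W k) e p)"
    proof (cases "e \<in> X \<and> p \<in> fst e")
      case True
      have "coeff W e = (\<lambda>z. \<Sum>k<N. coeff (?W k) e z)"
        using partition_of_unityD(5)[OF P] by (simp add: fun_eq_iff coeff_def flip: sum_distrib_right of_real_sum)
      moreover have "coeff (?W k) e differentiable (at (snd e p))" if "k \<in> {..<N}" for k
      proof -
        have "smooth_on (chart_image e) (coeff (?W k) e)"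
          using sW[of k] that True unfolding smooth_field_def by simp
        then show ?thesis
          using smooth_onD(1) chart(2)[OF conjunct1[OF True]] chart(6)[OF conjunct1[OF True] conjunct2[OF True]] by blast
      qed
      ultimately show ?thesis
        using True wirtinger_sum(3)[of "{..<N}" "\<lambda>k. coeff (?W k) e" "snd e p"] by (simp add: dbar_def)
    qed (auto simp: dbar_def)
  qed
  then have "partition_integral N c \<psi> (dbar X W) = (\<Sum>k<N. partition_integral N c \<psi> (dbar X (?W k)))"
    using partition_integral_sum[OF P, of "{..<N}" "\<lambda>k. dbar X (?W k)"]
      continuous_form_of_smooth[OF smooth_field_dbar[OF sW]] by simp
  also have "\<dots> = 0"
  proof (intro sum.neutral ballI)
    fix k assume "k \<in> {..<N}"
    then have k: "k < N" by simp
    show "partition_integral N c \<psi> (dbar X (?W k)) = 0"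
    proof (rule partition_integral_dbar_localized[OF P sW[OF k] partition_of_unityD(1)[OF P k]])
      show "compact (closure {p. \<psi> k p \<noteq> 0})" by (simp add: compact_closed)
      show "closure {p. \<psi> k p \<noteq> 0} \<subseteq> fst (c k)" by (rule partition_of_unityD(4)[OF P k])
      show "of_real (\<psi> k p) * W e p = 0" if "p \<notin> closure {p. \<psi> k p \<noteq> 0}" for e p
      proof -
        have "\<psi> k p = 0" using that by (rule zero_outside_support)
        then show ?thesis by simp
      qed
    qed
  qed
  finally show ?thesis .
qed

lemma exists_bump_at:
  obtains b :: "'a \<Rightarrow> real" and c where "c \<in> X" "smooth_fun X (\<lambda>q. of_real (b q))" "\<And>q. 0 \<le> b q"
    "closure {q. b q \<noteq> 0} \<subseteq> fst c" "open {q. b q > 0}" "b p > 0"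
proof -
  let ?c = "chart_at X p"
  note c = chart_at(1)[of p]
  define a where "a = snd ?c p"
  have a: "a \<in> chart_image ?c" unfolding a_def by (rule chart(6)[OF c chart_at(2)])
  obtain r where r: "r > 0" "cball a r \<subseteq> chart_image ?c"
    using a chart(2)[OF c] open_contains_cball by blast
  define g where "g = (\<lambda>z. bump ((z - a) / of_real r))"
  define b where "b = (\<lambda>q. if q \<in> fst ?c then g (snd ?c q) else 0)"
  have g0: "g z > 0 \<longleftrightarrow> z \<in> ball a r" "g z \<ge> 0" for z
    using r(1) by (auto simp: g_def bump_def norm_divide dist_norm norm_minus_commute)
  have gz: "g z = 0" if "z \<notin> ball a r" for z using g0(1)[of z] g0(2)[of z] that by linarith
  have "smooth_on UNIV (\<lambda>z. (z - a) / of_real r)"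
    using r(1) by (intro smooth_intros) auto
  then have "smooth_on UNIV (\<lambda>z. of_real (g z))" unfolding g_def
    by (rule smooth_on_compose[OF open_UNIV open_UNIV _ smooth_bump]) auto
  then have "smooth_on (chart_image ?c) (\<lambda>z. of_real (g z))" by (rule smooth_on_subset) auto
  then have "smooth_fun X (\<lambda>q. if q \<in> fst ?c then of_real (g (snd ?c q)) else 0)"
    by (rule smooth_fun_extend_zero[OF c _ compact_cball r(2)]) (use gz in auto)
  then have "smooth_fun X (\<lambda>q. of_real (b q))" by (simp add: b_def if_distrib cong: if_cong)
  moreover have "0 \<le> b q" for q using g0(2) by (simp add: b_def)
  moreover have "closure {q. b q \<noteq> 0} \<subseteq> fst ?c"
  proof -
    have "compact (chart_inv ?c ` cball a r)"
      using compact_continuous_image[OF continuous_on_subset[OF chart(4)[OF c] r(2)] compact_cball] .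
    then have cl: "closed (chart_inv ?c ` cball a r)" by (rule compact_imp_closed)
    have "{q. b q \<noteq> 0} \<subseteq> chart_inv ?c ` cball a r"
    proof
      fix q assume "q \<in> {q. b q \<noteq> 0}"
      then have q: "q \<in> fst ?c" "snd ?c q \<in> ball a r" using gz by (auto simp: b_def split: if_splits)
      then have "q = chart_inv ?c (snd ?c q)" using chart(5)[OF c] by simp
      then show "q \<in> chart_inv ?c ` cball a r" using q(2) by (metis ball_subset_cball imageI subsetD)
    qed
    then have "closure {q. b q \<noteq> 0} \<subseteq> chart_inv ?c ` cball a r" using cl closure_minimal by blast
    also have "\<dots> \<subseteq> fst ?c" using r(2) chart(7)[OF c] by blast
    finally show ?thesis .
  qed
  moreover have "{q. b q > 0} = {q \<in> fst ?c. snd ?c q \<in> ball a r}"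
    using g0(1) by (auto simp: b_def)
  then have "open {q. b q > 0}" using open_chart_preimage[OF c, of "ball a r"] by simp
  moreover have "b p > 0" using g0(1)[of a] r(1) chart_at(2)[of p] by (simp add: b_def a_def)
  ultimately show ?thesis using that c by blast
qed

text \<open>Finitely many of the bump functions around the points have no common zero, by compactness; they are
divided by their sum.\<close>

lemma exists_partition_of_unity: "\<exists>N c \<psi>. partition_of_unity X N c \<psi>"
proof -
  have "\<forall>p. \<exists>b c. c \<in> X \<and> smooth_fun X (\<lambda>q. of_real (b q)) \<and> (\<forall>q. 0 \<le> b q) \<and>
    closure {q. b q \<noteq> 0} \<subseteq> fst c \<and> open {q. b q > 0} \<and> b p > (0::real)"
    by (metis exists_bump_at)
  then obtain b c where bc: "\<And>p. c p \<in> X" "\<And>p. smooth_fun X (\<lambda>q. of_real (b p q))" "\<And>p q. (0::real) \<le> b p q"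
    "\<And>p. closure {q. b p q \<noteq> 0} \<subseteq> fst (c p)" "\<And>p. open {q. b p q > 0}" "\<And>p. b p p > 0"
    by metis
  have "(UNIV :: 'a set) \<subseteq> (\<Union>p\<in>UNIV. {q. b p q > 0})" using bc(6) by blast
  then obtain D where D: "finite D" "(UNIV :: 'a set) \<subseteq> (\<Union>p\<in>D. {q. b p q > 0})"
    using compactE_image[OF compact, of UNIV "\<lambda>p. {q. b p q > 0}"] bc(5) by metis
  obtain e where e: "bij_betw e {0..<card D} D" using ex_bij_betw_nat_finite[OF D(1)] by blast
  let ?N = "card D"
  define s where "s = (\<lambda>q. \<Sum>k<?N. b (e k) q)"
  have s: "s q > 0" for q
  proof -
    obtain p where "p \<in> D" "b p q > 0" using D(2) by blast
    then obtain k where "k < ?N" "b (e k) q > 0" using e by (auto simp: bij_betw_def image_iff) (metis atLeast0LessThan lessThan_iff imageE)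
    then show ?thesis unfolding s_def using bc(3) by (intro sum_pos2) auto
  qed
  define \<psi> where "\<psi> = (\<lambda>k q. b (e k) q / s q)"
  have "smooth_fun X (\<lambda>q. of_real (s q))"
    unfolding s_def of_real_sum by (intro smooth_fun_sum bc(2))
  then have "smooth_fun X (\<lambda>q. of_real (\<psi> k q))" for k
    unfolding \<psi>_def of_real_divide by (intro smooth_fun_divide bc(2)) (use s in \<open>auto simp: less_imp_neq[symmetric]\<close>)
  moreover have "{q. \<psi> k q \<noteq> 0} = {q. b (e k) q \<noteq> 0}" for k
    using s by (auto simp: \<psi>_def less_imp_neq[symmetric])
  moreover have "0 \<le> \<psi> k q" for k q using bc(3) s[of q] by (simp add: \<psi>_def)
  moreover have "(\<Sum>k<?N. \<psi> k q) = 1" for q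
    using s[of q] unfolding \<psi>_def sum_divide_distrib[symmetric] by (simp add: s_def)
  ultimately have "partition_of_unity X ?N (c \<circ> e) \<psi>"
    using bc(1,4) by (simp add: partition_of_unity_def)
  then show ?thesis by blast
qed

text \<open>The surface integral is the value of an arbitrarily chosen partition of unity. It is determined as
soon as all partitions give the same value, and at least one exists.\<close>

lemma surface_integral_eq:
  assumes "\<And>N c \<psi>. partition_of_unity X N c \<psi> \<Longrightarrow> partition_integral N c \<psi> \<sigma> = I"
  shows "surface_integral X \<sigma> = I"
proof -
  have "surface_integral X \<sigma> =
      (SOME J. \<exists>N c \<psi>. partition_of_unity X N c \<psi> \<and> J = partition_integral N c \<psi> \<sigma>)"
    unfolding surface_integral_def partition_integral_def ..
  also have "\<dots> = I"
  proof (rule some_equality)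
    from exists_partition_of_unity obtain N c \<psi> where "partition_of_unity X N c \<psi>" by (elim exE)
    then show "\<exists>N c \<psi>. partition_of_unity X N c \<psi> \<and> I = partition_integral N c \<psi> \<sigma>"
      using assms[symmetric] by (intro exI conjI)
  qed (use assms in \<open>elim exE conjE, simp\<close>)
  finally show ?thesis .
qed

text \<open>If \<open>\<partial>h\<close> is holomorphic, then \<open>\<partial>\<close>-bar applied to the conjugate of \<open>h\<close> times \<open>\<partial>h\<close> is \<open>|\<partial>h|\<^sup>2\<close>. By Stokes' theorem
the integral of this nonnegative density is zero.\<close>

lemma del_eq_zero:
  assumes h: "smooth_fun X h"
    and hol: "\<And>c z. c \<in> X \<Longrightarrow> z \<in> chart_image c \<Longrightarrow> d_zbar (coeff (del X h) c) z = 0"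
  shows "del X h c p = 0"
proof -
  from exists_partition_of_unity obtain N d \<psi> where P: "partition_of_unity X N d \<psi>" by (elim exE)
  \<comment> \<open>The form whose \<open>\<partial>\<close>-bar-derivative is \<open>|\<partial>h|\<^sup>2\<close>.\<close>
  let ?W = "\<lambda>c p. cnj (h p) * del X h c p"
  have W: "smooth_field X 1 0 ?W"
    by (intro smooth_field_scale smooth_fun_cnj smooth_field_del h)
  have cW: "coeff (dbar X ?W) c z = of_real ((norm (coeff (del X h) c z))\<^sup>2)"
    if c: "c \<in> X" and z: "z \<in> chart_image c" for c z
  proof -
    have hd: "(h \<circ> chart_inv c) differentiable (at z)"
      using h c z smooth_onD(1)[OF _ chart(2)[OF c]] by (simp add: smooth_fun_def)
    have dd: "coeff (del X h) c differentiable (at z)"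
      using smooth_field_del[OF h] c z smooth_onD(1)[OF _ chart(2)[OF c]] by (simp add: smooth_field_def)
    have "coeff (dbar X ?W) c z = d_zbar (\<lambda>w. cnj ((h \<circ> chart_inv c) w) * coeff (del X h) c w) z"
      unfolding coeff_dbar[OF c z] by (simp add: coeff_def[abs_def])
    also have "\<dots> = cnj (d_z (h \<circ> chart_inv c) z) * coeff (del X h) c z"
      unfolding wirtinger_mult(2)[OF wirtinger_cnj(1)[OF hd] dd] wirtinger_cnj(3)[OF hd] hol[OF c z] by simp
    also have "\<dots> = of_real ((norm (coeff (del X h) c z))\<^sup>2)"
      unfolding complex_norm_square coeff_del[OF c z, symmetric] by (simp add: mult.commute)
    finally show ?thesis .
  qed
  define G where "G = (\<lambda>k z. \<psi> k (chart_inv (d k) z) * (norm (coeff (del X h) (d k) z))\<^sup>2)"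
  have G: "G k integrable_on chart_image (d k)"
    "integral (chart_image (d k)) (\<lambda>z. of_real (\<psi> k (chart_inv (d k) z)) * coeff (dbar X ?W) (d k) z) = of_real (integral (chart_image (d k)) (G k))"
    "continuous_on (chart_image (d k)) (G k)" if k: "k < N" for k
  proof -
    note dk = partition_of_unityD(1)[OF P k]
    let ?f = "\<lambda>z. of_real (\<psi> k (chart_inv (d k) z)) * coeff (dbar X ?W) (d k) z"
    have eq: "?f z = of_real (G k z)" if "z \<in> chart_image (d k)" for z
      using cW[OF dk that] by (simp add: G_def)
    have "?f integrable_on chart_image (d k)"
      using integrable_partition[OF P k continuous_form_of_smooth[OF smooth_field_dbar[OF W]]]
      by (simp add: absolutely_integrable_on_def)
    then have "(?f has_integral (integral (chart_image (d k)) ?f)) (chart_image (d k))" by blast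
    then have "((Re \<circ> ?f) has_integral Re (integral (chart_image (d k)) ?f)) (chart_image (d k))"
      by (rule has_integral_linear[OF _ bounded_linear_Re])
    then have "(G k has_integral Re (integral (chart_image (d k)) ?f)) (chart_image (d k))"
      by (rule has_integral_eq[rotated]) (use eq in simp)
    then show i: "G k integrable_on chart_image (d k)" by blast
    then have "(G k has_integral (integral (chart_image (d k)) (G k))) (chart_image (d k))" by blast
    then have "((of_real \<circ> G k :: complex \<Rightarrow> complex) has_integral of_real (integral (chart_image (d k)) (G k))) (chart_image (d k))"
      by (rule has_integral_linear[OF _ bounded_linear_of_real])
    then have "(?f has_integral of_real (integral (chart_image (d k)) (G k))) (chart_image (d k))"
      by (rule has_integral_eq[rotated]) (use eq in simp)
    then show "integral (chart_image (d k)) ?f = of_real (integral (chart_image (d k)) (G k))" by (rule integral_unique)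
    have "continuous_on (chart_image (d k)) (\<lambda>z. Re (of_real (\<psi> k (chart_inv (d k) z))))"
      by (intro continuous_on_Re smooth_fun_continuous[OF partition_of_unityD(2)[OF P k] dk])
    moreover have "continuous_on (chart_image (d k)) (coeff (del X h) (d k))"
      using smooth_field_del[OF h] dk smooth_onD(2)[OF _ chart(2)[OF dk]] by (simp add: smooth_field_def)
    ultimately show "continuous_on (chart_image (d k)) (G k)" unfolding G_def
      by (auto intro!: continuous_intros)
  qed
  have pos: "0 \<le> G k z" if "k < N" for k z
    using partition_of_unityD(3)[OF P that] by (simp add: G_def)
  have "-2 * \<i> * complex_of_real (\<Sum>k<N. integral (chart_image (d k)) (G k)) = 0"
    using stokes[OF P W] G(2) unfolding partition_integral_eq by simp
  then have "complex_of_real (\<Sum>k<N. integral (chart_image (d k)) (G k)) = 0" by (simp del: of_real_sum)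
  then have "(\<Sum>k<N. integral (chart_image (d k)) (G k)) = 0" by (simp only: of_real_eq_0_iff)
  then have int0: "integral (chart_image (d k)) (G k) = 0" if "k < N" for k
    using that G(1) pos by (subst (asm) sum_nonneg_eq_0_iff) (auto intro!: integral_nonneg)
  show ?thesis
  proof (cases "c \<in> X \<and> p \<in> fst c")
    case True
    obtain k where k: "k < N" "\<psi> k p \<noteq> 0"
    proof -
      have "(\<Sum>k<N. \<psi> k p) \<noteq> 0" using partition_of_unityD(5)[OF P] by simp
      then show ?thesis using that by (meson lessThan_iff sum.neutral)
    qed
    note dk = partition_of_unityD(1)[OF P k(1)]
    have p: "p \<in> fst (d k)" using partition_of_unityD(4)[OF P k(1)] k(2) zero_outside_support[of p "\<psi> k"] by blast
    have "G k (snd (d k) p) = 0"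
      by (rule continuous_nonneg_integral_zero[OF chart(2)[OF dk] G(3)[OF k(1)] pos[OF k(1)] G(1)[OF k(1)] int0[OF k(1)]])
        (rule chart(6)[OF dk p])
    then have "del X h (d k) p = 0" using k(2) chart(5)[OF dk p] by (simp add: G_def coeff_def)
    moreover have "tensor_field X 1 0 (del X h)" using smooth_field_del[OF h] by (simp add: smooth_field_def)
    ultimately show ?thesis using tensor_field_zero_iff[of 1 0 "del X h" c "d k" p] True dk p by blast
  qed (auto simp: del_def)
qed

end

section \<open>Zeros of a holomorphic form\<close>

context compact_riemann begin

lemma H0K_D:
  assumes "\<alpha> \<in> H0K X m"
  shows "tensor_field X m 0 \<alpha>" "c \<in> X \<Longrightarrow> coeff \<alpha> c holomorphic_on chart_image c"
  using assms by (simp_all add: H0K_def)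

lemma mem_zeros_iff:
  assumes "tensor_field X m n \<alpha>" "c \<in> X" "p \<in> fst c"
  shows "p \<in> zeros X \<alpha> \<longleftrightarrow> \<alpha> c p = 0"
proof
  assume "\<alpha> c p = 0"
  then have "\<alpha> d p = 0" if "d \<in> X" "p \<in> fst d" for d
    using tensor_field_zero_iff[OF assms(1,2) that(1) assms(3) that(2)] by simp
  then show "p \<in> zeros X \<alpha>" by (simp add: zeros_def)
qed (use assms in \<open>simp add: zeros_def\<close>)

lemma coeff_zero_iff:
  assumes "tensor_field X m n \<alpha>" "c \<in> X" "t \<in> chart_image c"
  shows "coeff \<alpha> c t = 0 \<longleftrightarrow> chart_inv c t \<in> zeros X \<alpha>"
  using mem_zeros_iff[OF assms(1,2) chart(7)[OF assms(2,3)]] by (simp add: coeff_def)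

text \<open>The interior of the zero set is open; it is also closed, by analytic continuation in a disk around a
limit point. Connectedness leaves only the zero section.\<close>

lemma zeros_no_interior:
  assumes \<alpha>: "\<alpha> \<in> H0K X m" "\<alpha> \<noteq> 0" and N: "open N" "p \<in> N"
  shows "\<not> N \<subseteq> zeros X \<alpha>"
proof
  assume sub: "N \<subseteq> zeros X \<alpha>"
  define A where "A = interior (zeros X \<alpha>)"
  note tf = H0K_D(1)[OF \<alpha>(1)]
  have "closed A"
    unfolding closure_subset_eq[symmetric]
  proof
    fix x assume x: "x \<in> closure A"
    let ?c = "chart_at X x"
    note c = chart_at(1)[of x]
    have a: "snd ?c x \<in> chart_image ?c" by (rule chart(6)[OF c chart_at(2)])
    obtain e where e: "e > 0" "ball (snd ?c x) e \<subseteq> chart_image ?c"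
      using a chart(2)[OF c] open_contains_ball by blast
    let ?B = "ball (snd ?c x) e"
    let ?M = "{q \<in> fst ?c. snd ?c q \<in> ?B}"
    have oM: "open ?M" by (rule open_chart_preimage[OF c open_ball])
    have xM: "x \<in> ?M" using chart_at(2)[of x] e(1) by simp
    obtain q where q: "q \<in> ?M" "q \<in> A"
      using x oM xM unfolding closure_iff_nhds_not_empty by (metis (lifting) IntE all_not_in_conv order_refl)
    let ?T = "{t \<in> chart_image ?c. chart_inv ?c t \<in> A} \<inter> ?B"
    have oT: "open ?T"
      by (intro open_Int open_chart_image_of[OF c] open_ball) (simp add: A_def)
    have "snd ?c q \<in> ?T" using q chart(5,6)[OF c, of q] by simp
    then have ne: "?T \<noteq> {}" by blast
    have zero: "coeff \<alpha> ?c t = 0" if "t \<in> ?B" for t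
    proof (rule analytic_continuation_open[OF oT open_ball ne convex_connected[OF convex_ball] _ _ _ _ that])
      show "coeff \<alpha> ?c holomorphic_on ?B"
        by (rule holomorphic_on_subset[OF H0K_D(2)[OF \<alpha>(1) c] e(2)])
      show "coeff \<alpha> ?c t = 0" if "t \<in> ?T" for t
        using that coeff_zero_iff[OF tf c, of t] interior_subset[of "zeros X \<alpha>"] by (auto simp: A_def)
    qed auto
    have "?M \<subseteq> zeros X \<alpha>"
    proof
      fix y assume y: "y \<in> ?M"
      then have "coeff \<alpha> ?c (snd ?c y) = 0" using zero by simp
      then show "y \<in> zeros X \<alpha>"
        using y coeff_zero_iff[OF tf c, of "snd ?c y"] chart(5,6)[OF c, of y] by simp
    qed
    then show "x \<in> A" unfolding A_def using oM xM interior_maximal by blast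
  qed
  moreover have "open A" by (simp add: A_def)
  moreover have "A \<noteq> {}" using sub N interior_maximal[of N "zeros X \<alpha>"] by (auto simp: A_def)
  moreover have "openin (top_of_set UNIV) A \<and> closedin (top_of_set UNIV) A \<longrightarrow> A = {} \<or> A = UNIV"
    using connected unfolding connected_clopen by (rule spec)
  ultimately have "A = UNIV" by (simp add: open_openin[symmetric] closed_closedin[symmetric])
  then have all: "zeros X \<alpha> = UNIV" using interior_subset[of "zeros X \<alpha>"] by (auto simp: A_def)
  have "\<alpha> c x = 0" for c x
  proof (cases "c \<in> X \<and> x \<in> fst c")
    case True
    then show ?thesis using all mem_zeros_iff[OF tf, of c x] by simp
  next
    case False
    then show ?thesis using tensor_fieldD(1)[OF tf, of c x] by simp
  qed
  then show False using \<alpha>(2) by (simp add: fun_eq_iff)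
qed

text \<open>The factorisation of a holomorphic function at a zero of order \<open>k\<close>; it applies at every point, since a
section other than \<open>0\<close> does not vanish identically near any point.\<close>

lemma zero_local_form:
  assumes \<alpha>: "\<alpha> \<in> H0K X m" "\<alpha> \<noteq> 0" and c: "c \<in> X" and a: "a \<in> chart_image c"
  obtains \<delta> k g where "\<delta> > 0" "ball a \<delta> \<subseteq> chart_image c" "g holomorphic_on ball a \<delta>"
    "\<And>t. t \<in> ball a \<delta> \<Longrightarrow> coeff \<alpha> c t = g t * (t - a) ^ k \<and> g t \<noteq> 0"
    "coeff \<alpha> c a = 0 \<Longrightarrow> k > 0"
proof -
  obtain e where e: "e > 0" "ball a e \<subseteq> chart_image c"
    using a chart(2)[OF c] open_contains_ball by blast
  have hol: "coeff \<alpha> c holomorphic_on ball a e"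
    by (rule holomorphic_on_subset[OF H0K_D(2)[OF \<alpha>(1) c] e(2)])
  have "\<exists>t\<in>ball a e. coeff \<alpha> c t \<noteq> 0"
  proof (rule ccontr)
    assume "\<not> (\<exists>t\<in>ball a e. coeff \<alpha> c t \<noteq> 0)"
    then have zero: "coeff \<alpha> c t = 0" if "t \<in> ball a e" for t using that by blast
    have "{q \<in> fst c. snd c q \<in> ball a e} \<subseteq> zeros X \<alpha>"
    proof
      fix y assume y: "y \<in> {q \<in> fst c. snd c q \<in> ball a e}"
      then have "coeff \<alpha> c (snd c y) = 0" using zero by simp
      then show "y \<in> zeros X \<alpha>"
        using y coeff_zero_iff[OF H0K_D(1)[OF \<alpha>(1)] c, of "snd c y"] chart(5,6)[OF c, of y] by simp
    qed
    moreover have "chart_inv c a \<in> {q \<in> fst c. snd c q \<in> ball a e}"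
      using a e(1) chart(7,8)[OF c a] by simp
    ultimately show False
      using zeros_no_interior[OF \<alpha> open_chart_preimage[OF c open_ball[of a e]]] by blast
  qed
  note Z = zorder_exist_zero[OF hol open_ball convex_connected[OF convex_ball] _ this]
  have "a \<in> ball a e" using e(1) by simp
  note Z' = Z[OF this]
  from conjunct2[OF Z'] obtain \<delta> where \<delta>: "\<delta> > 0" "cball a \<delta> \<subseteq> ball a e"
    "zor_poly (coeff \<alpha> c) a holomorphic_on cball a \<delta>"
    "\<forall>w\<in>cball a \<delta>. coeff \<alpha> c w = zor_poly (coeff \<alpha> c) a w * (w - a) ^ nat (zorder (coeff \<alpha> c) a) \<and> zor_poly (coeff \<alpha> c) a w \<noteq> 0"
    by (elim exE conjE) (rule that)
  note ord = conjunct1[OF Z']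
  show ?thesis
  proof
    show "\<delta> > 0" by fact
    show "ball a \<delta> \<subseteq> chart_image c" using \<delta>(2) e(2) ball_subset_cball[of a \<delta>] by blast
    show "zor_poly (coeff \<alpha> c) a holomorphic_on ball a \<delta>"
      using \<delta>(3) ball_subset_cball holomorphic_on_subset by blast
    show "coeff \<alpha> c t = zor_poly (coeff \<alpha> c) a t * (t - a) ^ nat (zorder (coeff \<alpha> c) a) \<and> zor_poly (coeff \<alpha> c) a t \<noteq> 0"
      if "t \<in> ball a \<delta>" for t using that \<delta>(4) by simp
    show "coeff \<alpha> c a = 0 \<Longrightarrow> nat (zorder (coeff \<alpha> c) a) > 0" using ord by simp
  qed
qed

text \<open>Every point has a neighbourhood which contains no zero except possibly the point itself, and
finitely many of these neighbourhoods cover the surface.\<close>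

lemma finite_zeros:
  assumes \<alpha>: "\<alpha> \<in> H0K X m" "\<alpha> \<noteq> 0"
  shows "finite (zeros X \<alpha>)"
proof -
  have "\<exists>N. open N \<and> p \<in> N \<and> N \<inter> zeros X \<alpha> \<subseteq> {p}" for p
  proof -
    let ?c = "chart_at X p"
    note c = chart_at(1)[of p]
    let ?a = "snd ?c p"
    obtain \<delta> k g where \<delta>: "\<delta> > 0" "ball ?a \<delta> \<subseteq> chart_image ?c"
      "\<And>t. t \<in> ball ?a \<delta> \<Longrightarrow> coeff \<alpha> ?c t = g t * (t - ?a) ^ k \<and> g t \<noteq> 0"
      using zero_local_form[OF \<alpha> c chart(6)[OF c chart_at(2)]] by metis
    let ?N = "{q \<in> fst ?c. snd ?c q \<in> ball ?a \<delta>}"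
    have "q = p" if q: "q \<in> ?N" "q \<in> zeros X \<alpha>" for q
    proof -
      have "coeff \<alpha> ?c (snd ?c q) = 0"
        using q coeff_zero_iff[OF H0K_D(1)[OF \<alpha>(1)] c, of "snd ?c q"] chart(5,6)[OF c, of q] by simp
      then have "snd ?c q = ?a" using \<delta>(3)[of "snd ?c q"] q(1) by auto
      then show "q = p" using q(1) chart(5)[OF c, of q] chart(5)[OF c chart_at(2)] by simp
    qed
    then have "?N \<inter> zeros X \<alpha> \<subseteq> {p}" by blast
    moreover have "open ?N" by (rule open_chart_preimage[OF c open_ball])
    moreover have "p \<in> ?N" using chart_at(2)[of p] \<delta>(1) by simp
    ultimately show ?thesis by blast
  qed
  then obtain N where N: "\<And>p. open (N p)" "\<And>p. p \<in> N p" "\<And>p. N p \<inter> zeros X \<alpha> \<subseteq> {p}" by metis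
  have "(UNIV :: 'a set) \<subseteq> (\<Union>p\<in>UNIV. N p)" using N(2) by blast
  then obtain D where D: "finite D" "(UNIV :: 'a set) \<subseteq> (\<Union>p\<in>D. N p)"
    using compactE_image[OF compact, of UNIV N] N(1) by metis
  have "zeros X \<alpha> \<subseteq> D"
  proof
    fix x assume x: "x \<in> zeros X \<alpha>"
    obtain p where "p \<in> D" "x \<in> N p" using D(2) by blast
    then show "x \<in> D" using N(3)[of p] x by blast
  qed
  then show ?thesis using D(1) finite_subset by blast
qed

end

section \<open>The class of a cut-off principal part\<close>

locale principal_part = compact_riemann X for X :: "'a::t2_space chart set" +
  fixes \<omega> :: "'a sect" and z :: "'a \<Rightarrow> 'a chart" and f :: "'a \<Rightarrow> complex \<Rightarrow> complex"
    and r R :: "'a \<Rightarrow> real" and \<rho>' \<rho> :: "'a \<Rightarrow> complex"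
  assumes omega: "\<omega> \<in> H0K X 1" "\<omega> \<noteq> 0"
    and zc: "\<And>p. p \<in> zeros X \<omega> \<Longrightarrow> z p \<in> X" "\<And>p. p \<in> zeros X \<omega> \<Longrightarrow> p \<in> fst (z p)"
      "\<And>p. p \<in> zeros X \<omega> \<Longrightarrow> snd (z p) p = 0"
    and disj: "disjoint_family_on (\<lambda>p. fst (z p)) (zeros X \<omega>)"
    and f_hol: "\<And>p. p \<in> zeros X \<omega> \<Longrightarrow> f p holomorphic_on UNIV"
    and radii: "\<And>p. p \<in> zeros X \<omega> \<Longrightarrow> 0 < r p \<and> r p < R p \<and> cball 0 (R p) \<subseteq> chart_image (z p)"
    and cut_smooth: "smooth_fun X \<rho>'"
    and cut_one: "\<And>x. x \<in> (\<Union>p\<in>zeros X \<omega>. coord_disk (z p) (r p)) \<Longrightarrow> \<rho>' x = 1"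
    and cut_zero: "\<And>x. x \<notin> (\<Union>p\<in>zeros X \<omega>. coord_disk (z p) (R p)) \<Longrightarrow> \<rho>' x = 0"
    and rho: "\<And>x. \<rho> x = (\<Sum>p\<in>zeros X \<omega>. if x \<in> fst (z p) then \<rho>' x * f p (snd (z p) x) else 0)"
begin

abbreviation Z :: "'a set" where "Z \<equiv> zeros X \<omega>"

abbreviation \<Theta>0 :: "'a sect" where "\<Theta>0 \<equiv> dbar_quotient X \<rho> \<omega>"

definition disks :: "'a set" where
  "disks = (\<Union>p\<in>Z. coord_disk (z p) (R p))"

text \<open>The open disk around \<open>p\<close> on which \<open>\<rho>'\<close> is \<open>1\<close>, so that \<open>\<rho>\<close> is \<open>f\<^sub>p\<close> in the coordinate.\<close>

definition core :: "'a \<Rightarrow> 'a set" where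
  "core p = {x \<in> fst (z p). snd (z p) x \<in> ball 0 (r p)}"

lemma finite_Z: "finite Z"
  by (rule finite_zeros[OF omega])

lemma closed_Z: "closed Z"
  by (rule finite_imp_closed[OF finite_Z])

lemma omega_tf: "tensor_field X 1 0 \<omega>"
  by (rule H0K_D(1)[OF omega(1)])

lemma other_chart:
  assumes "p \<in> Z" "p' \<in> Z" "x \<in> fst (z p)" "x \<in> fst (z p')"
  shows "p' = p"
  using disj assms unfolding disjoint_family_on_def by blast

lemma compact_coord_disk:
  assumes "p \<in> Z"
  shows "compact (coord_disk (z p) (R p))"
proof -
  have "coord_disk (z p) (R p) = chart_inv (z p) ` cball 0 (R p)"
  proof (intro equalityI subsetI)
    fix x assume "x \<in> coord_disk (z p) (R p)"
    then show "x \<in> chart_inv (z p) ` cball 0 (R p)"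
      using chart(5)[OF zc(1)[OF assms], of x] by (intro image_eqI[of _ _ "snd (z p) x"]) (auto simp: coord_disk_def)
  next
    fix x assume "x \<in> chart_inv (z p) ` cball 0 (R p)"
    then obtain t where "t \<in> cball 0 (R p)" "x = chart_inv (z p) t" by blast
    moreover from this have "t \<in> chart_image (z p)" using radii[OF assms] by blast
    ultimately show "x \<in> coord_disk (z p) (R p)"
      using chart(7,8)[OF zc(1)[OF assms], of t] by (simp add: coord_disk_def)
  qed
  moreover have "continuous_on (cball 0 (R p)) (chart_inv (z p))"
    using chart(4)[OF zc(1)[OF assms]] radii[OF assms] continuous_on_subset by blast
  ultimately show ?thesis using compact_continuous_image compact_cball by metis
qed

lemma closed_disks: "closed disks"
  unfolding disks_def using compact_imp_closed[OF compact_coord_disk] finite_Z by (intro closed_UN) auto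

lemma disks_chart:
  assumes "p \<in> Z" "x \<in> fst (z p)" "x \<in> disks"
  shows "x \<in> coord_disk (z p) (R p)"
proof -
  obtain p' where p': "p' \<in> Z" "x \<in> coord_disk (z p') (R p')" using assms(3) by (auto simp: disks_def)
  then have "p' = p" using other_chart[OF assms(1) p'(1) assms(2)] by (simp add: coord_disk_def)
  then show ?thesis using p'(2) by simp
qed

lemma rho_chart:
  assumes "p \<in> Z" "x \<in> fst (z p)"
  shows "\<rho> x = \<rho>' x * f p (snd (z p) x)"
proof -
  have "\<rho> x = (\<Sum>p'\<in>Z. if p' = p then \<rho>' x * f p (snd (z p) x) else 0)"
    unfolding rho
  proof (rule sum.cong[OF refl])
    fix p' assume p': "p' \<in> Z"
    show "(if x \<in> fst (z p') then \<rho>' x * f p' (snd (z p') x) else 0) =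
        (if p' = p then \<rho>' x * f p (snd (z p) x) else 0)"
    proof (cases "p' = p")
      case True
      then show ?thesis using assms(2) by simp
    next
      case False
      then have "x \<notin> fst (z p')" using other_chart[OF assms(1) p' assms(2)] by blast
      then show ?thesis using False by simp
    qed
  qed
  then show ?thesis using assms(1) finite_Z by simp
qed

lemma rho_zero: "x \<notin> disks \<Longrightarrow> \<rho> x = 0"
  unfolding rho disks_def using cut_zero[of x] by (intro sum.neutral) simp

lemma core:
  assumes "p \<in> Z"
  shows "open (core p)" "p \<in> core p" "x \<in> core p \<Longrightarrow> x \<in> fst (z p)" "x \<in> core p \<Longrightarrow> \<rho> x = f p (snd (z p) x)"
    "x \<in> core p \<Longrightarrow> x \<in> Z \<Longrightarrow> x = p" "t \<in> ball 0 (r p) \<Longrightarrow> chart_inv (z p) t \<in> core p"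
    "ball 0 (r p) \<subseteq> chart_image (z p)"
proof -
  note c = zc(1)[OF assms]
  show "open (core p)" unfolding core_def by (rule open_chart_preimage[OF c open_ball])
  show "p \<in> core p" using zc[OF assms] radii[OF assms] by (simp add: core_def)
  show fst: "x \<in> fst (z p)" if "x \<in> core p" for x using that by (simp add: core_def)
  show "\<rho> x = f p (snd (z p) x)" if "x \<in> core p"
  proof -
    have "x \<in> coord_disk (z p) (r p)" using that by (simp add: core_def coord_disk_def)
    then have "\<rho>' x = 1" using cut_one assms by blast
    then show ?thesis using rho_chart[OF assms fst[OF that]] by simp
  qed
  show "x = p" if "x \<in> core p" "x \<in> Z"
    using other_chart[OF assms that(2) fst[OF that(1)] zc(2)[OF that(2)]] .
  show sub: "ball 0 (r p) \<subseteq> chart_image (z p)"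
  proof
    fix t :: complex assume "t \<in> ball 0 (r p)"
    then have "t \<in> cball 0 (R p)" using radii[OF assms] by simp
    then show "t \<in> chart_image (z p)" using radii[OF assms] by blast
  qed
  show "chart_inv (z p) t \<in> core p" if "t \<in> ball 0 (r p)"
    using that sub chart(7,8)[OF c, of t] by (auto simp: core_def)
qed

lemma smooth_rho: "smooth_fun X \<rho>"
proof (rule smooth_fun_localI)
  fix x
  show "\<exists>c\<in>X. \<exists>W. x \<in> fst c \<and> open W \<and> W \<subseteq> chart_image c \<and> snd c x \<in> W \<and> smooth_on W (\<rho> \<circ> chart_inv c)"
  proof (cases "\<exists>p\<in>Z. x \<in> fst (z p)")
    case True
    then obtain p where p: "p \<in> Z" "x \<in> fst (z p)" by blast
    note c = zc(1)[OF p(1)]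
    have s1: "smooth_on (chart_image (z p)) (\<rho>' \<circ> chart_inv (z p))"
      using cut_smooth c by (simp add: smooth_fun_def)
    have s2: "smooth_on (chart_image (z p)) (f p)"
      by (rule smooth_on_holomorphic[OF chart(2)[OF c] holomorphic_on_subset[OF f_hol[OF p(1)]]]) simp
    from smooth_on_mult[OF chart(2)[OF c] s1 s2] have "smooth_on (chart_image (z p)) (\<rho> \<circ> chart_inv (z p))"
      by (subst smooth_on_cong[OF chart(2)[OF c], of _ "\<lambda>t. (\<rho>' \<circ> chart_inv (z p)) t * f p t"])
        (simp_all add: rho_chart[OF p(1) chart(7)[OF c]] chart(8)[OF c])
    then show ?thesis using c p(2) chart(2)[OF c] chart(6)[OF c p(2)] by blast
  next
    case False
    then have x: "x \<notin> disks" by (auto simp: disks_def coord_disk_def)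
    let ?c = "chart_at X x"
    note c = chart_at(1)[of x]
    let ?W = "{t \<in> chart_image ?c. chart_inv ?c t \<in> - disks}"
    have oW: "open ?W" by (rule open_chart_image_of[OF c]) (simp add: closed_disks open_Compl)
    have "smooth_on ?W (\<rho> \<circ> chart_inv ?c)"
      by (subst smooth_on_cong[OF oW, of _ "\<lambda>_. 0"]) (use rho_zero smooth_on_const[OF oW] in auto)
    moreover have "snd ?c x \<in> ?W" using x chart(5,6)[OF c chart_at(2)] by simp
    ultimately show ?thesis using c chart_at(2)[of x] oW by blast
  qed
qed

text \<open>Near a zero of \<open>\<omega>\<close> the function \<open>\<rho>\<close> is holomorphic.\<close>

lemma dbar_rho_core:
  assumes p: "p \<in> Z" and c: "c \<in> X" and t: "t \<in> chart_image c" "chart_inv c t \<in> core p"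
  shows "d_zbar (\<rho> \<circ> chart_inv c) t = 0"
proof -
  let ?\<phi> = "snd (z p) \<circ> chart_inv c"
  let ?T = "{s \<in> chart_image c. chart_inv c s \<in> core p}"
  have oT: "open ?T" by (rule open_chart_image_of[OF c core(1)[OF p]])
  have eq: "(\<rho> \<circ> chart_inv c) s = f p (?\<phi> s)" if "s \<in> ?T" for s
    using that core(4)[OF p, of "chart_inv c s"] by simp
  have to: "t \<in> overlap c (z p)" using t core(3)[OF p] mem_overlap[OF c] by blast
  have "?\<phi> field_differentiable (at t)"
    using holomorphic_on_imp_differentiable_at[OF transition_map(1)[OF c zc(1)[OF p]] open_overlap[OF c zc(1)[OF p]] to] .
  moreover have "f p field_differentiable (at (?\<phi> t))"
    using f_hol[OF p] by (simp add: holomorphic_on_def)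
  ultimately have "(f p \<circ> ?\<phi>) field_differentiable (at t)" by (rule field_differentiable_compose)
  then have "d_zbar (\<lambda>s. f p (?\<phi> s)) t = 0" using wirtinger_holomorphic(3) by (simp add: comp_def)
  moreover have "d_zbar (\<rho> \<circ> chart_inv c) t = d_zbar (\<lambda>s. f p (?\<phi> s)) t"
    by (rule wirtinger_cong(3)[OF oT]) (use t eq in auto)
  ultimately show ?thesis by simp
qed

text \<open>The factor \<open>1/\<omega>\<close> is holomorphic off the zeros and passes through \<open>\<partial>/\<partial>z'\<close>.\<close>

lemma theta_off_Z:
  assumes c: "c \<in> X" and t: "t \<in> chart_image c" "chart_inv c t \<notin> Z"
  shows "coeff \<Theta>0 c t = d_zbar (\<lambda>s. \<rho> (chart_inv c s) / coeff \<omega> c s) t"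
    "coeff \<Theta>0 c t = d_zbar (\<rho> \<circ> chart_inv c) t / coeff \<omega> c t"
proof -
  have e: "coeff (\<lambda>c p. \<rho> p / \<omega> c p) c = (\<lambda>s. \<rho> (chart_inv c s) / coeff \<omega> c s)"
    by (simp add: coeff_def fun_eq_iff)
  show 1: "coeff \<Theta>0 c t = d_zbar (\<lambda>s. \<rho> (chart_inv c s) / coeff \<omega> c s) t"
    unfolding coeff_def[of \<Theta>0] using c t chart(7,8)[OF c t(1)] by (simp add: dbar_quotient_def dbar_def e)
  let ?T = "{s \<in> chart_image c. chart_inv c s \<in> - Z}"
  have oT: "open ?T" by (rule open_chart_image_of[OF c]) (simp add: closed_Z open_Compl)
  have "(\<lambda>s. inverse (coeff \<omega> c s)) holomorphic_on ?T"
    using coeff_zero_iff[OF omega_tf c] H0K_D(2)[OF omega(1) c]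
    by (intro holomorphic_on_inverse) (auto intro: holomorphic_on_subset)
  then have inv: "(\<lambda>s. inverse (coeff \<omega> c s)) field_differentiable (at t)"
    using oT t holomorphic_on_imp_differentiable_at by (metis (mono_tags, lifting) ComplI mem_Collect_eq)
  have "(\<rho> \<circ> chart_inv c) differentiable (at t)"
    using smooth_rho c t smooth_onD(1)[OF _ chart(2)[OF c]] by (simp add: smooth_fun_def)
  from wirtinger_mult(2)[OF this wirtinger_holomorphic(1)[OF inv]]
  show "coeff \<Theta>0 c t = d_zbar (\<rho> \<circ> chart_inv c) t / coeff \<omega> c t"
    unfolding 1 wirtinger_holomorphic(3)[OF inv] by (simp add: divide_inverse)
qed

text \<open>On the inner disks \<open>\<rho>/\<omega>\<close> is meromorphic.\<close>

lemma theta_core: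
  assumes p: "p \<in> Z" and c: "c \<in> X" and t: "t \<in> chart_image c" "chart_inv c t \<in> core p"
  shows "coeff \<Theta>0 c t = 0"
proof (cases "chart_inv c t \<in> Z")
  case True
  then show ?thesis by (simp add: coeff_def dbar_quotient_def)
next
  case False
  then show ?thesis using theta_off_Z(2)[OF c t(1)] dbar_rho_core[OF p c t] by simp
qed

lemma theta_off_disks:
  assumes x: "x \<notin> disks"
  shows "\<Theta>0 c x = 0"
proof (cases "c \<in> X \<and> x \<in> fst c \<and> x \<notin> Z")
  case True
  then have c: "c \<in> X" "x \<in> fst c" and xZ: "x \<notin> Z" by auto
  let ?T = "{s \<in> chart_image c. chart_inv c s \<in> - disks}"
  have oT: "open ?T" by (rule open_chart_image_of[OF c(1)]) (simp add: closed_disks open_Compl)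
  have t: "snd c x \<in> chart_image c" "chart_inv c (snd c x) = x" using chart(5,6)[OF c] by auto
  have "d_zbar (\<rho> \<circ> chart_inv c) (snd c x) = d_zbar (\<lambda>_. 0) (snd c x)"
    by (rule wirtinger_cong(3)[OF oT]) (use x t rho_zero in auto)
  then show ?thesis using theta_off_Z(2)[OF c(1) t(1)] xZ t(2) by (simp add: coeff_def)
qed (auto simp: dbar_quotient_def dbar_def)

section \<open>Hodge decompositions of the class against holomorphic forms\<close>

text \<open>A decomposition \<open>\<Theta>0 \<eta> = \<gamma> + \<partial>\<close>-bar\<open> h\<close> with \<open>\<gamma>\<close> harmonic says that \<open>\<gamma> = \<Theta>0 \<eta> - \<partial>\<close>-bar\<open> h\<close> is annihilated by \<open>\<partial>\<close>.
Stated without \<open>\<gamma>\<close>, and with the second derivatives of \<open>h\<close> interchanged, this is an equation between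
\<open>\<partial>h\<close> and \<open>\<eta>\<close> which is linear in the pair \<open>(\<eta>, h)\<close>.\<close>

definition hodge_lift :: "'a sect \<Rightarrow> ('a \<Rightarrow> complex) \<Rightarrow> bool" where
  "hodge_lift \<eta> h \<longleftrightarrow> smooth_fun X h \<and> (\<forall>c\<in>X. \<forall>t\<in>chart_image c.
     d_zbar (coeff (del X h) c) t = d_z (\<lambda>s. coeff \<Theta>0 c s * coeff \<eta> c s) t)"

lemma smooth_theta:
  assumes c: "c \<in> X"
  shows "smooth_on (chart_image c) (coeff \<Theta>0 c)"
proof (rule smooth_on_local)
  fix t assume t: "t \<in> chart_image c"
  show "\<exists>T. open T \<and> t \<in> T \<and> smooth_on T (coeff \<Theta>0 c)"
  proof (cases "chart_inv c t \<in> Z")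
    case True
    let ?T = "{s \<in> chart_image c. chart_inv c s \<in> core (chart_inv c t)}"
    have oT: "open ?T" by (rule open_chart_image_of[OF c core(1)[OF True]])
    have "smooth_on ?T (coeff \<Theta>0 c)"
      by (subst smooth_on_cong[OF oT, of _ "\<lambda>_. 0"]) (use theta_core[OF True c] smooth_on_const[OF oT] in auto)
    then show ?thesis using oT t core(2)[OF True] by blast
  next
    case False
    let ?T = "{s \<in> chart_image c. chart_inv c s \<in> - Z}"
    have oT: "open ?T" by (rule open_chart_image_of[OF c]) (simp add: closed_Z open_Compl)
    have sub: "?T \<subseteq> chart_image c" by blast
    have "smooth_on (chart_image c) (d_zbar (\<rho> \<circ> chart_inv c))"
      using smooth_rho c by (intro smooth_onD(4)[OF _ chart(2)[OF c]]) (simp add: smooth_fun_def)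
    moreover have "smooth_on (chart_image c) (coeff \<omega> c)"
      by (rule smooth_on_holomorphic[OF chart(2)[OF c] H0K_D(2)[OF omega(1) c]])
    ultimately have "smooth_on ?T (\<lambda>s. d_zbar (\<rho> \<circ> chart_inv c) s / coeff \<omega> c s)"
      using coeff_zero_iff[OF omega_tf c] smooth_on_subset[OF _ sub] by (intro smooth_on_divide oT) auto
    then have "smooth_on ?T (coeff \<Theta>0 c)"
      by (subst smooth_on_cong[OF oT, of _ "\<lambda>s. d_zbar (\<rho> \<circ> chart_inv c) s / coeff \<omega> c s"])
        (use theta_off_Z(2)[OF c] in auto)
    then show ?thesis using oT t False by blast
  qed
qed

lemma hodge_lift_sum:
  assumes A: "\<And>i. i \<in> A \<Longrightarrow> hodge_lift (\<eta> i) (h i)" "\<And>i. i \<in> A \<Longrightarrow> \<eta> i \<in> H0K X 1"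
  shows "hodge_lift (\<lambda>c p. \<Sum>i\<in>A. a i * \<eta> i c p) (\<lambda>p. \<Sum>i\<in>A. a i * h i p)"
    and "c \<in> X \<Longrightarrow> t \<in> chart_image c \<Longrightarrow>
      coeff (del X (\<lambda>p. \<Sum>i\<in>A. a i * h i p)) c t = (\<Sum>i\<in>A. a i * coeff (del X (h i)) c t)"
proof -
  have sm: "smooth_fun X (h i)" if "i \<in> A" for i using A(1)[OF that] by (simp add: hodge_lift_def)
  show del: "coeff (del X (\<lambda>p. \<Sum>i\<in>A. a i * h i p)) c t = (\<Sum>i\<in>A. a i * coeff (del X (h i)) c t)"
    if c: "c \<in> X" and t: "t \<in> chart_image c" for c t
  proof -
    have d: "(h i \<circ> chart_inv c) differentiable (at t)" if "i \<in> A" for i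
      using sm[OF that] c t smooth_onD(1)[OF _ chart(2)[OF c]] by (simp add: smooth_fun_def)
    have "(\<lambda>p. \<Sum>i\<in>A. a i * h i p) \<circ> chart_inv c = (\<lambda>s. \<Sum>i\<in>A. a i * (h i \<circ> chart_inv c) s)"
      by (simp add: fun_eq_iff)
    moreover have "d_z (\<lambda>s. \<Sum>i\<in>A. a i * (h i \<circ> chart_inv c) s) t = (\<Sum>i\<in>A. d_z (\<lambda>s. a i * (h i \<circ> chart_inv c) s) t)"
      by (rule wirtinger_sum(2)) (intro differentiable_mult d differentiable_const)
    ultimately show ?thesis
      unfolding coeff_del[OF c t] using wirtinger_cmult(1)[OF d] by (simp cong: sum.cong)
  qed
  show "hodge_lift (\<lambda>c p. \<Sum>i\<in>A. a i * \<eta> i c p) (\<lambda>p. \<Sum>i\<in>A. a i * h i p)"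
    unfolding hodge_lift_def
  proof (intro conjI ballI)
    show "smooth_fun X (\<lambda>p. \<Sum>i\<in>A. a i * h i p)"
      by (intro smooth_fun_sum smooth_fun_mult smooth_fun_const sm)
    fix c t assume c: "c \<in> X" and t: "t \<in> chart_image c"
    have d1: "coeff (del X (h i)) c differentiable (at t)" if "i \<in> A" for i
      using smooth_field_del[OF sm[OF that]] c t smooth_onD(1)[OF _ chart(2)[OF c]] by (simp add: smooth_field_def)
    have d2: "(\<lambda>s. coeff \<Theta>0 c s * coeff (\<eta> i) c s) differentiable (at t)" if "i \<in> A" for i
      using smooth_onD(1)[OF smooth_theta[OF c] chart(2)[OF c] t] wirtinger_holomorphic(1)
        holomorphic_on_imp_differentiable_at[OF H0K_D(2)[OF A(2)[OF that] c] chart(2)[OF c] t]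
      by (intro differentiable_mult) auto
    have "d_zbar (coeff (del X (\<lambda>p. \<Sum>i\<in>A. a i * h i p)) c) t = d_zbar (\<lambda>s. \<Sum>i\<in>A. a i * coeff (del X (h i)) c s) t"
      by (rule wirtinger_cong(3)[OF chart(2)[OF c] t]) (rule del[OF c])
    also have "\<dots> = (\<Sum>i\<in>A. d_zbar (\<lambda>s. a i * coeff (del X (h i)) c s) t)"
      by (rule wirtinger_sum(3)) (intro differentiable_mult d1 differentiable_const)
    also have "\<dots> = (\<Sum>i\<in>A. a i * d_z (\<lambda>s. coeff \<Theta>0 c s * coeff (\<eta> i) c s) t)"
      using A(1) c t wirtinger_cmult(2)[OF d1] by (intro sum.cong) (simp_all add: hodge_lift_def)
    also have "\<dots> = (\<Sum>i\<in>A. d_z (\<lambda>s. a i * (coeff \<Theta>0 c s * coeff (\<eta> i) c s)) t)"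
      using wirtinger_cmult(1)[OF d2] by (intro sum.cong) simp_all
    also have "\<dots> = d_z (\<lambda>s. \<Sum>i\<in>A. a i * (coeff \<Theta>0 c s * coeff (\<eta> i) c s)) t"
      by (rule wirtinger_sum(2)[symmetric]) (intro differentiable_mult d2 differentiable_const)
    also have "(\<lambda>s. \<Sum>i\<in>A. a i * (coeff \<Theta>0 c s * coeff (\<eta> i) c s)) = 
        (\<lambda>s. coeff \<Theta>0 c s * coeff (\<lambda>c p. \<Sum>i\<in>A. a i * \<eta> i c p) c s)"
      by (simp add: coeff_def fun_eq_iff sum_distrib_left mult_ac)
    finally show "d_zbar (coeff (del X (\<lambda>p. \<Sum>i\<in>A. a i * h i p)) c) t =
        d_z (\<lambda>s. coeff \<Theta>0 c s * coeff (\<lambda>c p. \<Sum>i\<in>A. a i * \<eta> i c p) c s) t" .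
  qed
qed

text \<open>The difference of two lifts \<open>h\<close> of the same form has a holomorphic \<open>\<partial>\<close>-derivative, which is zero on a
compact surface.\<close>

lemma hodge_lift_unique:
  assumes \<eta>: "hodge_lift \<eta> h" "hodge_lift \<eta> h'" and c: "c \<in> X" "t \<in> chart_image c"
  shows "coeff (del X h) c t = coeff (del X h') c t"
proof -
  let ?h = "\<lambda>p. h p - h' p"
  have sm: "smooth_fun X h" "smooth_fun X h'" using \<eta> by (auto simp: hodge_lift_def)
  then have smd: "smooth_fun X ?h" by (rule smooth_fun_diff)
  have del: "coeff (del X ?h) c s = coeff (del X h) c s - coeff (del X h') c s" if "c \<in> X" "s \<in> chart_image c" for c s
  proof -
    have d: "(h \<circ> chart_inv c) differentiable (at s)" "(h' \<circ> chart_inv c) differentiable (at s)"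
      using sm that smooth_onD(1)[OF _ chart(2)[OF that(1)]] by (auto simp: smooth_fun_def)
    have "?h \<circ> chart_inv c = (\<lambda>s. (h \<circ> chart_inv c) s - (h' \<circ> chart_inv c) s)" by (simp add: fun_eq_iff)
    then show ?thesis unfolding coeff_del[OF that] using wirtinger_minus(1)[OF d] by simp
  qed
  have "del X ?h c (chart_inv c t) = 0"
  proof (rule del_eq_zero[OF smd])
    fix c s assume c: "c \<in> X" and s: "s \<in> chart_image c"
    have d1: "coeff (del X h) c differentiable (at s)" "coeff (del X h') c differentiable (at s)"
      using smooth_field_del[OF sm(1)] smooth_field_del[OF sm(2)] c s smooth_onD(1)[OF _ chart(2)[OF c]]
      by (simp_all add: smooth_field_def)
    have "d_zbar (coeff (del X ?h) c) s = d_zbar (\<lambda>s. coeff (del X h) c s - coeff (del X h') c s) s"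
      by (rule wirtinger_cong(3)[OF chart(2)[OF c] s]) (rule del[OF c])
    also have "\<dots> = 0"
      unfolding wirtinger_minus(2)[OF d1] using \<eta> c s by (simp add: hodge_lift_def)
    finally show "d_zbar (coeff (del X ?h) c) s = 0" .
  qed
  then show ?thesis using del[OF c] by (simp add: coeff_def)
qed

text \<open>Near a zero of \<open>\<omega>\<close> the form \<open>\<Theta>0\<close> vanishes, and the defining equation of a lift becomes the
Cauchy-Riemann equation for \<open>\<partial>h\<close>.\<close>

lemma hodge_lift_holomorphic:
  assumes \<eta>: "hodge_lift \<eta> h" and p: "p \<in> Z"
  shows "coeff (del X h) (z p) holomorphic_on ball 0 (r p)"
proof (rule holomorphic_of_smooth)
  note c = zc(1)[OF p]
  show "smooth_on (ball 0 (r p)) (coeff (del X h) (z p))"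
    using \<eta> c smooth_field_del by (intro smooth_on_subset[OF _ core(7)[OF p]]) (simp add: hodge_lift_def smooth_field_def)
  fix t :: complex assume t: "t \<in> ball 0 (r p)"
  then have t': "t \<in> chart_image (z p)" using core(7)[OF p] by blast
  have "d_zbar (coeff (del X h) (z p)) t = d_z (\<lambda>s. coeff \<Theta>0 (z p) s * coeff \<eta> (z p) s) t"
    using \<eta> c t' by (simp add: hodge_lift_def)
  also have "\<dots> = d_z (\<lambda>_. 0) t"
  proof (rule wirtinger_cong(2)[OF open_ball t])
    fix s :: complex assume s: "s \<in> ball 0 (r p)"
    show "coeff \<Theta>0 (z p) s * coeff \<eta> (z p) s = 0"
      using theta_core[OF p c _ core(6)[OF p s]] s core(7)[OF p] by auto
  qed
  finally show "d_zbar (coeff (del X h) (z p)) t = 0" by simp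
qed simp

lemma ratio_chart:
  assumes \<alpha>: "\<alpha> \<in> H0K X 1" and c: "c \<in> X" "x \<in> fst c"
  shows "ratio X \<alpha> \<omega> x = \<alpha> c x / \<omega> c x"
proof -
  let ?d = "chart_at X x"
  note e = c(1) chart_at(1)[of x] c(2) chart_at(2)[of x]
  show ?thesis
    unfolding ratio_def
    using tensor_fieldD(2)[OF H0K_D(1)[OF \<alpha>] e] tensor_fieldD(2)[OF omega_tf e] transition_nonzero[OF e]
    by simp
qed

text \<open>If \<open>\<rho> u/\<omega>\<close> is smooth, then \<open>\<Theta>0 u = \<partial>\<close>-bar\<open>(\<rho> u/\<omega>)\<close>, so that \<open>\<rho> u/\<omega>\<close> is a lift of \<open>u\<close> with harmonic part
\<open>0\<close>. At the zeros of \<open>\<omega>\<close>, where the values of the quotient are not given by the formula, the equation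
follows by continuity.\<close>

lemma hodge_lift_smooth_quotient:
  assumes u: "u \<in> H0K X 1" and v: "smooth_fun X v" "\<And>x. x \<notin> Z \<Longrightarrow> v x = \<rho> x * ratio X u \<omega> x"
  shows "hodge_lift u v"
    and "p \<in> Z \<Longrightarrow> v \<circ> chart_inv (z p) holomorphic_on ball 0 (r p)"
proof -
  have off: "d_zbar (v \<circ> chart_inv c) t = d_zbar (\<rho> \<circ> chart_inv c) t * (coeff u c t / coeff \<omega> c t)"
    if c: "c \<in> X" and t: "t \<in> chart_image c" "chart_inv c t \<notin> Z" for c t
  proof -
    let ?T = "{s \<in> chart_image c. chart_inv c s \<in> - Z}"
    have oT: "open ?T" by (rule open_chart_image_of[OF c]) (simp add: closed_Z open_Compl)
    have tT: "t \<in> ?T" using t by simp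
    let ?q = "\<lambda>s. coeff u c s / coeff \<omega> c s"
    have "?q holomorphic_on ?T"
      using coeff_zero_iff[OF omega_tf c] H0K_D(2)[OF omega(1) c] H0K_D(2)[OF u c]
      by (intro holomorphic_on_divide) (auto intro: holomorphic_on_subset)
    from holomorphic_on_imp_differentiable_at[OF this oT tT] have q: "?q field_differentiable (at t)" .
    have rd: "(\<rho> \<circ> chart_inv c) differentiable (at t)"
      using smooth_rho c t smooth_onD(1)[OF _ chart(2)[OF c]] by (simp add: smooth_fun_def)
    have "d_zbar (v \<circ> chart_inv c) t = d_zbar (\<lambda>s. (\<rho> \<circ> chart_inv c) s * ?q s) t"
    proof (rule wirtinger_cong(3)[OF oT tT])
      fix s assume s: "s \<in> ?T"
      then show "(v \<circ> chart_inv c) s = (\<rho> \<circ> chart_inv c) s * ?q s"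
        using v(2)[of "chart_inv c s"] ratio_chart[OF u c chart(7)[OF c], of s] by (simp add: coeff_def)
    qed
    then show ?thesis
      unfolding wirtinger_mult(2)[OF rd wirtinger_holomorphic(1)[OF q]] wirtinger_holomorphic(3)[OF q] by simp
  qed
  have dv: "d_zbar (v \<circ> chart_inv c) t = coeff \<Theta>0 c t * coeff u c t" if c: "c \<in> X" and t: "t \<in> chart_image c" for c t
  proof (cases "chart_inv c t \<in> Z")
    case False
    then show ?thesis using theta_off_Z(2)[OF c t False] off[OF c t False] by simp
  next
    case True
    let ?p = "chart_inv c t"
    let ?T = "{s \<in> chart_image c. chart_inv c s \<in> core ?p}"
    have oT: "open ?T" by (rule open_chart_image_of[OF c core(1)[OF True]])
    have tT: "t \<in> ?T" using t core(2)[OF True] by simp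
    have near: "d_zbar (v \<circ> chart_inv c) s = 0" if s: "s \<in> ?T - {t}" for s
    proof -
      have s': "s \<in> chart_image c" "chart_inv c s \<in> core ?p" using s by auto
      have "chart_inv c s \<notin> Z"
      proof
        assume "chart_inv c s \<in> Z"
        then have "chart_inv c s = ?p" using core(5)[OF True s'(2)] by blast
        then have "s = t" by (metis chart(8)[OF c s'(1)] chart(8)[OF c t])
        then show False using s by simp
      qed
      from off[OF c s'(1) this] dbar_rho_core[OF True c s'] show ?thesis by (simp only: mult_zero_left)
    qed
    have "smooth_on (chart_image c) (d_zbar (v \<circ> chart_inv c))"
      using v(1) c by (intro smooth_onD(4)[OF _ chart(2)[OF c]]) (simp add: smooth_fun_def)
    then have "continuous_on (chart_image c) (d_zbar (v \<circ> chart_inv c))"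
      by (rule smooth_onD(2)[OF _ chart(2)[OF c]])
    then have "isCont (d_zbar (v \<circ> chart_inv c)) t"
      using t chart(2)[OF c] by (simp add: continuous_on_eq_continuous_at)
    then have lim: "(d_zbar (v \<circ> chart_inv c) \<longlongrightarrow> d_zbar (v \<circ> chart_inv c) t) (at t)"
      by (simp add: isCont_def)
    have "\<forall>\<^sub>F s in at t. s \<in> ?T - {t}"
      using oT tT by (rule eventually_at_in_open)
    then have "\<forall>\<^sub>F s in at t. d_zbar (v \<circ> chart_inv c) s = 0"
      by (rule eventually_mono) (rule near)
    then have "(d_zbar (v \<circ> chart_inv c) \<longlongrightarrow> 0) (at t)" by (rule tendsto_eventually)
    from LIM_unique[OF lim this] have "d_zbar (v \<circ> chart_inv c) t = 0" .
    then show ?thesis using True by (simp add: coeff_def dbar_quotient_def)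
  qed
  show "hodge_lift u v"
    unfolding hodge_lift_def
  proof (intro conjI ballI v(1))
    fix c t assume c: "c \<in> X" and t: "t \<in> chart_image c"
    have sv: "smooth_on (chart_image c) (v \<circ> chart_inv c)" using v(1) c by (simp add: smooth_fun_def)
    have "d_zbar (coeff (del X v) c) t = d_zbar (d_z (v \<circ> chart_inv c)) t"
      by (rule wirtinger_cong(3)[OF chart(2)[OF c] t]) (rule coeff_del[OF c])
    also have "\<dots> = d_z (d_zbar (v \<circ> chart_inv c)) t"
      by (rule wirtinger_commute[OF sv chart(2)[OF c] t, symmetric])
    also have "\<dots> = d_z (\<lambda>s. coeff \<Theta>0 c s * coeff u c s) t"
      by (rule wirtinger_cong(2)[OF chart(2)[OF c] t]) (rule dv[OF c])
    finally show "d_zbar (coeff (del X v) c) t = d_z (\<lambda>s. coeff \<Theta>0 c s * coeff u c s) t" .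
  qed
  show "v \<circ> chart_inv (z p) holomorphic_on ball 0 (r p)" if p: "p \<in> Z"
  proof (rule holomorphic_of_smooth)
    note c = zc(1)[OF p]
    show "smooth_on (ball 0 (r p)) (v \<circ> chart_inv (z p))"
      using v(1) c by (intro smooth_on_subset[OF _ core(7)[OF p]]) (simp add: smooth_fun_def)
    fix t :: complex assume t: "t \<in> ball 0 (r p)"
    then have t': "t \<in> chart_image (z p)" using core(7)[OF p] by blast
    show "d_zbar (v \<circ> chart_inv (z p)) t = 0"
      using dv[OF c t'] theta_core[OF p c t' core(6)[OF p t]] by simp
  qed simp
qed

end

section \<open>Residue calculus\<close>

text \<open>A derivative has a primitive, so its integral over a circle vanishes.\<close>

lemma residue_deriv_eq_zero:
  assumes "0 < \<delta>" "G holomorphic_on ball 0 \<delta> - {0}"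
  shows "residue (deriv G) 0 = 0"
proof -
  have o: "open (ball 0 \<delta> - {0 :: complex})" by (simp add: open_delete)
  have hol: "deriv G holomorphic_on ball 0 \<delta> - {0}" by (rule holomorphic_deriv[OF assms(2) o])
  have sub: "cball 0 (\<delta>/2) \<subseteq> ball (0::complex) \<delta>" using assms(1) by auto
  have "(deriv G has_contour_integral 2 * pi * \<i> * residue (deriv G) 0) (circlepath 0 (\<delta>/2))"
    using assms(1) by (intro base_residue[OF open_ball _ _ hol sub]) auto
  moreover have "(deriv G has_contour_integral (G (pathfinish (circlepath 0 (\<delta>/2))) - G (pathstart (circlepath 0 (\<delta>/2))))) (circlepath 0 (\<delta>/2))"
  proof (rule contour_integral_primitive)
    show "(G has_field_derivative deriv G x) (at x within ball 0 \<delta> - {0})" if "x \<in> ball 0 \<delta> - {0}" for x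
      using holomorphic_derivI[OF assms(2) o that] .
    show "path_image (circlepath 0 (\<delta>/2)) \<subseteq> ball 0 \<delta> - {0}"
      using assms(1) by auto
  qed simp
  ultimately have "2 * pi * \<i> * residue (deriv G) 0 = 0"
    using has_contour_integral_unique by fastforce
  then show ?thesis by simp
qed

lemma residue_by_parts:
  assumes "0 < \<delta>" "G holomorphic_on ball 0 \<delta> - {0}" "H holomorphic_on ball 0 \<delta> - {0}"
  shows "residue (\<lambda>t. H t * deriv G t) 0 = - residue (\<lambda>t. G t * deriv H t) 0"
proof -
  have o: "open (ball 0 \<delta> - {0 :: complex})" by (simp add: open_delete)
  have d: "deriv (\<lambda>t. G t * H t) t = G t * deriv H t + H t * deriv G t" if "t \<in> ball 0 \<delta> - {0}" for t
    using holomorphic_on_imp_differentiable_at[OF assms(2) o that]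
      holomorphic_on_imp_differentiable_at[OF assms(3) o that] by (simp add: deriv_mult algebra_simps)
  have "0 = residue (deriv (\<lambda>t. G t * H t)) 0"
    using assms by (intro residue_deriv_eq_zero[symmetric, of \<delta>]) (auto intro!: holomorphic_intros)
  also have "\<dots> = residue (\<lambda>t. G t * deriv H t + H t * deriv G t) 0"
    using eventually_at_in_open[OF open_ball, of 0 0 \<delta>] assms(1)
    by (intro residue_cong) (auto elim!: eventually_mono simp: d)
  also have "\<dots> = residue (\<lambda>t. G t * deriv H t) 0 + residue (\<lambda>t. H t * deriv G t) 0"
    using assms o by (intro residue_add[OF open_ball[of 0 \<delta>]]) (auto intro!: holomorphic_intros)
  finally show ?thesis by (simp add: eq_neg_iff_add_eq_0 add.commute)
qed

lemma higher_deriv_linear_combination: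
  assumes "open S" "x \<in> S" "\<And>i. i \<in> A \<Longrightarrow> G i holomorphic_on S"
  shows "(deriv ^^ k) (\<lambda>t. \<Sum>i\<in>A. b i * G i t) x = (\<Sum>i\<in>A. b i * (deriv ^^ k) (G i) x)"
  using assms(3)
proof (induction A rule: infinite_finite_induct)
  case (insert y F)
  have "(deriv ^^ k) (\<lambda>t. \<Sum>i\<in>insert y F. b i * G i t) x = (deriv ^^ k) (\<lambda>t. b y * G y t + (\<Sum>i\<in>F. b i * G i t)) x"
    using insert by simp
  also have "\<dots> = (deriv ^^ k) (\<lambda>t. b y * G y t) x + (deriv ^^ k) (\<lambda>t. \<Sum>i\<in>F. b i * G i t) x"
    using insert.prems by (intro higher_deriv_add[OF _ _ assms(1,2)] holomorphic_intros) auto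
  also have "(deriv ^^ k) (\<lambda>t. b y * G y t) x = b y * (deriv ^^ k) (G y) x"
    using insert.prems by (intro higher_deriv_cmult[OF _ assms(2,1)]) auto
  finally show ?case using insert by simp
qed simp_all

context principal_part begin

text \<open>The left-hand side is the residue of \<open>f\<^sub>p q/\<omega>\<close> for \<open>q = \<Sum> a\<^sub>i\<^sub>j \<eta>\<^sub>i \<partial>h\<^sub>j\<close>. Near \<open>p\<close> let \<open>\<omega> = g t\<^sup>k dt\<close> with \<open>g\<close>
without zeros, and put \<open>E(\<alpha>) = f\<^sub>p \<alpha>/g\<close>, so that \<open>f\<^sub>p \<alpha>/\<omega> = E(\<alpha>)/t\<^sup>k\<close>. The functionals
\<open>e\<^sub>l(\<alpha>) = E(\<alpha>)\<^sup>(\<^sup>l\<^sup>)(0)\<close> for \<open>l < k\<close> describe the polar part. They vanish on the \<open>u\<^sub>i\<close>, and applied to the first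
slot of the two presentations of the tensor they give \<open>\<Sum>\<^sub>j (\<Sum>\<^sub>i a\<^sub>i\<^sub>j e\<^sub>l(\<eta>\<^sub>i)) \<eta>\<^sub>j = \<Sum>\<^sub>i e\<^sub>l(b\<^sub>i) u\<^sub>i\<close>. By uniqueness of
lifts the same relation holds for \<open>\<partial>h\<^sub>j\<close> and \<open>\<partial>v\<^sub>i\<close>. The Leibniz rule expresses the residues through
\<open>e\<^sub>l\<close> and Taylor coefficients, and so replaces the pairs \<open>(\<eta>\<^sub>i, \<partial>h\<^sub>j)\<close> by the pairs \<open>(b\<^sub>i, \<partial>v\<^sub>i)\<close>. An
integration by parts brings them into the stated form.\<close>

lemma residue_quadratic:
  fixes N :: nat and a :: "nat \<Rightarrow> nat \<Rightarrow> complex"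
  assumes p: "p \<in> Z" and I: "finite I"
    and \<eta>: "\<And>i. i < N \<Longrightarrow> \<eta> i \<in> H0K X 1" "\<And>i. i < N \<Longrightarrow> hodge_lift (\<eta> i) (h i)"
    and ub: "\<And>i. i \<in> I \<Longrightarrow> u i \<in> H0K X 1" "\<And>i. i \<in> I \<Longrightarrow> b i \<in> H0K X 1"
    and v: "\<And>i. i \<in> I \<Longrightarrow> smooth_fun X (v i)"
      "\<And>i x. i \<in> I \<Longrightarrow> x \<notin> Z \<Longrightarrow> v i x = \<rho> x * ratio X (u i) \<omega> x"
    and tensor: "\<And>c x d y. (\<Sum>i<N. \<Sum>j<N. a i j * (\<eta> i c x * \<eta> j d y)) =
      (\<Sum>i\<in>I. u i c x * b i d y + b i c x * u i d y)"
  shows "residue (\<lambda>t. f p t * (\<Sum>i<N. \<Sum>j<N. a i j * (coeff (\<eta> i) (z p) t * coeff (del X (h j)) (z p) t))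
      / coeff \<omega> (z p) t) 0 =
    - (\<Sum>i\<in>I. residue (\<lambda>t. f p t * ratio X (u i) \<omega> (chart_inv (z p) t) *
        deriv (\<lambda>s. f p s * ratio X (b i) \<omega> (chart_inv (z p) s)) t) 0)"
proof -
  note c = zc(1)[OF p]
  have z0: "0 \<in> chart_image (z p)" using chart(6)[OF c zc(2)[OF p]] zc(3)[OF p] by simp
  have p0: "chart_inv (z p) 0 = p" using chart(5)[OF c zc(2)[OF p]] zc(3)[OF p] by simp
  obtain \<delta>' k g where g: "\<delta>' > 0" "ball 0 \<delta>' \<subseteq> chart_image (z p)" "g holomorphic_on ball 0 \<delta>'"
    "\<And>t. t \<in> ball 0 \<delta>' \<Longrightarrow> coeff \<omega> (z p) t = g t * (t - 0) ^ k \<and> g t \<noteq> 0"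
    "coeff \<omega> (z p) 0 = 0 \<Longrightarrow> k > 0"
    using zero_local_form[OF omega c z0] by metis
  have "coeff \<omega> (z p) 0 = 0" using coeff_zero_iff[OF omega_tf c z0] p p0 by simp
  with g(5) obtain m where k: "k = Suc m" by (cases k) auto
  define \<delta> where "\<delta> = min \<delta>' (r p)"
  have \<delta>: "\<delta> > 0" using g(1) radii[OF p] by (simp add: \<delta>_def)
  let ?B = "ball (0::complex) \<delta>"
  have B: "?B \<subseteq> ball 0 \<delta>'" "?B \<subseteq> ball 0 (r p)" "?B \<subseteq> chart_image (z p)"
    using g(2) by (auto simp: \<delta>_def)
  have oB: "open (?B - {0})" by (simp add: open_delete)
  have x0: "0 \<in> ?B" using \<delta> by simp
  have evB: "\<forall>\<^sub>F t in at 0. t \<in> ?B - {0}" by (rule eventually_at_in_open[OF open_ball x0])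
  have \<omega>t: "coeff \<omega> (z p) t = g t * t ^ k" "g t \<noteq> 0" if "t \<in> ?B" for t
    using g(4)[of t] that B(1) by auto
  define E where "E = (\<lambda>\<alpha> t. f p t * coeff \<alpha> (z p) t / g t)"
  have E: "E \<alpha> holomorphic_on ?B" if "\<alpha> \<in> H0K X 1" for \<alpha>
    unfolding E_def using \<omega>t(2)
    by (intro holomorphic_intros holomorphic_on_subset[OF f_hol[OF p]] holomorphic_on_subset[OF H0K_D(2)[OF that c] B(3)]
        holomorphic_on_subset[OF g(3) B(1)]) auto
  define D where "D = (\<lambda>h. coeff (del X h) (z p))"
  have D: "D (h i) holomorphic_on ?B" if "i < N" for i
    unfolding D_def by (rule holomorphic_on_subset[OF hodge_lift_holomorphic[OF \<eta>(2)[OF that] p] B(2)])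
  have lift_v: "hodge_lift (u i) (v i)" if "i \<in> I" for i
    by (rule hodge_lift_smooth_quotient(1)[OF ub(1)[OF that] v(1)[OF that] v(2)[OF that]])
  have Dv: "D (v i) holomorphic_on ?B" if "i \<in> I" for i
    unfolding D_def by (rule holomorphic_on_subset[OF hodge_lift_holomorphic[OF lift_v[OF that] p] B(2)])
  define w where "w = (\<lambda>i. v i \<circ> chart_inv (z p))"
  have w: "w i holomorphic_on ?B" if "i \<in> I" for i
    unfolding w_def
    by (rule holomorphic_on_subset[OF hodge_lift_smooth_quotient(2)[OF ub(1)[OF that] v(1)[OF that] v(2)[OF that] p] B(2)])
  have Dw: "D (v i) t = deriv (w i) t" if "i \<in> I" "t \<in> ?B" for i t
  proof -
    have "t \<in> chart_image (z p)" using that(2) B(3) by blast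
    then show ?thesis
      unfolding D_def coeff_del[OF c \<open>t \<in> chart_image (z p)\<close>] w_def[symmetric, THEN fun_cong]
      using wirtinger_holomorphic(2)[OF holomorphic_on_imp_differentiable_at[OF w[OF that(1)] open_ball that(2)]]
      by (simp add: w_def)
  qed
  have offZ: "chart_inv (z p) t \<notin> Z" if "t \<in> ?B - {0}" for t
  proof
    have t: "t \<in> chart_image (z p)" using that B(3) by blast
    assume "chart_inv (z p) t \<in> Z"
    moreover have "chart_inv (z p) t \<in> core p" using that B(2) by (intro core(6)[OF p]) auto
    ultimately have "chart_inv (z p) t = p" using core(5)[OF p] by blast
    then have "t = snd (z p) p" using chart(8)[OF c t] by simp
    then show False using that zc(3)[OF p] by simp
  qed
  have ratio: "ratio X \<alpha> \<omega> (chart_inv (z p) t) = coeff \<alpha> (z p) t / coeff \<omega> (z p) t"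
    if "\<alpha> \<in> H0K X 1" "t \<in> ?B" for \<alpha> t
  proof -
    have "t \<in> chart_image (z p)" using that(2) B(3) by blast
    from ratio_chart[OF that(1) c chart(7)[OF c this]] show ?thesis by (simp add: coeff_def)
  qed
  have Et: "E \<alpha> t / t ^ k = f p t * ratio X \<alpha> \<omega> (chart_inv (z p) t)" if "\<alpha> \<in> H0K X 1" "t \<in> ?B - {0}" for \<alpha> t
    using that \<omega>t[of t] ratio[of \<alpha> t] by (simp add: E_def)
  have wt: "w i t = f p t * ratio X (u i) \<omega> (chart_inv (z p) t)" if "i \<in> I" "t \<in> ?B - {0}" for i t
  proof -
    have t: "t \<in> ball 0 (r p)" "t \<in> chart_image (z p)" using that(2) B by auto
    have "\<rho> (chart_inv (z p) t) = f p t"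
      using core(4)[OF p core(6)[OF p t(1)]] chart(8)[OF c t(2)] by simp
    then show ?thesis using v(2)[OF that(1) offZ[OF that(2)]] by (simp add: w_def)
  qed
  define e where "e = (\<lambda>l \<alpha>. (deriv ^^ l) (E \<alpha>) 0)"

  \<comment> \<open>Up to \<open>l!\<close> this is the residue of \<open>E(u\<^sub>i)/t\<^sup>l\<^sup>+\<^sup>1\<close>, where \<open>E(u\<^sub>i) = t\<^sup>k w\<^sub>i\<close> with \<open>w\<^sub>i\<close> holomorphic and \<open>l < k\<close>.\<close>
  have e_u: "e l (u i) = 0" if i: "i \<in> I" and l: "l < k" for i l
  proof -
    have "e l (u i) / fact l = residue (\<lambda>t. E (u i) t / t ^ Suc l) 0"
      unfolding e_def by (rule residue_holomorphic_over_power'[OF open_ball x0 E[OF ub(1)[OF i]], symmetric])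
    also have "\<dots> = residue (\<lambda>t. t ^ (m - l) * w i t) 0"
    proof (rule residue_cong[OF eventually_mono[OF evB] refl])
      fix t assume t: "t \<in> ?B - {0}"
      have "E (u i) t = w i t * t ^ k"
        using Et[OF ub(1)[OF i] t] wt[OF i t] t by (simp add: field_simps)
      moreover have "t ^ k = t ^ (m - l) * t ^ Suc l"
        using l k by (simp flip: power_add)
      ultimately show "E (u i) t / t ^ Suc l = t ^ (m - l) * w i t" using t by simp
    qed
    also have "\<dots> = 0"
      by (rule residue_holo[OF open_ball x0]) (intro holomorphic_intros w[OF i])
    finally show ?thesis by simp
  qed

  \<comment> \<open>The functional \<open>e\<^sub>l\<close> applied to the first slot of the tensor.\<close>
  have slot: "(\<Sum>j<N. (\<Sum>i<N. a i j * e l (\<eta> i)) * \<eta> j d y) = (\<Sum>i\<in>I. e l (b i) * u i d y)" if l: "l < k" for l d y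
  proof -
    have "(\<Sum>i<N. (\<Sum>j<N. a i j * \<eta> j d y) * E (\<eta> i) t) =
        (\<Sum>i\<in>I. b i d y * E (u i) t) + (\<Sum>i\<in>I. u i d y * E (b i) t)" for t
    proof -
      have "(\<Sum>i<N. (\<Sum>j<N. a i j * \<eta> j d y) * E (\<eta> i) t) =
          f p t / g t * (\<Sum>i<N. \<Sum>j<N. a i j * (\<eta> i (z p) (chart_inv (z p) t) * \<eta> j d y))"
        by (simp add: E_def coeff_def sum_distrib_left sum_distrib_right sum_divide_distrib mult_ac)
      also have "\<dots> = (\<Sum>i\<in>I. b i d y * E (u i) t) + (\<Sum>i\<in>I. u i d y * E (b i) t)"
        unfolding tensor by (simp add: E_def coeff_def sum_distrib_left sum_divide_distrib sum.distrib algebra_simps add_divide_distrib)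
      finally show ?thesis .
    qed
    then have "(deriv ^^ l) (\<lambda>t. \<Sum>i<N. (\<Sum>j<N. a i j * \<eta> j d y) * E (\<eta> i) t) 0 =
        (deriv ^^ l) (\<lambda>t. (\<Sum>i\<in>I. b i d y * E (u i) t) + (\<Sum>i\<in>I. u i d y * E (b i) t)) 0" by simp
    also have "\<dots> = (deriv ^^ l) (\<lambda>t. \<Sum>i\<in>I. b i d y * E (u i) t) 0 + (deriv ^^ l) (\<lambda>t. \<Sum>i\<in>I. u i d y * E (b i) t) 0"
      using E ub by (intro higher_deriv_add[OF _ _ open_ball x0] holomorphic_intros) auto
    also have "\<dots> = (\<Sum>i\<in>I. b i d y * e l (u i)) + (\<Sum>i\<in>I. u i d y * e l (b i))"
      using E ub by (simp add: e_def higher_deriv_linear_combination[OF open_ball x0])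
    also have "(\<Sum>i\<in>I. b i d y * e l (u i)) = 0" using e_u l by simp
    also have "(deriv ^^ l) (\<lambda>t. \<Sum>i<N. (\<Sum>j<N. a i j * \<eta> j d y) * E (\<eta> i) t) 0 =
        (\<Sum>i<N. (\<Sum>j<N. a i j * \<eta> j d y) * e l (\<eta> i))"
      unfolding e_def by (rule higher_deriv_linear_combination[OF open_ball x0]) (use E \<eta>(1) in auto)
    finally have "(\<Sum>i<N. (\<Sum>j<N. a i j * \<eta> j d y) * e l (\<eta> i)) = (\<Sum>i\<in>I. u i d y * e l (b i))"
      by simp
    moreover have "(\<Sum>j<N. (\<Sum>i<N. a i j * e l (\<eta> i)) * \<eta> j d y) = (\<Sum>i<N. (\<Sum>j<N. a i j * \<eta> j d y) * e l (\<eta> i))"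
      unfolding sum_distrib_right by (subst sum.swap) (simp add: mult_ac)
    ultimately show ?thesis by (simp add: mult.commute)
  qed

  \<comment> \<open>The same relation for the \<open>\<partial>\<close>-derivatives of the lifts.\<close>
  have D_eq: "(\<Sum>j<N. (\<Sum>i<N. a i j * e l (\<eta> i)) * D (h j) t) = (\<Sum>i\<in>I. e l (b i) * D (v i) t)"
    if l: "l < k" and t: "t \<in> ?B" for l t
  proof -
    have t': "t \<in> chart_image (z p)" using t B(3) by blast
    let ?A = "\<lambda>j. \<Sum>i<N. a i j * e l (\<eta> i)"
    have 1: "hodge_lift (\<lambda>d y. \<Sum>j<N. ?A j * \<eta> j d y) (\<lambda>x. \<Sum>j<N. ?A j * h j x)"
      by (rule hodge_lift_sum(1)) (use \<eta> in auto)
    have 2: "hodge_lift (\<lambda>d y. \<Sum>i\<in>I. e l (b i) * u i d y) (\<lambda>x. \<Sum>i\<in>I. e l (b i) * v i x)"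
      by (rule hodge_lift_sum(1)) (use lift_v ub(1) in auto)
    have 3: "hodge_lift (\<lambda>d y. \<Sum>i\<in>I. e l (b i) * u i d y) (\<lambda>x. \<Sum>j<N. ?A j * h j x)"
      using 1 unfolding slot[OF l] .
    have "coeff (del X (\<lambda>x. \<Sum>j<N. ?A j * h j x)) (z p) t = (\<Sum>j<N. ?A j * D (h j) t)"
      unfolding D_def by (rule hodge_lift_sum(2)[OF _ _ c t']) (use \<eta> in auto)
    moreover have "coeff (del X (\<lambda>x. \<Sum>i\<in>I. e l (b i) * v i x)) (z p) t = (\<Sum>i\<in>I. e l (b i) * D (v i) t)"
      unfolding D_def by (rule hodge_lift_sum(2)[OF _ _ c t', where \<eta> = u]) (use lift_v ub(1) in auto)
    ultimately show ?thesis using hodge_lift_unique[OF 3 2 c t'] by simp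
  qed

  have D_deriv: "(\<Sum>j<N. (\<Sum>i<N. a i j * e l (\<eta> i)) * (deriv ^^ o') (D (h j)) 0) = (\<Sum>i\<in>I. e l (b i) * (deriv ^^ o') (D (v i)) 0)"
    if l: "l < k" for l o'
  proof -
    have "(deriv ^^ o') (\<lambda>t. \<Sum>j<N. (\<Sum>i<N. a i j * e l (\<eta> i)) * D (h j) t) 0 = (deriv ^^ o') (\<lambda>t. \<Sum>i\<in>I. e l (b i) * D (v i) t) 0"
    proof (rule higher_deriv_cong_ev[OF _ refl])
      have "\<forall>\<^sub>F t in nhds 0. t \<in> ?B" by (rule eventually_nhds_in_open[OF open_ball x0])
      then show "\<forall>\<^sub>F t in nhds 0. (\<Sum>j<N. (\<Sum>i<N. a i j * e l (\<eta> i)) * D (h j) t) = (\<Sum>i\<in>I. e l (b i) * D (v i) t)"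
        by (rule eventually_mono) (rule D_eq[OF l])
    qed
    also have "(deriv ^^ o') (\<lambda>t. \<Sum>i\<in>I. e l (b i) * D (v i) t) 0 = (\<Sum>i\<in>I. e l (b i) * (deriv ^^ o') (D (v i)) 0)"
      by (rule higher_deriv_linear_combination[OF open_ball x0 Dv])
    also have "(deriv ^^ o') (\<lambda>t. \<Sum>j<N. (\<Sum>i<N. a i j * e l (\<eta> i)) * D (h j) t) 0 =
        (\<Sum>j<N. (\<Sum>i<N. a i j * e l (\<eta> i)) * (deriv ^^ o') (D (h j)) 0)"
      by (rule higher_deriv_linear_combination[OF open_ball x0]) (use D in auto)
    finally show ?thesis .
  qed

  have leibniz: "(deriv ^^ m) (\<lambda>t. E \<alpha> t * G t) 0 = (\<Sum>l=0..m. of_nat (m choose l) * e l \<alpha> * (deriv ^^ (m - l)) G 0)"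
    if "\<alpha> \<in> H0K X 1" "G holomorphic_on ?B" for \<alpha> G
    unfolding e_def by (rule higher_deriv_mult[OF E[OF that(1)] that(2) open_ball x0])

  \<comment> \<open>Expand the residues by the Leibniz rule, exchange the pairs, and contract again.\<close>
  have "residue (\<lambda>t. f p t * (\<Sum>i<N. \<Sum>j<N. a i j * (coeff (\<eta> i) (z p) t * coeff (del X (h j)) (z p) t))
      / coeff \<omega> (z p) t) 0 = residue (\<lambda>t. (\<Sum>i<N. 1 * (\<Sum>j<N. a i j * (E (\<eta> i) t * D (h j) t))) / t ^ Suc m) 0"
  proof (rule residue_cong[OF eventually_mono[OF evB] refl])
    fix t assume t: "t \<in> ?B - {0}"
    have "(\<Sum>i<N. 1 * (\<Sum>j<N. a i j * (E (\<eta> i) t * D (h j) t))) =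
        f p t / g t * (\<Sum>i<N. \<Sum>j<N. a i j * (coeff (\<eta> i) (z p) t * coeff (del X (h j)) (z p) t))"
      by (simp add: E_def D_def sum_distrib_left sum_divide_distrib mult_ac)
    then show "f p t * (\<Sum>i<N. \<Sum>j<N. a i j * (coeff (\<eta> i) (z p) t * coeff (del X (h j)) (z p) t)) / coeff \<omega> (z p) t =
        (\<Sum>i<N. 1 * (\<Sum>j<N. a i j * (E (\<eta> i) t * D (h j) t))) / t ^ Suc m"
      using \<omega>t[of t] t k by simp
  qed
  also have "\<dots> = (deriv ^^ m) (\<lambda>t. \<Sum>i<N. 1 * (\<Sum>j<N. a i j * (E (\<eta> i) t * D (h j) t))) 0 / fact m"
    using E D \<eta>(1) by (intro residue_holomorphic_over_power'[OF open_ball x0] holomorphic_intros) auto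
  also have "(deriv ^^ m) (\<lambda>t. \<Sum>i<N. 1 * (\<Sum>j<N. a i j * (E (\<eta> i) t * D (h j) t))) 0 =
      (\<Sum>i<N. 1 * (\<Sum>j<N. a i j * (deriv ^^ m) (\<lambda>t. E (\<eta> i) t * D (h j) t) 0))"
  proof (subst higher_deriv_linear_combination[OF open_ball x0])
    show "(\<lambda>t. \<Sum>j<N. a i j * (E (\<eta> i) t * D (h j) t)) holomorphic_on ?B" if "i \<in> {..<N}" for i
      using that E D \<eta>(1) by (intro holomorphic_intros) auto
    show "(\<Sum>i<N. 1 * (deriv ^^ m) (\<lambda>t. \<Sum>j<N. a i j * (E (\<eta> i) t * D (h j) t)) 0) =
      (\<Sum>i<N. 1 * (\<Sum>j<N. a i j * (deriv ^^ m) (\<lambda>t. E (\<eta> i) t * D (h j) t) 0))"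
      using E D \<eta>(1)
      by (intro sum.cong refl arg_cong2[where f = "(*)"] higher_deriv_linear_combination[OF open_ball x0] holomorphic_intros) auto
  qed
  also have "\<dots> = (\<Sum>i<N. \<Sum>j<N. \<Sum>l=0..m. of_nat (m choose l) * (a i j * e l (\<eta> i) * (deriv ^^ (m - l)) (D (h j)) 0))"
    using leibniz[OF \<eta>(1) D] by (simp add: sum_distrib_left mult_ac)
  also have "\<dots> = (\<Sum>l=0..m. of_nat (m choose l) * (\<Sum>j<N. (\<Sum>i<N. a i j * e l (\<eta> i)) * (deriv ^^ (m - l)) (D (h j)) 0))"
  proof -
    have "(\<Sum>i<N. \<Sum>j<N. \<Sum>l=0..m. F i j l) = (\<Sum>l=0..m. \<Sum>j<N. \<Sum>i<N. F i j l)" for F :: "nat \<Rightarrow> nat \<Rightarrow> nat \<Rightarrow> complex"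
    proof -
      have "(\<Sum>i<N. \<Sum>j<N. \<Sum>l=0..m. F i j l) = (\<Sum>j<N. \<Sum>i<N. \<Sum>l=0..m. F i j l)" by (rule sum.swap)
      also have "\<dots> = (\<Sum>j<N. \<Sum>l=0..m. \<Sum>i<N. F i j l)" by (intro sum.cong refl sum.swap)
      also have "\<dots> = (\<Sum>l=0..m. \<Sum>j<N. \<Sum>i<N. F i j l)" by (rule sum.swap)
      finally show ?thesis .
    qed
    then show ?thesis by (simp add: sum_distrib_left sum_distrib_right)
  qed
  also have "\<dots> = (\<Sum>l=0..m. of_nat (m choose l) * (\<Sum>i\<in>I. e l (b i) * (deriv ^^ (m - l)) (D (v i)) 0))"
    using D_deriv k by (intro sum.cong refl) simp
  also have "\<dots> = (\<Sum>i\<in>I. \<Sum>l=0..m. of_nat (m choose l) * e l (b i) * (deriv ^^ (m - l)) (D (v i)) 0)"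
    unfolding sum_distrib_left by (subst sum.swap) (simp add: mult_ac)
  also have "\<dots> = (\<Sum>i\<in>I. (deriv ^^ m) (\<lambda>t. E (b i) t * D (v i) t) 0)"
    using leibniz[OF ub(2) Dv] by simp
  also have "\<dots> / fact m = (\<Sum>i\<in>I. (deriv ^^ m) (\<lambda>t. E (b i) t * D (v i) t) 0 / fact m)"
    by (rule sum_divide_distrib)
  also have "\<dots> = (\<Sum>i\<in>I. - residue (\<lambda>t. f p t * ratio X (u i) \<omega> (chart_inv (z p) t) *
        deriv (\<lambda>s. f p s * ratio X (b i) \<omega> (chart_inv (z p) s)) t) 0)"
  proof (rule sum.cong[OF refl])
    fix i assume i: "i \<in> I"
    define H where "H = (\<lambda>t. f p t * ratio X (b i) \<omega> (chart_inv (z p) t))"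
    have H: "H holomorphic_on ?B - {0}"
    proof -
      have "(\<lambda>t. E (b i) t / t ^ k) holomorphic_on ?B - {0}"
        by (intro holomorphic_intros holomorphic_on_subset[OF E[OF ub(2)[OF i]]]) auto
      then show ?thesis
        by (rule holomorphic_transform) (simp add: H_def Et[OF ub(2)[OF i]])
    qed
    have "(deriv ^^ m) (\<lambda>t. E (b i) t * D (v i) t) 0 / fact m = residue (\<lambda>t. E (b i) t * D (v i) t / t ^ Suc m) 0"
      by (rule residue_holomorphic_over_power'[OF open_ball x0, symmetric]) (intro holomorphic_intros E ub Dv i)
    also have "\<dots> = residue (\<lambda>t. H t * deriv (w i) t) 0"
    proof (rule residue_cong[OF eventually_mono[OF evB] refl])
      fix t assume t: "t \<in> ?B - {0}"
      have "E (b i) t / t ^ Suc m = H t" using Et[OF ub(2)[OF i] t] unfolding k H_def .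
      moreover have "D (v i) t = deriv (w i) t" using Dw[OF i] t by simp
      ultimately show "E (b i) t * D (v i) t / t ^ Suc m = H t * deriv (w i) t"
        by (simp only: times_divide_eq_left[symmetric])
    qed
    also have "\<dots> = - residue (\<lambda>t. w i t * deriv H t) 0"
      by (rule residue_by_parts[OF \<delta> holomorphic_on_subset[OF w[OF i]] H]) auto
    also have "residue (\<lambda>t. w i t * deriv H t) 0 = residue (\<lambda>t. f p t * ratio X (u i) \<omega> (chart_inv (z p) t) * deriv H t) 0"
      by (rule residue_cong[OF eventually_mono[OF evB] refl]) (simp add: wt[OF i])
    finally show "(deriv ^^ m) (\<lambda>t. E (b i) t * D (v i) t) 0 / fact m =
        - residue (\<lambda>t. f p t * ratio X (u i) \<omega> (chart_inv (z p) t) *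
        deriv (\<lambda>s. f p s * ratio X (b i) \<omega> (chart_inv (z p) s)) t) 0" unfolding H_def .
  qed
  finally show ?thesis by (simp add: sum_negf)
qed

end

section \<open>The second fundamental form\<close>

lemma sym_presentationD:
  assumes "sym_presentation X Q N a \<eta>"
  shows "i < N \<Longrightarrow> \<eta> i \<in> H0K X 1" "i < N \<Longrightarrow> j < N \<Longrightarrow> a i j = a j i"
    "Q c x d y = (\<Sum>i<N. \<Sum>j<N. a i j * (\<eta> i c x * \<eta> j d y))"
  using assms unfolding sym_presentation_def tensor_def by blast+

context compact_riemann begin

text \<open>The first relation is the vanishing of \<open>Q\<close> on the diagonal. Its derivative is twice the left-hand side
of the second, because \<open>a\<close> is symmetric.\<close>

lemma quadric_relations:
  assumes pres: "sym_presentation X Q N a \<eta>" and Q: "Q \<in> I2 X" and c: "c \<in> X" and t: "t \<in> chart_image c"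
  shows "(\<Sum>i<N. \<Sum>j<N. a i j * (coeff (\<eta> i) c t * coeff (\<eta> j) c t)) = 0"
    and "(\<Sum>i<N. \<Sum>j<N. a i j * (coeff (\<eta> i) c t * deriv (coeff (\<eta> j) c) t)) = 0"
proof -
  have \<eta>: "\<eta> i \<in> H0K X 1" if "i < N" for i by (rule sym_presentationD[OF pres]) (use that in simp_all)
  have sym: "a i j = a j i" if "i < N" "j < N" for i j by (rule sym_presentationD[OF pres]) (use that in simp_all)
  have zero: "(\<Sum>i<N. \<Sum>j<N. a i j * (coeff (\<eta> i) c s * coeff (\<eta> j) c s)) = 0" for s
  proof -
    have "multiplication Q c x = 0" for x using Q by (simp add: I2_def)
    then have "Q c x c x = 0" for x by (simp add: multiplication_def)
    then show ?thesis using sym_presentationD(3)[OF pres, of c _ c] by (simp add: coeff_def)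
  qed
  show "(\<Sum>i<N. \<Sum>j<N. a i j * (coeff (\<eta> i) c t * coeff (\<eta> j) c t)) = 0" by (rule zero)
  have d: "(coeff (\<eta> i) c has_field_derivative deriv (coeff (\<eta> i) c) t) (at t)" if "i < N" for i
    by (rule holomorphic_derivI[OF H0K_D(2)[OF \<eta>[OF that] c] chart(2)[OF c] t])
  have "((\<lambda>s. \<Sum>i<N. \<Sum>j<N. a i j * (coeff (\<eta> i) c s * coeff (\<eta> j) c s)) has_field_derivative
      (\<Sum>i<N. \<Sum>j<N. a i j * (coeff (\<eta> i) c t * deriv (coeff (\<eta> j) c) t + deriv (coeff (\<eta> i) c) t * coeff (\<eta> j) c t))) (at t)"
    by (intro DERIV_sum DERIV_cmult DERIV_mult' d) auto
  moreover have "((\<lambda>s. \<Sum>i<N. \<Sum>j<N. a i j * (coeff (\<eta> i) c s * coeff (\<eta> j) c s)) has_field_derivative 0) (at t)"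
    unfolding zero by simp
  ultimately have "(\<Sum>i<N. \<Sum>j<N. a i j * (coeff (\<eta> i) c t * deriv (coeff (\<eta> j) c) t + deriv (coeff (\<eta> i) c) t * coeff (\<eta> j) c t)) = 0"
    by (rule DERIV_unique)
  then have "(\<Sum>i<N. \<Sum>j<N. a i j * (coeff (\<eta> i) c t * deriv (coeff (\<eta> j) c) t)) +
      (\<Sum>i<N. \<Sum>j<N. a i j * (deriv (coeff (\<eta> i) c) t * coeff (\<eta> j) c t)) = 0"
    by (simp add: distrib_left sum.distrib)
  moreover have "(\<Sum>i<N. \<Sum>j<N. a i j * (deriv (coeff (\<eta> i) c) t * coeff (\<eta> j) c t)) =
      (\<Sum>i<N. \<Sum>j<N. a i j * (coeff (\<eta> i) c t * deriv (coeff (\<eta> j) c) t))"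
  proof -
    have "(\<Sum>i<N. \<Sum>j<N. a i j * (deriv (coeff (\<eta> i) c) t * coeff (\<eta> j) c t)) =
        (\<Sum>j<N. \<Sum>i<N. a i j * (deriv (coeff (\<eta> i) c) t * coeff (\<eta> j) c t))" by (rule sum.swap)
    also have "\<dots> = (\<Sum>j<N. \<Sum>i<N. a j i * (coeff (\<eta> j) c t * deriv (coeff (\<eta> i) c) t))"
    proof (intro sum.cong refl)
      fix i j assume "j \<in> {..<N}" "i \<in> {..<N}"
      then show "a i j * (deriv (coeff (\<eta> i) c) t * coeff (\<eta> j) c t) = a j i * (coeff (\<eta> j) c t * deriv (coeff (\<eta> i) c) t)"
        using sym[of i j] by (simp add: mult_ac)
    qed
    finally show ?thesis .
  qed
  ultimately show "(\<Sum>i<N. \<Sum>j<N. a i j * (coeff (\<eta> i) c t * deriv (coeff (\<eta> j) c) t)) = 0" by simp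
qed

text \<open>By the Leibniz rule and the two relations above. It is applied to \<open>G = \<Theta>0\<close>, for the holomorphy of
\<open>II(Q)(\<zeta>)\<close>, and to vector fields \<open>G = V\<close>, for the independence of the representative.\<close>

lemma quadric_d_z:
  assumes pres: "sym_presentation X Q N a \<eta>" and Q: "Q \<in> I2 X" and c: "c \<in> X" and t: "t \<in> chart_image c"
    and G: "G differentiable (at t)"
  shows "(\<Sum>i<N. \<Sum>j<N. a i j * (coeff (\<eta> i) c t * d_z (\<lambda>s. G s * coeff (\<eta> j) c s) t)) = 0"
proof -
  have d: "coeff (\<eta> j) c field_differentiable (at t)" if "j < N" for j
  proof -
    have "\<eta> j \<in> H0K X 1" by (rule sym_presentationD[OF pres]) (use that in simp_all)
    then show ?thesis
      using holomorphic_on_imp_differentiable_at[OF H0K_D(2)[OF _ c] chart(2)[OF c] t] by blast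
  qed
  have "d_z (\<lambda>s. G s * coeff (\<eta> j) c s) t = d_z G t * coeff (\<eta> j) c t + G t * deriv (coeff (\<eta> j) c) t"
    if "j < N" for j
    using wirtinger_mult(1)[OF G wirtinger_holomorphic(1)[OF d[OF that]]] wirtinger_holomorphic(2)[OF d[OF that]] by simp
  then have "(\<Sum>i<N. \<Sum>j<N. a i j * (coeff (\<eta> i) c t * d_z (\<lambda>s. G s * coeff (\<eta> j) c s) t)) =
      (\<Sum>i<N. \<Sum>j<N. d_z G t * (a i j * (coeff (\<eta> i) c t * coeff (\<eta> j) c t))
        + G t * (a i j * (coeff (\<eta> i) c t * deriv (coeff (\<eta> j) c) t)))"
    by (simp add: algebra_simps)
  also have "\<dots> = d_z G t * (\<Sum>i<N. \<Sum>j<N. a i j * (coeff (\<eta> i) c t * coeff (\<eta> j) c t))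
        + G t * (\<Sum>i<N. \<Sum>j<N. a i j * (coeff (\<eta> i) c t * deriv (coeff (\<eta> j) c) t))"
    by (simp add: sum.distrib sum_distrib_left)
  finally show ?thesis using quadric_relations[OF pres Q c t] by simp
qed

end

context principal_part begin

text \<open>A decomposition for the representative \<open>\<Theta>0 + \<partial>\<close>-bar\<open> V\<close> becomes one for \<open>\<Theta>0\<close> when \<open>V \<eta>\<close> is subtracted from
\<open>h\<close>.\<close>

lemma hodge_lift_of_representative:
  assumes \<Theta>: "\<And>c x. \<Theta> c x = \<Theta>0 c x + dbar X V c x" and V: "smooth_field X (-1) 0 V"
    and \<eta>: "\<eta> \<in> H0K X 1" and \<gamma>: "harmonic01 X \<gamma>" and h: "smooth_fun X h"
    and dec: "\<And>c x. \<Theta> c x * \<eta> c x = \<gamma> c x + dbar X (\<lambda>_. h) c x"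
  defines "h' \<equiv> \<lambda>x. h x - V (chart_at X x) x * \<eta> (chart_at X x) x"
  shows "hodge_lift \<eta> h'"
    and "c \<in> X \<Longrightarrow> t \<in> chart_image c \<Longrightarrow>
      coeff (del X h') c t = coeff (del X h) c t - d_z (\<lambda>s. coeff V c s * coeff \<eta> c s) t"
proof -
  have prod: "smooth_field X 0 0 (\<lambda>c x. V c x * \<eta> c x)"
    using smooth_field_mult[OF V H0K_smooth_field[OF \<eta>]] by simp
  have sm': "smooth_fun X h'"
    unfolding h'_def by (intro smooth_fun_diff h smooth_fun_of_field(1)[OF prod])
  have local: "(h' \<circ> chart_inv c) s = (h \<circ> chart_inv c) s - coeff V c s * coeff \<eta> c s"
    if c: "c \<in> X" and s: "s \<in> chart_image c" for c s
    using smooth_fun_of_field(2)[OF prod c chart(7)[OF c s]] by (simp add: h'_def coeff_def)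
  have dh: "(h \<circ> chart_inv c) differentiable (at s)" if "c \<in> X" "s \<in> chart_image c" for c s
    using h that smooth_onD(1)[OF _ chart(2)[OF that(1)]] by (simp add: smooth_fun_def)
  have dV: "coeff V c differentiable (at s)" if "c \<in> X" "s \<in> chart_image c" for c s
    using V that smooth_onD(1)[OF _ chart(2)[OF that(1)]] by (simp add: smooth_field_def)
  have d\<eta>: "coeff \<eta> c field_differentiable (at s)" if "c \<in> X" "s \<in> chart_image c" for c s
    by (rule holomorphic_on_imp_differentiable_at[OF H0K_D(2)[OF \<eta> that(1)] chart(2)[OF that(1)] that(2)])
  have dV\<eta>: "(\<lambda>s. coeff V c s * coeff \<eta> c s) differentiable (at s)" if "c \<in> X" "s \<in> chart_image c" for c s
    by (intro differentiable_mult dV[OF that] wirtinger_holomorphic(1)[OF d\<eta>[OF that]])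
  show "coeff (del X h') c t = coeff (del X h) c t - d_z (\<lambda>s. coeff V c s * coeff \<eta> c s) t"
    if c: "c \<in> X" and t: "t \<in> chart_image c" for c t
    unfolding coeff_del[OF c t] wirtinger_minus(1)[OF dh[OF c t] dV\<eta>[OF c t], symmetric]
    by (rule wirtinger_cong(2)[OF chart(2)[OF c] t]) (rule local[OF c])
  have dbar': "d_zbar (h' \<circ> chart_inv c) s = coeff \<Theta>0 c s * coeff \<eta> c s - coeff \<gamma> c s"
    if c: "c \<in> X" and s: "s \<in> chart_image c" for c s
  proof -
    have "d_zbar (h' \<circ> chart_inv c) s = d_zbar (\<lambda>s. (h \<circ> chart_inv c) s - coeff V c s * coeff \<eta> c s) s"
      by (rule wirtinger_cong(3)[OF chart(2)[OF c] s]) (rule local[OF c])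
    also have "\<dots> = d_zbar (h \<circ> chart_inv c) s - d_zbar (coeff V c) s * coeff \<eta> c s"
      unfolding wirtinger_minus(2)[OF dh[OF c s] dV\<eta>[OF c s]]
        wirtinger_mult(2)[OF dV[OF c s] wirtinger_holomorphic(1)[OF d\<eta>[OF c s]]]
        wirtinger_holomorphic(3)[OF d\<eta>[OF c s]] by simp
    also have "d_zbar (h \<circ> chart_inv c) s = coeff \<Theta> c s * coeff \<eta> c s - coeff \<gamma> c s"
    proof -
      have "coeff (dbar X (\<lambda>_. h)) c s = d_zbar (h \<circ> chart_inv c) s"
        unfolding coeff_dbar[OF c s] by (simp add: coeff_def[abs_def] comp_def)
      then show ?thesis using dec[of c "chart_inv c s"] by (simp add: coeff_def)
    qed
    also have "coeff \<Theta> c s = coeff \<Theta>0 c s + d_zbar (coeff V c) s"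
      using \<Theta>[of c "chart_inv c s"] unfolding coeff_dbar[OF c s, symmetric] by (simp add: coeff_def)
    finally have e: "d_zbar (h' \<circ> chart_inv c) s = (coeff \<Theta>0 c s + d_zbar (coeff V c) s) * coeff \<eta> c s
        - coeff \<gamma> c s - d_zbar (coeff V c) s * coeff \<eta> c s" .
    show ?thesis unfolding e by (simp add: algebra_simps)
  qed
  show "hodge_lift \<eta> h'"
    unfolding hodge_lift_def
  proof (intro conjI ballI sm')
    fix c t assume c: "c \<in> X" and t: "t \<in> chart_image c"
    have sh: "smooth_on (chart_image c) (h' \<circ> chart_inv c)" using sm' c by (simp add: smooth_fun_def)
    have d1: "(\<lambda>s. coeff \<Theta>0 c s * coeff \<eta> c s) differentiable (at t)"
      by (intro differentiable_mult smooth_onD(1)[OF smooth_theta[OF c] chart(2)[OF c] t]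
          wirtinger_holomorphic(1)[OF d\<eta>[OF c t]])
    have d2: "coeff \<gamma> c differentiable (at t)" "d_z (coeff \<gamma> c) t = 0"
      using \<gamma> c t smooth_onD(1)[OF _ chart(2)[OF c]] by (auto simp: harmonic01_def smooth_field_def)
    have "d_zbar (coeff (del X h') c) t = d_zbar (d_z (h' \<circ> chart_inv c)) t"
      by (rule wirtinger_cong(3)[OF chart(2)[OF c] t]) (rule coeff_del[OF c])
    also have "\<dots> = d_z (d_zbar (h' \<circ> chart_inv c)) t"
      by (rule wirtinger_commute[OF sh chart(2)[OF c] t, symmetric])
    also have "\<dots> = d_z (\<lambda>s. coeff \<Theta>0 c s * coeff \<eta> c s - coeff \<gamma> c s) t"
      by (rule wirtinger_cong(2)[OF chart(2)[OF c] t]) (rule dbar'[OF c])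
    also have "\<dots> = d_z (\<lambda>s. coeff \<Theta>0 c s * coeff \<eta> c s) t"
      unfolding wirtinger_minus(1)[OF d1 d2(1)] d2(2) by simp
    finally show "d_zbar (coeff (del X h') c) t = d_z (\<lambda>s. coeff \<Theta>0 c s * coeff \<eta> c s) t" .
  qed
qed

text \<open>The quadratic differential does not change when the lifts are adapted to the representative \<open>\<Theta>0\<close>,
since \<open>\<Sum> a\<^sub>i\<^sub>j \<eta>\<^sub>i \<partial>(V \<eta>\<^sub>j) = 0\<close>.\<close>

lemma second_fundamental_form_lift:
  assumes "second_fundamental_form X Q (dolbeault_class X \<Theta>0) q"
  obtains N a \<eta> h where "sym_presentation X Q N a \<eta>" "\<And>i. i < N \<Longrightarrow> \<eta> i \<in> H0K X 1"
    "\<And>i. i < N \<Longrightarrow> hodge_lift (\<eta> i) (h i)"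
    "\<And>c x. q c x = (\<Sum>i<N. \<Sum>j<N. a i j * \<eta> i c x * del X (h j) c x)"
proof -
  from assms obtain \<Theta> N a \<eta> \<gamma> h where Q: "Q \<in> I2 X" and \<Theta>: "\<Theta> \<in> dolbeault_class X \<Theta>0"
    and pres: "sym_presentation X Q N a \<eta>"
    and dec: "\<forall>i<N. harmonic01 X (\<gamma> i) \<and> smooth_fun X (h i) \<and>
           (\<forall>c p. \<Theta> c p * \<eta> i c p = \<gamma> i c p + dbar X (\<lambda>_. h i) c p)"
    and q: "q = (\<lambda>c p. \<Sum>i<N. \<Sum>j<N. a i j * \<eta> i c p * del X (h j) c p)"
    unfolding second_fundamental_form_def by (elim conjE bexE exE) (rule that)
  obtain V where V: "smooth_field X (-1) 0 V" "\<And>c x. \<Theta> c x = \<Theta>0 c x + dbar X V c x"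
    using \<Theta> unfolding dolbeault_class_def by blast
  have \<eta>: "\<eta> i \<in> H0K X 1" if "i < N" for i by (rule sym_presentationD[OF pres]) (use that in simp_all)
  define h' where "h' = (\<lambda>i x. h i x - V (chart_at X x) x * \<eta> i (chart_at X x) x)"
  have lift: "hodge_lift (\<eta> i) (h' i)"
    and del: "\<And>c t. c \<in> X \<Longrightarrow> t \<in> chart_image c \<Longrightarrow>
      coeff (del X (h' i)) c t = coeff (del X (h i)) c t - d_z (\<lambda>s. coeff V c s * coeff (\<eta> i) c s) t"
    if i: "i < N" for i
    using hodge_lift_of_representative[OF V(2,1) \<eta>[OF i], of "\<gamma> i" "h i"] dec i unfolding h'_def by auto
  have "q c x = (\<Sum>i<N. \<Sum>j<N. a i j * \<eta> i c x * del X (h' j) c x)" for c x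
  proof (cases "c \<in> X \<and> x \<in> fst c")
    case True
    then have c: "c \<in> X" and x: "x \<in> fst c" by auto
    let ?t = "snd c x"
    have t: "?t \<in> chart_image c" "chart_inv c ?t = x" using chart(5,6)[OF c x] by auto
    have dV: "coeff V c differentiable (at ?t)"
      using V(1) c t smooth_onD(1)[OF _ chart(2)[OF c]] by (simp add: smooth_field_def)
    have "(\<Sum>i<N. \<Sum>j<N. a i j * \<eta> i c x * del X (h' j) c x) =
        (\<Sum>i<N. \<Sum>j<N. a i j * \<eta> i c x * del X (h j) c x - a i j * (coeff (\<eta> i) c ?t * d_z (\<lambda>s. coeff V c s * coeff (\<eta> j) c s) ?t))"
    proof (intro sum.cong refl)
      fix i j assume "j \<in> {..<N}"
      then have e1: "del X (h' j) c x = del X (h j) c x - d_z (\<lambda>s. coeff V c s * coeff (\<eta> j) c s) ?t"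
        using del[of j c ?t] c t unfolding coeff_def[of "del X (h' j)"] coeff_def[of "del X (h j)"] by simp
      have e2: "coeff (\<eta> i) c ?t = \<eta> i c x" using t by (simp add: coeff_def)
      show "a i j * \<eta> i c x * del X (h' j) c x =
        a i j * \<eta> i c x * del X (h j) c x - a i j * (coeff (\<eta> i) c ?t * d_z (\<lambda>s. coeff V c s * coeff (\<eta> j) c s) ?t)"
        unfolding e1 e2 by (simp add: algebra_simps)
    qed
    also have "\<dots> = (\<Sum>i<N. \<Sum>j<N. a i j * \<eta> i c x * del X (h j) c x)"
      using quadric_d_z[OF pres Q c t(1) dV] by (simp add: sum_subtractf)
    finally show ?thesis by (simp add: q)
  next
    case False
    then show ?thesis unfolding q by (auto simp: del_def)
  qed
  then show ?thesis using that[OF pres \<eta> lift] by blast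
qed

text \<open>The \<open>\<partial>/\<partial>z'\<close>-derivative is \<open>\<Sum> a\<^sub>i\<^sub>j \<eta>\<^sub>i \<partial>(\<Theta>0 \<eta>\<^sub>j)\<close>, which vanishes for \<open>Q\<close> in \<open>I\<^sub>2\<close>.\<close>

lemma holomorphic_second_fundamental_form:
  assumes pres: "sym_presentation X Q N a \<eta>" and Q: "Q \<in> I2 X"
    and lift: "\<And>i. i < N \<Longrightarrow> hodge_lift (\<eta> i) (h i)"
    and q: "\<And>c x. q c x = (\<Sum>i<N. \<Sum>j<N. a i j * \<eta> i c x * del X (h j) c x)"
  shows "q \<in> H0K X 2"
proof -
  have \<eta>: "\<eta> i \<in> H0K X 1" if "i < N" for i by (rule sym_presentationD[OF pres]) (use that in simp_all)
  have sh: "smooth_fun X (h i)" if "i < N" for i using lift[OF that] by (simp add: hodge_lift_def)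
  have q': "q = (\<lambda>c x. \<Sum>i<N. \<Sum>j<N. a i j * (\<eta> i c x * del X (h j) c x))"
    by (simp add: fun_eq_iff q mult.assoc)
  have s1: "smooth_field X 2 0 (\<lambda>c x. \<eta> i c x * del X (h j) c x)" if "i < N" "j < N" for i j
    using smooth_field_mult[OF H0K_smooth_field[OF \<eta>[OF that(1)]] smooth_field_del[OF sh[OF that(2)]]] by simp
  have sq: "smooth_field X 2 0 q"
    unfolding q'
  proof (intro smooth_field_sum)
    fix i j assume "i \<in> {..<N}" "j \<in> {..<N}"
    then show "smooth_field X 2 0 (\<lambda>c x. a i j * (\<eta> i c x * del X (h j) c x))"
      using smooth_field_scale[OF smooth_fun_const s1[of i j]] by simp
  qed
  show ?thesis
    unfolding H0K_def
  proof (intro CollectI conjI ballI)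
    show "tensor_field X 2 0 q" using sq by (simp add: smooth_field_def)
    fix c assume c: "c \<in> X"
    show "coeff q c holomorphic_on chart_image c"
    proof (rule holomorphic_of_smooth[OF _ chart(2)[OF c]])
      show "smooth_on (chart_image c) (coeff q c)" using sq c by (simp add: smooth_field_def)
      fix t assume t: "t \<in> chart_image c"
      have d\<eta>: "coeff (\<eta> i) c field_differentiable (at t)" if "i < N" for i
        by (rule holomorphic_on_imp_differentiable_at[OF H0K_D(2)[OF \<eta>[OF that] c] chart(2)[OF c] t])
      have dd: "coeff (del X (h j)) c differentiable (at t)" if "j < N" for j
        using smooth_field_del[OF sh[OF that]] c t smooth_onD(1)[OF _ chart(2)[OF c]] by (simp add: smooth_field_def)
      have m: "(\<lambda>s. coeff (\<eta> i) c s * coeff (del X (h j)) c s) differentiable (at t)" if "i < N" "j < N" for i j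
        by (intro differentiable_mult wirtinger_holomorphic(1)[OF d\<eta>[OF that(1)]] dd[OF that(2)])
      have m2: "d_zbar (\<lambda>s. a i j * (coeff (\<eta> i) c s * coeff (del X (h j)) c s)) t =
          a i j * (coeff (\<eta> i) c t * d_z (\<lambda>s. coeff \<Theta>0 c s * coeff (\<eta> j) c s) t)" if "i < N" "j < N" for i j
        unfolding wirtinger_cmult(2)[OF m[OF that]]
          wirtinger_mult(2)[OF wirtinger_holomorphic(1)[OF d\<eta>[OF that(1)]] dd[OF that(2)]]
          wirtinger_holomorphic(3)[OF d\<eta>[OF that(1)]]
        using lift[OF that(2)] c t by (simp add: hodge_lift_def)
      have qc: "coeff q c = (\<lambda>s. \<Sum>i<N. \<Sum>j<N. a i j * (coeff (\<eta> i) c s * coeff (del X (h j)) c s))"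
        by (simp add: q' coeff_def fun_eq_iff)
      have "d_zbar (coeff q c) t = (\<Sum>i<N. d_zbar (\<lambda>s. \<Sum>j<N. a i j * (coeff (\<eta> i) c s * coeff (del X (h j)) c s)) t)"
        unfolding qc by (rule wirtinger_sum(3)) (intro wirtinger_sum(1) differentiable_mult differentiable_const m, auto)
      also have "\<dots> = (\<Sum>i<N. \<Sum>j<N. d_zbar (\<lambda>s. a i j * (coeff (\<eta> i) c s * coeff (del X (h j)) c s)) t)"
      proof (rule sum.cong[OF refl])
        fix i assume "i \<in> {..<N}"
        then show "d_zbar (\<lambda>s. \<Sum>j<N. a i j * (coeff (\<eta> i) c s * coeff (del X (h j)) c s)) t =
            (\<Sum>j<N. d_zbar (\<lambda>s. a i j * (coeff (\<eta> i) c s * coeff (del X (h j)) c s)) t)"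
          using m[of i] by (intro wirtinger_sum(3)) (intro differentiable_mult[OF differentiable_const], auto)
      qed
      also have "\<dots> = (\<Sum>i<N. \<Sum>j<N. a i j * (coeff (\<eta> i) c t * d_z (\<lambda>s. coeff \<Theta>0 c s * coeff (\<eta> j) c s) t))"
        using m2 by (intro sum.cong refl) auto
      also have "\<dots> = 0"
        by (rule quadric_d_z[OF pres Q c t smooth_onD(1)[OF smooth_theta[OF c] chart(2)[OF c] t]])
      finally show "d_zbar (coeff q c) t = 0" .
    qed
  qed
qed

section \<open>The integral of a quadratic differential against the class\<close>

text \<open>For holomorphic \<open>q\<close> the product \<open>q \<partial>\<close>-bar\<open> V\<close> is the exact form \<open>\<partial>\<close>-bar\<open>(q V)\<close>.\<close>

lemma quadratic_times_representative:
  assumes q: "q \<in> H0K X 2" and \<Theta>: "\<Theta> \<in> dolbeault_class X \<Theta>0"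
  obtains W where "smooth_field X 1 0 W" "smooth_field X 1 1 (\<lambda>c x. q c x * \<Theta> c x)"
    "\<And>c x. q c x * \<Theta> c x = q c x * \<Theta>0 c x + dbar X W c x"
proof -
  obtain V where sm: "smooth_field X (-1) 1 \<Theta>" and V: "smooth_field X (-1) 0 V"
    "\<And>c x. \<Theta> c x = \<Theta>0 c x + dbar X V c x"
    using \<Theta> unfolding dolbeault_class_def by blast
  let ?W = "\<lambda>c x. q c x * V c x"
  note sq = H0K_smooth_field[OF q]
  have "smooth_field X 1 0 ?W" using smooth_field_mult[OF sq V(1)] by simp
  moreover have "smooth_field X 1 1 (\<lambda>c x. q c x * \<Theta> c x)" using smooth_field_mult[OF sq sm] by simp
  moreover have "q c x * \<Theta> c x = q c x * \<Theta>0 c x + dbar X ?W c x" for c x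
  proof (cases "c \<in> X \<and> x \<in> fst c")
    case True
    then have c: "c \<in> X" and x: "x \<in> fst c" by auto
    let ?t = "snd c x"
    have t: "?t \<in> chart_image c" "chart_inv c ?t = x" using chart(5,6)[OF c x] by auto
    have dq: "coeff q c field_differentiable (at ?t)"
      by (rule holomorphic_on_imp_differentiable_at[OF H0K_D(2)[OF q c] chart(2)[OF c] t(1)])
    have dV: "coeff V c differentiable (at ?t)"
      using V(1) c t smooth_onD(1)[OF _ chart(2)[OF c]] by (simp add: smooth_field_def)
    have "dbar X ?W c x = d_zbar (\<lambda>s. coeff q c s * coeff V c s) ?t"
      using True by (simp add: dbar_def coeff_def[abs_def])
    also have "\<dots> = coeff q c ?t * d_zbar (coeff V c) ?t"
      unfolding wirtinger_mult(2)[OF wirtinger_holomorphic(1)[OF dq] dV] wirtinger_holomorphic(3)[OF dq] by simp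
    also have "\<dots> = q c x * dbar X V c x" using True t(2) by (simp add: dbar_def coeff_def[of q])
    finally show ?thesis using V(2)[of c x] by (simp add: distrib_left)
  next
    case False
    then show ?thesis using V(2)[of c x] by (auto simp: dbar_def distrib_left)
  qed
  ultimately show ?thesis by (rule that)
qed

lemma coeff_omega_nonzero:
  assumes p: "p \<in> Z" and t: "t \<in> chart_image (z p)" "t \<noteq> 0"
  shows "coeff \<omega> (z p) t \<noteq> 0" "chart_inv (z p) t \<notin> Z"
proof -
  note c = zc(1)[OF p]
  show *: "chart_inv (z p) t \<notin> Z"
  proof
    assume m: "chart_inv (z p) t \<in> Z"
    have "chart_inv (z p) t = p"
      using other_chart[OF p m chart(7)[OF c t(1)] zc(2)[OF m]] .
    then have "t = snd (z p) p" using chart(8)[OF c t(1)] by simp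
    then show False using zc(3)[OF p] t(2) by simp
  qed
  then show "coeff \<omega> (z p) t \<noteq> 0" using coeff_zero_iff[OF omega_tf c t(1)] by simp
qed

text \<open>In the coordinate around \<open>p\<close> the integrand is the \<open>\<partial>/\<partial>z'\<close>-derivative of \<open>F = q \<rho>/\<omega>\<close>, extended by \<open>0\<close> to the
whole plane; near \<open>0\<close> this function is the meromorphic \<open>f\<^sub>p q/\<omega>\<close>.\<close>

lemma local_residue_integral:
  assumes p: "p \<in> Z" and q: "q \<in> H0K X 2"
  shows "integral (chart_image (z p)) (coeff (\<lambda>c x. q c x * \<Theta>0 c x) (z p)) =
    - of_real pi * residue (\<lambda>t. f p t * coeff q (z p) t / coeff \<omega> (z p) t) 0"
proof -
  note c = zc(1)[OF p]
  let ?U = "chart_image (z p)"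
  let ?G = "\<lambda>t. coeff q (z p) t * (\<rho> (chart_inv (z p) t) / coeff \<omega> (z p) t)"
  define F where "F = (\<lambda>t. if t \<in> ?U then ?G t else 0)"
  note U = chart(2)[OF c]
  have RU: "cball 0 (R p) \<subseteq> ?U" using radii[OF p] by blast
  have oU0: "open (?U - {0})" using U by (simp add: open_delete)
  have far: "F t = 0" if "norm t > R p" for t
  proof (cases "t \<in> ?U")
    case True
    have "chart_inv (z p) t \<notin> disks"
      using disks_chart[OF p chart(7)[OF c True]] chart(8)[OF c True] that by (auto simp: coord_disk_def)
    then show ?thesis using rho_zero by (simp add: F_def)
  qed (simp add: F_def)
  have s1: "smooth_on (?U - {0}) ?G"
  proof (intro smooth_on_mult smooth_on_divide oU0)
    show "smooth_on (?U - {0}) (coeff q (z p))"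
      by (rule smooth_on_subset[OF smooth_on_holomorphic[OF U H0K_D(2)[OF q c]]]) auto
    have "smooth_on ?U (\<rho> \<circ> chart_inv (z p))" using smooth_rho c by (simp add: smooth_fun_def)
    then show "smooth_on (?U - {0}) (\<lambda>t. \<rho> (chart_inv (z p) t))"
      unfolding comp_def by (rule smooth_on_subset) auto
    show "smooth_on (?U - {0}) (coeff \<omega> (z p))"
      by (rule smooth_on_subset[OF smooth_on_holomorphic[OF U H0K_D(2)[OF omega(1) c]]]) auto
    show "coeff \<omega> (z p) t \<noteq> 0" if "t \<in> ?U - {0}" for t
      using coeff_omega_nonzero(1)[OF p] that by auto
  qed
  have F1: "smooth_on (?U - {0}) F"
    by (subst smooth_on_cong[OF oU0, of _ ?G]) (use s1 in \<open>auto simp: F_def\<close>)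
  have oR: "open (- cball 0 (R p) :: complex set)" by (simp add: open_Compl)
  have F2: "smooth_on (- cball 0 (R p)) F"
    by (subst smooth_on_cong[OF oR, of _ "\<lambda>_. 0"]) (use far smooth_on_const[OF oR] in auto)
  have F: "smooth_on (- {0}) F"
  proof (rule smooth_on_local)
    fix t :: complex assume t: "t \<in> - {0}"
    show "\<exists>T. open T \<and> t \<in> T \<and> smooth_on T F"
    proof (cases "t \<in> ?U")
      case True
      then show ?thesis using F1 oU0 t by (intro exI[of _ "?U - {0}"]) auto
    next
      case False
      then show ?thesis using F2 oR RU by (intro exI[of _ "- cball 0 (R p)"]) auto
    qed
  qed
  have rp: "0 < r p" using radii[OF p] by simp
  have ob: "open (ball 0 (r p) - {0 :: complex})" by (simp add: open_delete)
  have Fr: "F t = f p t * coeff q (z p) t / coeff \<omega> (z p) t" if "t \<in> ball 0 (r p) - {0}" for t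
  proof -
    have t: "t \<in> ball 0 (r p)" "t \<in> ?U" using that core(7)[OF p] by auto
    have "\<rho> (chart_inv (z p) t) = f p t"
      using core(4)[OF p core(6)[OF p t(1)]] chart(8)[OF c t(2)] by simp
    then show ?thesis using t(2) by (simp add: F_def)
  qed
  have "(\<lambda>t. f p t * coeff q (z p) t / coeff \<omega> (z p) t) holomorphic_on ball 0 (r p) - {0}"
    using core(7)[OF p] coeff_omega_nonzero(1)[OF p]
    by (intro holomorphic_intros holomorphic_on_subset[OF f_hol[OF p]] holomorphic_on_subset[OF H0K_D(2)[OF q c]]
        holomorphic_on_subset[OF H0K_D(2)[OF omega(1) c]]) auto
  then have hol: "F holomorphic_on ball 0 (r p) - {0}"
    by (rule holomorphic_transform) (simp add: Fr)
  have dF: "d_zbar F t = coeff (\<lambda>c x. q c x * \<Theta>0 c x) (z p) t" if t: "t \<in> ?U" "t \<noteq> 0" for t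
  proof -
    have dq: "coeff q (z p) field_differentiable (at t)"
      by (rule holomorphic_on_imp_differentiable_at[OF H0K_D(2)[OF q c] U t(1)])
    have d\<rho>: "(\<lambda>s. \<rho> (chart_inv (z p) s)) differentiable (at t)"
      using smooth_rho c t smooth_onD(1)[OF _ U] by (simp add: smooth_fun_def comp_def)
    have "(\<lambda>s. inverse (coeff \<omega> (z p) s)) holomorphic_on ?U - {0}"
      using coeff_omega_nonzero(1)[OF p]
      by (intro holomorphic_on_inverse holomorphic_on_subset[OF H0K_D(2)[OF omega(1) c]]) auto
    then have "(\<lambda>s. inverse (coeff \<omega> (z p) s)) field_differentiable (at t)"
      using holomorphic_on_imp_differentiable_at oU0 t by blast
    from differentiable_mult[OF d\<rho> wirtinger_holomorphic(1)[OF this]]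
    have dq2: "(\<lambda>s. \<rho> (chart_inv (z p) s) / coeff \<omega> (z p) s) differentiable (at t)" by (simp add: divide_inverse)
    have "d_zbar F t = d_zbar ?G t"
      by (rule wirtinger_cong(3)[OF U t(1)]) (simp add: F_def)
    also have "\<dots> = coeff q (z p) t * d_zbar (\<lambda>s. \<rho> (chart_inv (z p) s) / coeff \<omega> (z p) s) t"
      unfolding wirtinger_mult(2)[OF wirtinger_holomorphic(1)[OF dq] dq2] wirtinger_holomorphic(3)[OF dq] by simp
    also have "\<dots> = coeff q (z p) t * coeff \<Theta>0 (z p) t"
      using theta_off_Z(1)[OF c t(1) coeff_omega_nonzero(2)[OF p t]] by simp
    finally show ?thesis by (simp add: coeff_def)
  qed
  have "integral ?U (coeff (\<lambda>c x. q c x * \<Theta>0 c x) (z p)) = integral ?U (\<lambda>t. if t = 0 then 0 else d_zbar F t)"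
  proof (rule integral_cong)
    fix t assume t: "t \<in> ?U"
    show "coeff (\<lambda>c x. q c x * \<Theta>0 c x) (z p) t = (if t = 0 then 0 else d_zbar F t)"
    proof (cases "t = 0")
      case True
      have "chart_inv (z p) 0 = p" using chart(5)[OF c zc(2)[OF p]] zc(3)[OF p] by simp
      then show ?thesis using True p by (simp add: coeff_def dbar_quotient_def)
    qed (simp add: dF[OF t])
  qed
  also have "\<dots> = integral UNIV (\<lambda>t. if t = 0 then 0 else d_zbar F t)"
  proof (rule integral_zero_outside[symmetric])
    fix t assume t: "t \<in> UNIV - ?U"
    then have "d_zbar F t = d_zbar (\<lambda>_. 0) t"
      using RU far by (intro wirtinger_cong(3)[OF oR]) auto
    then show "(if t = 0 then 0 else d_zbar F t) = 0" by simp
  qed simp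
  also have "\<dots> = - of_real pi * residue F 0"
    by (rule integral_dbar_residue[OF F far rp hol])
  also have "residue F 0 = residue (\<lambda>t. f p t * coeff q (z p) t / coeff \<omega> (z p) t) 0"
  proof (rule residue_cong[OF _ refl])
    have "\<forall>\<^sub>F t in at 0. t \<in> ball 0 (r p) - {0}"
      using rp by (intro eventually_at_in_open) auto
    then show "\<forall>\<^sub>F t in at 0. F t = f p t * coeff q (z p) t / coeff \<omega> (z p) t"
      by (rule eventually_mono) (rule Fr)
  qed
  finally show ?thesis .
qed

text \<open>The support of \<open>\<Theta>0\<close> lies in the disjoint coordinate disks, so the integral splits into one local
contribution \<open>\<tau>\<^sub>p\<close> for each zero. The factor \<open>-2 i\<close> comes from \<open>dz \<and> dz' = -2 i dx \<and> dy\<close>.\<close>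

lemma integral_quadratic_theta:
  assumes P: "partition_of_unity X N c \<psi>" and q: "q \<in> H0K X 2"
    and sm: "smooth_field X 1 1 (\<lambda>c x. q c x * \<Theta>0 c x)"
  shows "partition_integral N c \<psi> (\<lambda>c x. q c x * \<Theta>0 c x) =
    2 * of_real pi * \<i> * (\<Sum>p\<in>Z. residue (\<lambda>t. f p t * coeff q (z p) t / coeff \<omega> (z p) t) 0)"
proof -
  let ?\<sigma> = "\<lambda>c x. q c x * \<Theta>0 c x"
  define \<tau> where "\<tau> = (\<lambda>p e x. (if x \<in> fst (z p) then 1 else 0) * ?\<sigma> e x)"
  have split: "?\<sigma> e x = (\<Sum>p\<in>Z. \<tau> p e x)" for e x
  proof (cases "x \<in> disks")
    case True
    then obtain p where p: "p \<in> Z" "x \<in> fst (z p)" by (auto simp: disks_def coord_disk_def)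
    have "(\<Sum>p'\<in>Z. \<tau> p' e x) = (\<Sum>p'\<in>Z. if p' = p then ?\<sigma> e x else 0)"
    proof (rule sum.cong[OF refl])
      fix p' assume p': "p' \<in> Z"
      show "\<tau> p' e x = (if p' = p then ?\<sigma> e x else 0)"
      proof (cases "p' = p")
        case True
        then show ?thesis using p(2) by (simp add: \<tau>_def)
      next
        case False
        then have "x \<notin> fst (z p')" using other_chart[OF p(1) p' p(2)] by blast
        then show ?thesis using False by (simp add: \<tau>_def)
      qed
    qed
    then show ?thesis using p(1) finite_Z by simp
  next
    case False
    then show ?thesis by (simp add: \<tau>_def theta_off_disks)
  qed
  have supp: "\<tau> p e x = 0" if p: "p \<in> Z" and x: "x \<notin> coord_disk (z p) (R p)" for p e x
  proof (cases "x \<in> fst (z p)")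
    case True
    then have "x \<notin> disks" using disks_chart[OF p True] x by blast
    then show ?thesis by (simp add: \<tau>_def theta_off_disks)
  qed (simp add: \<tau>_def)
  have form: "continuous_form (\<tau> p)" if p: "p \<in> Z" for p
    unfolding continuous_form_def
  proof (intro conjI ballI)
    show "tensor_field X 1 1 (\<tau> p)"
      unfolding \<tau>_def using sm by (intro tensor_field_scale) (simp add: smooth_field_def)
    fix e assume e: "e \<in> X"
    let ?A = "{t \<in> chart_image e. chart_inv e t \<in> fst (z p)}"
    let ?B = "{t \<in> chart_image e. chart_inv e t \<in> - coord_disk (z p) (R p)}"
    have o: "open ?A" "open ?B"
      using compact_imp_closed[OF compact_coord_disk[OF p]]
      by (intro open_chart_image_of[OF e] chart(1)[OF zc(1)[OF p]] open_Compl)+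
    have "continuous_on (chart_image e) (coeff ?\<sigma> e)"
      using sm e smooth_onD(2)[OF _ chart(2)[OF e]] by (simp add: smooth_field_def)
    then have "continuous_on ?A (coeff ?\<sigma> e)" by (rule continuous_on_subset) auto
    then have "continuous_on ?A (coeff (\<tau> p) e)"
      by (rule continuous_on_eq) (simp add: coeff_def \<tau>_def)
    moreover have "continuous_on ?B (coeff (\<tau> p) e)"
      by (rule continuous_on_eq[OF continuous_on_const[of _ 0]]) (simp add: coeff_def supp[OF p])
    ultimately have "continuous_on (?A \<union> ?B) (coeff (\<tau> p) e)" by (rule continuous_on_open_Un[OF o])
    moreover have "?A \<union> ?B = chart_image e" by (auto simp: coord_disk_def)
    ultimately show "continuous_on (chart_image e) (coeff (\<tau> p) e)" by simp
  qed
  have "partition_integral N c \<psi> ?\<sigma> = partition_integral N c \<psi> (\<lambda>e x. \<Sum>p\<in>Z. \<tau> p e x)"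
    by (simp add: split)
  also have "\<dots> = (\<Sum>p\<in>Z. partition_integral N c \<psi> (\<tau> p))"
    by (rule partition_integral_sum[OF P finite_Z form])
  also have "\<dots> = (\<Sum>p\<in>Z. 2 * of_real pi * \<i> * residue (\<lambda>t. f p t * coeff q (z p) t / coeff \<omega> (z p) t) 0)"
  proof (rule sum.cong[OF refl])
    fix p assume p: "p \<in> Z"
    note zp = zc(1)[OF p]
    have "partition_integral N c \<psi> (\<tau> p) = -2 * \<i> * integral (chart_image (z p)) (coeff (\<tau> p) (z p))"
    proof (rule partition_integral_localized[OF P form[OF p] zp compact_coord_disk[OF p]])
      show "coord_disk (z p) (R p) \<subseteq> fst (z p)" by (auto simp: coord_disk_def)
    qed (rule supp[OF p])
    also have "integral (chart_image (z p)) (coeff (\<tau> p) (z p)) = integral (chart_image (z p)) (coeff ?\<sigma> (z p))"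
      using chart(7)[OF zp] by (intro integral_cong) (simp add: coeff_def \<tau>_def)
    finally show "partition_integral N c \<psi> (\<tau> p) = 2 * of_real pi * \<i> * residue (\<lambda>t. f p t * coeff q (z p) t / coeff \<omega> (z p) t) 0"
      unfolding local_residue_integral[OF p q] by simp
  qed
  finally show ?thesis by (simp add: sum_distrib_left)
qed

text \<open>The pairing is computed with an arbitrarily chosen representative; all of them give the same value
because they differ from \<open>\<Theta>0\<close> by an exact form.\<close>

lemma serre_pairing_residue:
  assumes q: "q \<in> H0K X 2" and ne: "dolbeault_class X \<Theta>0 \<noteq> {}"
  shows "serre_pairing X q (dolbeault_class X \<Theta>0) =
    2 * of_real pi * \<i> * (\<Sum>p\<in>Z. residue (\<lambda>t. f p t * coeff q (z p) t / coeff \<omega> (z p) t) 0)" (is "_ = ?r")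
proof -
  have eq: "surface_integral X (\<lambda>c p. q c p * \<Theta> c p) = ?r" if \<Theta>: "\<Theta> \<in> dolbeault_class X \<Theta>0" for \<Theta>
  proof -
    obtain W where W: "smooth_field X 1 0 W" "smooth_field X 1 1 (\<lambda>c x. q c x * \<Theta> c x)"
      "\<And>c x. q c x * \<Theta> c x = q c x * \<Theta>0 c x + dbar X W c x"
      using quadratic_times_representative[OF q \<Theta>] by metis
    have "smooth_field X 1 1 (\<lambda>c x. q c x * \<Theta> c x + (-1) * dbar X W c x)"
      by (intro smooth_field_add W(2) smooth_field_scale[OF smooth_fun_const] smooth_field_dbar[OF W(1)])
    then have sm: "smooth_field X 1 1 (\<lambda>c x. q c x * \<Theta>0 c x)" by (simp add: W(3))
    show ?thesis
    proof (rule surface_integral_eq)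
      fix N c \<psi> assume P: "partition_of_unity X N c \<psi>"
      have "partition_integral N c \<psi> (\<lambda>c p. q c p * \<Theta> c p) =
          partition_integral N c \<psi> (\<lambda>c p. q c p * \<Theta>0 c p) + partition_integral N c \<psi> (dbar X W)"
        unfolding W(3)
        by (rule partition_integral_add[OF P continuous_form_of_smooth[OF sm]
              continuous_form_of_smooth[OF smooth_field_dbar[OF W(1)]]])
      then show "partition_integral N c \<psi> (\<lambda>c p. q c p * \<Theta> c p) = ?r"
        using stokes[OF P W(1)] integral_quadratic_theta[OF P q sm] by simp
    qed
  qed
  obtain \<Theta> where \<Theta>: "\<Theta> \<in> dolbeault_class X \<Theta>0" using ne by blast
  show ?thesis
    unfolding serre_pairing_def
  proof (rule some_equality)
    show "\<exists>\<Theta>\<in>dolbeault_class X \<Theta>0. ?r = surface_integral X (\<lambda>c p. q c p * \<Theta> c p)"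
      using eq[OF \<Theta>] \<Theta> by (intro bexI[of _ \<Theta>]) simp_all
  next
    fix v assume "\<exists>\<Theta>\<in>dolbeault_class X \<Theta>0. v = surface_integral X (\<lambda>c p. q c p * \<Theta> c p)"
    then show "v = ?r" using eq by blast
  qed
qed

end

section \<open>The formula for the second fundamental form\<close>

lemma sum_sect2_apply: "(\<Sum>i\<in>A. F i) c x d y = (\<Sum>i\<in>A. F i c x d y :: complex)"
  by (induction A rule: infinite_finite_induct) simp_all

theorem proposition4p4:
  fixes X :: "'a::t2_space chart set"
    and \<omega> :: "'a sect"
    and n :: "'a \<Rightarrow> nat"
    and z :: "'a \<Rightarrow> 'a chart"
    and \<beta> :: "'a \<Rightarrow> nat \<Rightarrow> complex"
    and f :: "'a \<Rightarrow> complex \<Rightarrow> complex"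
    and r R :: "'a \<Rightarrow> real"
    and \<rho>' \<rho> :: "'a \<Rightarrow> complex"
    and \<zeta> :: "'a sect set"
    and s :: nat
    and om :: "nat \<Rightarrow> 'a sect"
    and Q :: "'a sect2"
    and q :: "'a sect"
  assumes "compact_riemann_surface X"
    and "genus X \<ge> 4"
    and "\<not> hyperelliptic X"
    and "\<omega> \<in> H0K X 1" and "\<omega> \<noteq> 0"
    and "\<And>p. p \<in> zeros X \<omega> \<Longrightarrow> z p \<in> X \<and> p \<in> fst (z p) \<and> snd (z p) p = 0"
    and "disjoint_family_on (\<lambda>p. fst (z p)) (zeros X \<omega>)"
    and "\<And>p. p \<in> zeros X \<omega> \<Longrightarrow> int (n p) = order_at (z p) \<omega> p"
    and "\<And>p t. p \<in> zeros X \<omega> \<Longrightarrow> f p t = (\<Sum>j<n p. \<beta> p j * t ^ j)"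
    and "\<And>p. p \<in> zeros X \<omega> \<Longrightarrow> 0 < r p \<and> r p < R p \<and> cball 0 (R p) \<subseteq> chart_image (z p)"
    and "smooth_fun X \<rho>'"
    and "\<And>x. x \<in> (\<Union>p\<in>zeros X \<omega>. coord_disk (z p) (r p)) \<Longrightarrow> \<rho>' x = 1"
    and "\<And>x. x \<notin> (\<Union>p\<in>zeros X \<omega>. coord_disk (z p) (R p)) \<Longrightarrow> \<rho>' x = 0"
    and "\<And>x. \<rho> x = (\<Sum>p\<in>zeros X \<omega>. if x \<in> fst (z p) then \<rho>' x * f p (snd (z p) x) else 0)"
    and "\<zeta> = dolbeault_class X (dbar_quotient X \<rho> \<omega>)"
    and "\<And>i. i \<in> {1..2 * s} \<Longrightarrow> om i \<in> H0K X 1"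
    and "Q = (\<Sum>i=1..s. om (2 * i - 1) \<odot>\<^sub>s om (2 * i))"
    and "Q \<in> I2 X"
    and "\<And>i. i \<in> {1..s} \<Longrightarrow> smooth_off X (zeros X \<omega>) (\<lambda>x. \<rho> x * ratio X (om (2 * i - 1)) \<omega> x)"
    and "second_fundamental_form X Q \<zeta> q"
  shows "serre_pairing X q \<zeta> = - (\<Sum>i=1..s. w_residue X \<omega> z f (om (2 * i - 1)) (om (2 * i)))"
proof -
  note crs = assms(1)[unfolded compact_riemann_surface_def]
  have fh: "f p holomorphic_on UNIV" if "p \<in> zeros X \<omega>" for p
  proof -
    have "f p = (\<lambda>t. \<Sum>j<n p. \<beta> p j * t ^ j)" using assms(9)[OF that] by blast
    moreover have "(\<lambda>t. \<Sum>j<n p. \<beta> p j * t ^ j) holomorphic_on UNIV" by (intro holomorphic_intros)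
    ultimately show ?thesis by simp
  qed
  interpret principal_part X \<omega> z f r R \<rho>' \<rho>
  proof (unfold_locales)
    show "riemann_surface X" "compact (UNIV :: 'a set)" "connected (UNIV :: 'a set)" using crs by simp_all
    show "\<omega> \<in> H0K X 1" "\<omega> \<noteq> 0" by (fact assms(4), fact assms(5))
    show "z p \<in> X" "p \<in> fst (z p)" "snd (z p) p = 0" if "p \<in> zeros X \<omega>" for p
      using assms(6)[OF that] by simp_all
    show "disjoint_family_on (\<lambda>p. fst (z p)) (zeros X \<omega>)" by (fact assms(7))
    show "f p holomorphic_on UNIV" if "p \<in> zeros X \<omega>" for p by (rule fh[OF that])
    show "0 < r p \<and> r p < R p \<and> cball 0 (R p) \<subseteq> chart_image (z p)" if "p \<in> zeros X \<omega>" for p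
      by (rule assms(10)[OF that])
    show "smooth_fun X \<rho>'" by (fact assms(11))
    show "\<rho>' x = 1" if "x \<in> (\<Union>p\<in>zeros X \<omega>. coord_disk (z p) (r p))" for x
      by (rule assms(12)[OF that])
    show "\<rho>' x = 0" if "x \<notin> (\<Union>p\<in>zeros X \<omega>. coord_disk (z p) (R p))" for x
      by (rule assms(13)[OF that])
    show "\<rho> x = (\<Sum>p\<in>zeros X \<omega>. if x \<in> fst (z p) then \<rho>' x * f p (snd (z p) x) else 0)" for x
      by (rule assms(14))
  qed
  obtain N a \<eta> h where pres: "sym_presentation X Q N a \<eta>" and \<eta>: "\<And>i. i < N \<Longrightarrow> \<eta> i \<in> H0K X 1"
    and lift: "\<And>i. i < N \<Longrightarrow> hodge_lift (\<eta> i) (h i)"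
    and q: "\<And>c x. q c x = (\<Sum>i<N. \<Sum>j<N. a i j * \<eta> i c x * del X (h j) c x)"
  proof (rule second_fundamental_form_lift[OF assms(20)[unfolded assms(15)]], goal_cases)
    case (1 N a \<eta> h)
    show thesis by (rule 1(1)[OF 1(2-5)])
  qed
  have qH: "q \<in> H0K X 2"
    by (rule holomorphic_second_fundamental_form[OF pres assms(18) lift q])
  have ne: "dolbeault_class X (dbar_quotient X \<rho> \<omega>) \<noteq> {}"
    using assms(20)[unfolded assms(15)] unfolding second_fundamental_form_def by blast
  let ?u = "\<lambda>i. om (2 * i - 1)" and ?b = "\<lambda>i. om (2 * i)"
  have ub: "?u i \<in> H0K X 1" "?b i \<in> H0K X 1" if "i \<in> {1..s}" for i
    using that by (auto intro!: assms(16))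
  have "\<forall>i\<in>{1..s}. \<exists>v. smooth_fun X v \<and> (\<forall>x. x \<notin> zeros X \<omega> \<longrightarrow> v x = \<rho> x * ratio X (?u i) \<omega> x)"
    using assms(19) unfolding smooth_off_def by blast
  then obtain v where v: "\<And>i. i \<in> {1..s} \<Longrightarrow> smooth_fun X (v i)"
    "\<And>i x. i \<in> {1..s} \<Longrightarrow> x \<notin> zeros X \<omega> \<Longrightarrow> v i x = \<rho> x * ratio X (?u i) \<omega> x"
    by (metis (lifting))
  have tensor: "(\<Sum>i<N. \<Sum>j<N. a i j * (\<eta> i c x * \<eta> j d y)) =
      (\<Sum>i\<in>{1..s}. ?u i c x * ?b i d y + ?b i c x * ?u i d y)" for c x d y
  proof -
    have "Q c x d y = (\<Sum>i<N. \<Sum>j<N. a i j * (\<eta> i c x * \<eta> j d y))"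
      by (rule sym_presentationD(3)[OF pres])
    moreover have "Q c x d y = (\<Sum>i\<in>{1..s}. ?u i c x * ?b i d y + ?b i c x * ?u i d y)"
      unfolding assms(17) sum_sect2_apply by (simp add: odot_def tensor_def)
    ultimately show ?thesis by simp
  qed
  let ?w = "\<lambda>p i. residue (\<lambda>t. f p t * ratio X (?u i) \<omega> (chart_inv (z p) t) *
        deriv (\<lambda>s. f p s * ratio X (?b i) \<omega> (chart_inv (z p) s)) t) 0"
  have res: "residue (\<lambda>t. f p t * coeff q (z p) t / coeff \<omega> (z p) t) 0 = - (\<Sum>i=1..s. ?w p i)"
    if p: "p \<in> zeros X \<omega>" for p
  proof -
    have "coeff q (z p) = (\<lambda>t. \<Sum>i<N. \<Sum>j<N. a i j * (coeff (\<eta> i) (z p) t * coeff (del X (h j)) (z p) t))"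
      by (simp add: coeff_def fun_eq_iff q mult.assoc)
    then show ?thesis
      using residue_quadratic[OF p finite_atLeastAtMost \<eta> lift ub v tensor] by simp
  qed
  have "serre_pairing X q \<zeta> = 2 * of_real pi * \<i> *
      (\<Sum>p\<in>zeros X \<omega>. residue (\<lambda>t. f p t * coeff q (z p) t / coeff \<omega> (z p) t) 0)"
    unfolding assms(15) by (rule serre_pairing_residue[OF qH ne])
  also have "\<dots> = - (2 * of_real pi * \<i> * (\<Sum>i=1..s. \<Sum>p\<in>zeros X \<omega>. ?w p i))"
    using res by (subst sum.swap) (simp add: sum_negf)
  also have "\<dots> = - (\<Sum>i=1..s. w_residue X \<omega> z f (?u i) (?b i))"
    by (simp add: w_residue_def sum_distrib_left)
  finally show ?thesis .
qed

end
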